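(* Let $[\nu,\mu)\subset\mathbb R$ be an interval. If $[\nu,\mu)$ is good, then $M'\cap[\nu,\mu)=M''\cap[\nu,\mu)$.
   Context: For $\underline a=(a_i)_{i\in\mathbb Z}\in(\mathbb N_{>0})^{\mathbb Z}$ and $j\in\mathbb Z$ let $\lambda_j(\underline a)=[a_j;a_{j+1},a_{j+2},\ldots]+[0;a_{j-1},a_{j-2},\ldots]$ and $m(\underline a)=\sup_{j\in\mathbb Z}\lambda_j(\underline a)$. The Markov spectrum $M\subset\mathbb R$ is the set of finite values $m(\underline a)$; $S'$ denotes the set of accumulation points of $S\subset\mathbb R$ and $S''=(S')'$. Subshifts: a subshift of finite type is the set of bi-infinite sequences over a finite alphabet $\{1,\dots,A\}$ avoiding a finite list of finite words. It is symmetric if it is invariant under transposition $(a_i)\mapsto(a_{-i})$, and transitive (in particular nonempty) if for any two finite words $u,v$ occurring in its elements there is an element in which $u$ and $v$ occur without overlap, in this order. $\Sigma^+(B)=\{(a_n)_{n\ge0}:(a_n)_{n\in\mathbb Z}\in\Sigma(B)\}$. Good interval: $[\nu,\mu)$ is good if it can be covered by intervals $[x,y)$, each having two symmetric transitive subshifts of finite type $\Sigma(B)\subset\Sigma(C)\subset(\mathbb N_{>0})^{\mathbb Z}$ associated with it such that: $x=\sup\{m(\underline b):\underline b\in\Sigma(B)\}$; every $\underline c\in(\mathbb N_{>0})^{\mathbb Z}$ with $m(\underline c)<y$ lies in $\Sigma(C)$; and for every $\underline a$ with $m(\underline a)=\lambda_0(\underline a)<y$ the following holds: whenever $N\in\mathbb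 N$ and $v^1,v^2\in\Sigma^+(C)$ are two continuations with different first terms (with $m(\ldots a_{-1}a_0\ldots a_Nv^i)<y$ for $i=1,2$), there are a (perhaps empty) finite word $\tau$ and $v_B\in\Sigma^+(B)$ such that $$m(\ldots a_{-1}a_0\ldots a_N\tau v_B)\le\max\{m(\ldots a_{-1}a_0\ldots a_Nv^1),\,m(\ldots a_{-1}a_0\ldots a_Nv^2),\,x\}.$$ *)

theory Defs
  imports "HOL-Analysis.Analysis" "HOL-Library.Omega_Words_Fun"
begin

subsection \<open>The Markov spectrum\<close>

definition pos_seq :: "(int \<Rightarrow> nat) \<Rightarrow> bool" where
  "pos_seq a \<longleftrightarrow> (\<forall>i. 0 < a i)"

fun cf_conv :: "(nat \<Rightarrow> nat) \<Rightarrow> nat \<Rightarrow> real" where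
  "cf_conv a 0 = real (a 0)"
| "cf_conv a (Suc n) = real (a 0) + 1 / cf_conv (\<lambda>k. a (Suc k)) n"

text \<open>
  The value of the infinite continued fraction with partial quotients
  \<open>a 0; a 1, a 2, \<dots>\<close>. It is meaningful when \<open>a k > 0\<close> for \<open>k \<ge> 1\<close>; \<open>a 0\<close> may be 0.
\<close>
definition cf_value :: "(nat \<Rightarrow> nat) \<Rightarrow> real" where
  "cf_value a = lim (cf_conv a)"

definition markov_lambda :: "(int \<Rightarrow> nat) \<Rightarrow> int \<Rightarrow> real" where
  "markov_lambda a j =
     cf_value (\<lambda>k. a (j + int k)) + cf_value ([0] \<frown> (\<lambda>k. a (j - 1 - int k)))"

text \<open>Extended-real valued, since the supremum is infinite when \<open>a\<close> is unbounded.\<close>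
definition markov_value :: "(int \<Rightarrow> nat) \<Rightarrow> ereal" where
  "markov_value a = (SUP j. ereal (markov_lambda a j))"

definition markov_spectrum :: "real set" where
  "markov_spectrum = {t. \<exists>a. pos_seq a \<and> markov_value a = ereal t}"

definition accumulation_points :: "real set \<Rightarrow> real set" where
  "accumulation_points S = {t. t islimpt S}"


subsection \<open>Subshifts of finite type\<close>

definition occurs_at :: "nat list \<Rightarrow> (int \<Rightarrow> nat) \<Rightarrow> int \<Rightarrow> bool" where
  "occurs_at w a i \<longleftrightarrow> (\<forall>k < length w. a (i + int k) = w ! k)"

definition subshift_of_finite_type :: "(int \<Rightarrow> nat) set \<Rightarrow> bool" where
  "subshift_of_finite_type S \<longleftrightarrow>
     (\<exists>A W. finite W \<and>
        S = {a. (\<forall>i. a i \<in> {1..A}) \<and> (\<forall>w\<in>W. \<forall>i. \<not> occurs_at w a i)})"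

definition symmetric_subshift :: "(int \<Rightarrow> nat) set \<Rightarrow> bool" where
  "symmetric_subshift S \<longleftrightarrow> (\<lambda>a i. a (- i)) ` S = S"

definition transitive_subshift :: "(int \<Rightarrow> nat) set \<Rightarrow> bool" where
  "transitive_subshift S \<longleftrightarrow> S \<noteq> {} \<and>
     (\<forall>u v. (\<exists>a\<in>S. \<exists>i. occurs_at u a i) \<and> (\<exists>a\<in>S. \<exists>i. occurs_at v a i) \<longrightarrow>
        (\<exists>a\<in>S. \<exists>i j. occurs_at u a i \<and> occurs_at v a j \<and> i + int (length u) \<le> j))"

definition sym_trans_sft :: "(int \<Rightarrow> nat) set \<Rightarrow> bool" where
  "sym_trans_sft S \<longleftrightarrow>
     subshift_of_finite_type S \<and> symmetric_subshift S \<and> transitive_subshift S"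

definition one_sided :: "(int \<Rightarrow> nat) set \<Rightarrow> (nat \<Rightarrow> nat) set" where
  "one_sided S = (\<lambda>a n. a (int n)) ` S"


subsection \<open>Good intervals\<close>

text \<open>The bi-infinite sequence \<open>\<dots> a (-1) a 0 \<dots> a N v 0 v 1 \<dots>\<close>, with indices up to \<open>N\<close> unchanged.\<close>
definition continue_with :: "(int \<Rightarrow> nat) \<Rightarrow> nat \<Rightarrow> (nat \<Rightarrow> nat) \<Rightarrow> int \<Rightarrow> nat" where
  "continue_with a N v i = (if i \<le> int N then a i else v (nat (i - int N - 1)))"

text \<open>
  The conditions on the subshifts \<open>B\<close>, \<open>C\<close> (playing the roles of \<open>\<Sigma>(B)\<close>, \<open>\<Sigma>(C)\<close>) to be
  associated with the interval \<open>[x, y)\<close>. The word \<open>\<tau>\<close> has positive letters, so that all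
  sequences involved stay positive.
\<close>
definition associated_subshifts ::
    "real \<Rightarrow> real \<Rightarrow> (int \<Rightarrow> nat) set \<Rightarrow> (int \<Rightarrow> nat) set \<Rightarrow> bool" where
  "associated_subshifts x y B C \<longleftrightarrow>
     sym_trans_sft B \<and> sym_trans_sft C \<and> B \<subseteq> C \<and>
     ereal x = (SUP b\<in>B. markov_value b) \<and>
     (\<forall>c. pos_seq c \<and> markov_value c < ereal y \<longrightarrow> c \<in> C) \<and>
     (\<forall>a. pos_seq a \<and> markov_value a = ereal (markov_lambda a 0) \<and> markov_value a < ereal y \<longrightarrow>
        (\<forall>N. \<forall>v1\<in>one_sided C. \<forall>v2\<in>one_sided C.
           v1 0 \<noteq> v2 0 \<and>
           markov_value (continue_with a N v1) < ereal y \<and>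
           markov_value (continue_with a N v2) < ereal y \<longrightarrow>
           (\<exists>\<tau>. (\<forall>k\<in>set \<tau>. 0 < k) \<and> (\<exists>vB\<in>one_sided B.
              markov_value (continue_with a N (\<tau> \<frown> vB)) \<le>
                Max {markov_value (continue_with a N v1),
                     markov_value (continue_with a N v2), ereal x}))))"

definition good_interval :: "real \<Rightarrow> real \<Rightarrow> bool" where
  "good_interval \<nu> \<mu> \<longleftrightarrow>
     (\<exists>I :: (real \<times> real) set.
        {\<nu>..<\<mu>} \<subseteq> (\<Union>(x, y)\<in>I. {x..<y}) \<and>
        (\<forall>(x, y)\<in>I. \<exists>B C. associated_subshifts x y B C))"

end

theory Submission
  imports Defs "HOL-Library.Diagonal_Subsequence"
begin

text \<open>
  Let \<open>t \<in> M'\<close> with \<open>x \<le> t < y\<close>. Below 3 the spectrum is discrete, so \<open>t \<ge> 3\<close>. The constant sequence 1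
  serves as a hub: appending \<open>22111\<dots>\<close> far out in a tail of 1s produces only values of \<open>\<lambda>\<close> near or
  below 3 there, but moves all values of \<open>\<lambda>\<close> to its left. Hence a sequence with right tail 1, with
  value \<open>s > 3\<close> that is not approached at its left end, has \<open>s \<in> M''\<close>; this settles \<open>t = 3\<close>.

  Let \<open>t > 3\<close>, and let \<open>a\<close> with \<open>m(a) = \<lambda>\<^sub>0(a) = t\<close> be a limit of sequences with values different from
  \<open>t\<close>. Whenever \<open>a\<close> can be continued in two ways from arbitrarily far to the right, goodness leads
  from \<open>a\<close> into \<open>B\<close>, and goodness applied to \<open>\<dots>112211\<dots>\<close>, transposed, leads from \<open>B\<close> to the hub, at
  the cost of an arbitrarily small increase of \<open>m\<close>. If this works on both sides of \<open>a\<close>, gluing gives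
  points of \<open>M''\<close> near \<open>t\<close>. If it works on the right only, rigidity makes the left half of \<open>a\<close>
  eventually periodic. When the periodic sequence has value below \<open>t\<close>, the previous argument applies
  again. Otherwise, if \<open>t\<close> were not in \<open>M''\<close>, the right half of \<open>a\<close> would be extremal among its
  splicings, hence eventually periodic too, and Galois conjugation of \<open>\<lambda>\<^sub>0(a) = t\<close> would make \<open>a\<close>
  periodic. But a nearby sequence with the same left half cannot attain a value other than \<open>t\<close> at 0:
  one (even) period later \<open>\<lambda>\<close> would be larger.
\<close>

section \<open>Two-sided continued fractions\<close>

text \<open>Reaching \<open>B\<close> is not enough to produce points of \<open>M''\<close>:
  \<Sigma>(B) may be a single periodic orbit, and its values come up to \<open>x\<close>, which may
  equal \<open>t\<close>. A tail of 1s leaves room instead, because 3 lies strictly below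
  \<open>t\<close>: it can be altered again and again, so each value obtained is a limit of further
  such values (\<open>perturbable\<close>). It has to be shown that the alteration really changes
  the supremum; for this the supremum must be attained in a bounded range, and hence the left end
  has to be controlled. Goodness keeps the whole left half of a sequence and changes the right half
  only, so the two directions are treated separately, with reversal as the symmetry. Two halves are
  joined by cutting inside a long common window, at an error of \<open>8 / 2^R\<close>. All order
  arguments rest on the alternation of continued fractions: each common letter reverses the order.
  Where a change must have a known sign, lengths are therefore chosen even.\<close>

definition pos1 :: "(nat \<Rightarrow> nat) \<Rightarrow> bool" where
  "pos1 a \<longleftrightarrow> (\<forall>k. 0 < a k)"

lemma pos1_Suc: "pos1 a \<Longrightarrow> pos1 (\<lambda>k. a (Suc k))"
  by (simp add: pos1_def)

lemma pos1_ge_1: "pos1 a \<Longrightarrow> 1 \<le> real (a k)"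
  by (simp add: pos1_def Suc_leI)

lemma cf_conv_ge_1:
  assumes "pos1 a" shows "1 \<le> cf_conv a n"
  using assms
proof (induction n arbitrary: a)
  case 0 then show ?case using pos1_ge_1 by simp
next
  case (Suc n)
  have "1 \<le> cf_conv (\<lambda>k. a (Suc k)) n" using Suc pos1_Suc by blast
  then show ?case using pos1_ge_1[OF Suc.prems, of 0] by (simp add: add_increasing2)
qed

lemma inverse_dist:
  fixes x y :: real assumes "1 \<le> x" "1 \<le> y"
  shows "\<bar>1/x - 1/y\<bar> \<le> \<bar>x - y\<bar>" "\<bar>1/x - 1/y\<bar> \<le> 1"
proof -
  have "\<bar>1/x - 1/y\<bar> = \<bar>x - y\<bar> / (x*y)"
    using assms by (simp add: field_simps abs_if)
  moreover have "1 \<le> x*y" using assms by (metis mult_mono' mult_1 zero_le_one)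
  ultimately show "\<bar>1/x - 1/y\<bar> \<le> \<bar>x - y\<bar>"
    by (simp add: divide_le_eq mult_left_le mult_le_cancel_left1 pos_divide_le_eq)
  have "0 < 1/x" "1/x \<le> 1" "0 < 1/y" "1/y \<le> 1" using assms by auto
  then show "\<bar>1/x - 1/y\<bar> \<le> 1" by linarith
qed

text \<open>Two steps of the expansion contract distances by a factor of 4, since consecutive complete
  quotients satisfy \<open>x * x' = a * x' + 1 \<ge> 2\<close>.\<close>
lemma two_step_contraction:
  fixes a b x y :: real
  assumes "1 \<le> b" "1 \<le> x" "1 \<le> y"
  shows "\<bar>(a + 1/(b + 1/x)) - (a + 1/(b + 1/y))\<bar> \<le> \<bar>x - y\<bar> / 4"
proof -
  have p: "2 \<le> b*x+1" "2 \<le> b*y+1" using assms mult_mono[of 1 b 1 x] mult_mono[of 1 b 1 y] by auto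
  have "4 \<le> (b*x+1)*(b*y+1)" using mult_mono[OF p] p by simp
  have nz: "x \<noteq> 0" "y \<noteq> 0" "b*x+1 \<noteq> 0" "b*y+1 \<noteq> 0" using assms p by auto
  have e: "1/(b + 1/x) = x/(b*x+1)" "1/(b + 1/y) = y/(b*y+1)"
    using assms by (simp_all add: divide_simps)
  have "(a + 1/(b + 1/x)) - (a + 1/(b + 1/y)) = x/(b*x+1) - y/(b*y+1)"
    unfolding e by simp
  also have "\<dots> = (x * (b*y+1) - y * (b*x+1)) / ((b*x+1)*(b*y+1))"
    using nz(3,4) by (rule diff_frac_eq)
  also have "x * (b*y+1) - y * (b*x+1) = x - y"
    by (simp add: algebra_simps)
  finally have "\<bar>(a + 1/(b + 1/x)) - (a + 1/(b + 1/y))\<bar> = \<bar>x - y\<bar> / ((b*x+1)*(b*y+1))"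
    using p by (simp add: abs_mult)
  also have "\<dots> \<le> \<bar>x - y\<bar> / 4"
    using \<open>4 \<le> _\<close> by (intro divide_left_mono) auto
  finally show ?thesis .
qed

lemma quarter_bound:
  fixes D X :: real
  assumes "X \<le> 2 / 2^l" "D \<le> X / 4"
  shows "D \<le> 2 / 2^Suc (Suc l)"
proof -
  have "X / 4 \<le> (2 / 2^l) / 4" using assms(1) by (rule divide_right_mono) simp
  then have "D \<le> (2 / 2^l) / 4" using assms(2) by (rule order_trans[rotated])
  then show ?thesis by simp
qed

text \<open>Two steps of the recursion gain a factor 4, so the induction descends by 2. The constant
  2 makes the bound at least 1 for \<open>k \<le> 1\<close>, where it suffices to compare fractional
  parts.\<close>

lemma cf_conv_close:
  assumes "pos1 a" "Suc k \<le> n" "Suc k \<le> m"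
  shows "\<bar>cf_conv a n - cf_conv a m\<bar> \<le> 2 / 2^k"
  using assms
proof (induction k arbitrary: a n m rule: less_induct)
  case (less k)
  obtain n' m' where nm: "n = Suc n'" "m = Suc m'"
    using less.prems by (cases n; cases m) auto
  let ?b = "\<lambda>k. a (Suc k)"
  let ?c = "\<lambda>k. a (Suc (Suc k))"
  have pb: "pos1 ?b" using pos1_Suc less.prems by blast
  have pc: "pos1 ?c" using pos1_Suc[OF pb] .
  have one: "\<bar>cf_conv a n - cf_conv a m\<bar> \<le> 1"
    using inverse_dist(2)[OF cf_conv_ge_1[OF pb, of n'] cf_conv_ge_1[OF pb, of m']] nm by simp
  show ?case
  proof (cases "k \<le> 1")
    case True
    then have "(1::real) \<le> 2 / 2^k" by (cases k) auto
    then show ?thesis using one by linarith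
  next
    case False
    then obtain l where l: "k = Suc (Suc l)"
      by (cases k; cases "k - 1") auto
    obtain n2 m2 where nm2: "n' = Suc n2" "m' = Suc m2" "Suc l \<le> n2" "Suc l \<le> m2"
      using less.prems nm l by (cases n'; cases m') auto
    have "\<bar>cf_conv ?c n2 - cf_conv ?c m2\<bar> \<le> 2 / 2^l"
      using less.IH[of l ?c n2 m2] l pc nm2 by auto
    moreover have "\<bar>cf_conv a n - cf_conv a m\<bar> \<le> \<bar>cf_conv ?c n2 - cf_conv ?c m2\<bar> / 4"
      using two_step_contraction[OF pos1_ge_1[OF less.prems(1), of 1] cf_conv_ge_1[OF pc, of n2] cf_conv_ge_1[OF pc, of m2], of "real (a 0)"]
      by (simp add: nm nm2)
    ultimately show ?thesis using quarter_bound l by blast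
  qed
qed

lemma cf_conv_LIMSEQ:
  assumes "pos1 a" shows "cf_conv a \<longlonglongrightarrow> cf_value a"
proof -
  have "Cauchy (cf_conv a)"
  proof (rule metric_CauchyI)
    fix e :: real assume "0 < e"
    then obtain k :: nat where k: "(1/2)^k < e/2"
      using real_arch_pow_inv[of "e/2" "1/2"] by auto
    have "2 / 2^k < e" using k by (simp add: power_divide field_simps)
    then have "dist (cf_conv a m) (cf_conv a n) < e" if "Suc k \<le> m" "Suc k \<le> n" for m n
      using cf_conv_close[OF assms that] unfolding dist_real_def by (rule le_less_trans[rotated])
    then show "\<exists>M. \<forall>m\<ge>M. \<forall>n\<ge>M. dist (cf_conv a m) (cf_conv a n) < e"
      by blast
  qed
  then show ?thesis unfolding cf_value_def
    using Cauchy_convergent convergent_LIMSEQ_iff by blast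
qed

lemma cf_value_ge_1: "pos1 a \<Longrightarrow> 1 \<le> cf_value a"
  by (rule LIMSEQ_le_const[OF cf_conv_LIMSEQ]) (auto intro: cf_conv_ge_1)

text \<open>Positivity is asked from index 1 on, since \<open>markov_lambda\<close> puts a 0 in
  front of the left half.\<close>

lemma cf_value_step0:
  assumes "pos1 (\<lambda>k. a (Suc k))"
  shows "cf_value a = real (a 0) + 1 / cf_value (\<lambda>k. a (Suc k))"
proof -
  let ?b = "\<lambda>k. a (Suc k)"
  have "cf_value ?b \<noteq> 0" using cf_value_ge_1[OF assms] by auto
  then have "(\<lambda>n. cf_conv a (Suc n)) \<longlonglongrightarrow> real (a 0) + 1 / cf_value ?b"
    using cf_conv_LIMSEQ[OF assms] by (auto intro!: tendsto_intros)
  then have "cf_conv a \<longlonglongrightarrow> real (a 0) + 1 / cf_value ?b"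
    by (rule LIMSEQ_imp_Suc)
  then show ?thesis unfolding cf_value_def by (rule limI)
qed

section \<open>Complete quotients of bi-infinite sequences, read to the right and to the
  left\<close>

definition rv :: "(int \<Rightarrow> nat) \<Rightarrow> int \<Rightarrow> real" where
  "rv a i = cf_value (\<lambda>k. a (i + int k))"

definition lv :: "(int \<Rightarrow> nat) \<Rightarrow> int \<Rightarrow> real" where
  "lv a i = cf_value (\<lambda>k. a (i - int k))"

definition rev_seq :: "(int \<Rightarrow> nat) \<Rightarrow> int \<Rightarrow> nat" where
  "rev_seq a = (\<lambda>i. a (- i))"

lemma rev_seq_apply [simp]: "rev_seq a i = a (- i)"
  by (simp add: rev_seq_def)

lemma rev_rev_seq [simp]: "rev_seq (rev_seq a) = a"
  by (simp add: rev_seq_def)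

lemma pos_rev [simp]: "pos_seq (rev_seq a) \<longleftrightarrow> pos_seq a"
  unfolding pos_seq_def rev_seq_apply by (metis minus_minus)

lemma rv_rev: "rv (rev_seq a) i = lv a (- i)"
  by (simp add: rv_def lv_def)

lemma lv_rev: "lv (rev_seq a) i = rv a (- i)"
  by (simp add: rv_def lv_def)

lemma pos1_right: "pos_seq a \<Longrightarrow> pos1 (\<lambda>k. a (i + int k))"
  and pos1_left: "pos_seq a \<Longrightarrow> pos1 (\<lambda>k. a (i - int k))"
  by (auto simp: pos_seq_def pos1_def)

lemma rv_step: "pos_seq a \<Longrightarrow> rv a i = real (a i) + 1 / rv a (i+1)"
  using cf_value_step0[of "\<lambda>k. a (i + int k)"] pos1_right[of a "i+1"]
  by (simp add: rv_def add.assoc)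

lemma lv_step: "pos_seq a \<Longrightarrow> lv a i = real (a i) + 1 / lv a (i-1)"
  using rv_step[of "rev_seq a" "-i"] by (simp add: rv_rev)

lemma seq_ge_1: "pos_seq a \<Longrightarrow> 1 \<le> real (a i)"
  by (simp add: pos_seq_def Suc_leI)

lemma rv_gt_1: assumes "pos_seq a" shows "1 < rv a i"
proof -
  have "1 \<le> rv a (i+1)" unfolding rv_def using cf_value_ge_1 pos1_right[OF assms] by blast
  then have "0 < 1 / rv a (i+1)" by simp
  then show ?thesis using rv_step[OF assms, of i] seq_ge_1[OF assms, of i] by linarith
qed

lemma lv_gt_1: "pos_seq a \<Longrightarrow> 1 < lv a i"
  using rv_gt_1[of "rev_seq a" "-i"] by (simp add: rv_rev)

lemma inv_rv: "pos_seq a \<Longrightarrow> 0 < 1 / rv a i \<and> 1 / rv a i < 1"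
  using rv_gt_1[of a i] by simp

lemma inv_lv: "pos_seq a \<Longrightarrow> 0 < 1 / lv a i \<and> 1 / lv a i < 1"
  using lv_gt_1[of a i] by simp

lemma rv_bounds: "pos_seq a \<Longrightarrow> real (a i) < rv a i \<and> rv a i < real (a i) + 1"
  using rv_step[of a i] inv_rv[of a "i+1"] by auto

lemma lv_bounds: "pos_seq a \<Longrightarrow> real (a i) < lv a i \<and> lv a i < real (a i) + 1"
  using lv_step[of a i] inv_lv[of a "i-1"] by auto

lemma lam_eq:
  assumes "pos_seq a" shows "markov_lambda a j = rv a j + 1 / lv a (j-1)"
proof -
  let ?s = "[0] \<frown> (\<lambda>k. a (j - 1 - int k))"
  have s: "(\<lambda>k. ?s (Suc k)) = (\<lambda>k. a (j - 1 - int k))" by (simp add: conc_def)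
  have "cf_value ?s = real (?s 0) + 1 / cf_value (\<lambda>k. ?s (Suc k))"
    by (rule cf_value_step0) (simp add: s pos1_left[OF assms])
  then show ?thesis unfolding markov_lambda_def rv_def lv_def s by (simp add: conc_def)
qed

lemma lam_eq_lv: "pos_seq a \<Longrightarrow> markov_lambda a j = lv a j + 1 / rv a (j+1)"
  using lam_eq[of a j] rv_step[of a j] lv_step[of a j] by simp

lemma lam_eq_mid: "pos_seq a \<Longrightarrow> markov_lambda a j = real (a j) + 1 / rv a (j+1) + 1 / lv a (j-1)"
  using lam_eq[of a j] rv_step[of a j] by simp

lemma lam_rev: "pos_seq a \<Longrightarrow> markov_lambda (rev_seq a) j = markov_lambda a (- j)"
  using lam_eq[of "rev_seq a" j] lam_eq_lv[of a "-j"] by (simp add: rv_rev lv_rev)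

lemma lam_gt: assumes "pos_seq a" shows "real (a j) < markov_lambda a j"
  using lam_eq_mid[OF assms, of j] inv_rv[OF assms, of "j+1"] inv_lv[OF assms, of "j-1"] by linarith

lemma lam_lt: assumes "pos_seq a" shows "markov_lambda a j < real (a j) + 2"
  using lam_eq_mid[OF assms, of j] inv_rv[OF assms, of "j+1"] inv_lv[OF assms, of "j-1"] by linarith

definition shift_seq :: "int \<Rightarrow> (int \<Rightarrow> nat) \<Rightarrow> int \<Rightarrow> nat" where
  "shift_seq k a = (\<lambda>i. a (i + k))"

lemma shift_seq_apply [simp]: "shift_seq k a i = a (i + k)"
  by (simp add: shift_seq_def)

lemma pos_shift [simp]: "pos_seq (shift_seq k a) \<longleftrightarrow> pos_seq a"
  unfolding pos_seq_def shift_seq_apply by (metis diff_add_cancel)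

lemma rv_shift: "rv (shift_seq k a) i = rv a (i + k)"
  by (simp add: rv_def add_ac)

lemma lv_shift: "lv (shift_seq k a) i = lv a (i + k)"
  by (simp add: lv_def algebra_simps)

lemma lam_shift: "pos_seq a \<Longrightarrow> markov_lambda (shift_seq k a) i = markov_lambda a (i + k)"
  by (simp add: lam_eq rv_shift lv_shift algebra_simps)

lemma rv_cong: "(\<And>k. k \<ge> i \<Longrightarrow> a k = b k) \<Longrightarrow> rv a i = rv b i"
  by (simp add: rv_def)

lemma lv_cong: "(\<And>k. k \<le> i \<Longrightarrow> a k = b k) \<Longrightarrow> lv a i = lv b i"
  by (simp add: lv_def)

lemma rv_close:
  assumes "pos_seq a" "pos_seq b" "\<forall>k. i \<le> k \<and> k \<le> i + int n \<longrightarrow> a k = b k"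
  shows "\<bar>rv a i - rv b i\<bar> \<le> 2 / 2^n"
  using assms(3)
proof (induction n arbitrary: i rule: less_induct)
  case (less n)
  note st = rv_step[OF assms(1)] rv_step[OF assms(2)]
  have ge: "1 \<le> rv a k" "1 \<le> rv b k" for k
    using rv_gt_1[OF assms(1), of k] rv_gt_1[OF assms(2), of k] by auto
  have "a i = b i" using less.prems by auto
  then have one: "\<bar>rv a i - rv b i\<bar> \<le> 1"
    using inverse_dist(2)[OF ge(1)[of "i+1"] ge(2)[of "i+1"]] st(1)[of i] st(2)[of i] by simp
  show ?case
  proof (cases "n \<le> 1")
    case True
    then have "(1::real) \<le> 2 / 2^n" by (cases n) auto
    then show ?thesis using one by linarith
  next
    case False
    then obtain l where l: "n = Suc (Suc l)"
      by (cases n; cases "n - 1") auto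
    have "a (i+1) = b (i+1)" using less.prems l by auto
    then have e: "rv a i = real (a i) + 1/(real (a (i+1)) + 1/rv a (i+2))"
       "rv b i = real (a i) + 1/(real (a (i+1)) + 1/rv b (i+2))"
      using st(1)[of i] st(2)[of i] st(1)[of "i+1"] st(2)[of "i+1"] \<open>a i = b i\<close> by (simp_all add: add.assoc)
    have "\<bar>rv a (i+2) - rv b (i+2)\<bar> \<le> 2 / 2^l"
      using less.IH[of l "i+2"] l less.prems by auto
    moreover have "\<bar>rv a i - rv b i\<bar> \<le> \<bar>rv a (i+2) - rv b (i+2)\<bar> / 4"
      unfolding e using two_step_contraction[OF seq_ge_1[OF assms(1)] ge(1) ge(2)] by blast
    ultimately show ?thesis using quarter_bound l by blast
  qed
qed

lemma lv_close:
  assumes "pos_seq a" "pos_seq b" "\<forall>k. i - int n \<le> k \<and> k \<le> i \<longrightarrow> a k = b k"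
  shows "\<bar>lv a i - lv b i\<bar> \<le> 2 / 2^n"
  using rv_close[of "rev_seq a" "rev_seq b" "-i" n] assms by (simp add: rv_rev)

text \<open>The left quotient starts at \<open>j - 1\<close> and sees one letter less: its error
  \<open>4 / 2^n\<close> and the error \<open>2 / 2^n\<close> from the right stay below
  \<open>8 / 2^n\<close>. For \<open>n = 0\<close> the common letter at \<open>j\<close> confines
  both values to an interval of length 2.\<close>

lemma lam_close:
  assumes "pos_seq a" "pos_seq b" "\<forall>k. j - int n \<le> k \<and> k \<le> j + int n \<longrightarrow> a k = b k"
  shows "\<bar>markov_lambda a j - markov_lambda b j\<bar> \<le> 8 / 2^n"
proof (cases n)
  case 0
  have "a j = b j" using assms by auto
  then show ?thesis using 0 lam_gt[OF assms(1), of j] lam_gt[OF assms(2), of j]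
    lam_lt[OF assms(1), of j] lam_lt[OF assms(2), of j] by simp
next
  case (Suc m)
  have 1: "\<bar>rv a j - rv b j\<bar> \<le> 2 / 2^n" using rv_close[OF assms(1,2)] assms(3) by auto
  have "\<bar>lv a (j-1) - lv b (j-1)\<bar> \<le> 2 / 2^m" using lv_close[OF assms(1,2), of "j-1" m] assms(3) Suc by auto
  then have 2: "\<bar>1/lv a (j-1) - 1/lv b (j-1)\<bar> \<le> 2 / 2^m"
    using inverse_dist(1)[of "lv a (j-1)" "lv b (j-1)"] lv_gt_1[OF assms(1), of "j-1"] lv_gt_1[OF assms(2), of "j-1"] by linarith
  have "2 / 2^m + 2 / 2^n \<le> (8::real) / 2^n" by (simp add: Suc field_simps)
  then show ?thesis using 1 2 lam_eq[OF assms(1), of j] lam_eq[OF assms(2), of j] by linarith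
qed

lemma err_small:
  assumes "0 < (e::real)" obtains n :: nat where "8 / 2^n < e"
proof -
  obtain k :: nat where k: "(1/2)^k < e/8"
    using assms real_arch_pow_inv[of "e/8" "1/2"] by auto
  then have "8 / 2^k < e" by (simp add: power_divide field_simps)
  then show thesis using that by blast
qed

lemma err_mono: "n \<le> m \<Longrightarrow> (8::real) / 2^m \<le> 8 / 2^n"
  by (simp add: field_simps)

section \<open>The alternating order of continued fractions\<close>

lemma rv_less:
  assumes "pos_seq a" "pos_seq b" "a i < b j" shows "rv a i < rv b j"
proof -
  have "real (a i) + 1 \<le> real (b j)" using assms(3) by linarith
  then show ?thesis using rv_bounds[OF assms(1), of i] rv_bounds[OF assms(2), of j] by linarith
qed

lemma rv_step_less:
  assumes "pos_seq a" "pos_seq b" "a i = b j"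
  shows "rv a i < rv b j \<longleftrightarrow> rv b (j+1) < rv a (i+1)"
proof -
  have *: "1/x < 1/y \<longleftrightarrow> y < x" if "1 < x" "1 < y" for x y :: real
    using that by (simp add: field_simps)
  show ?thesis
    using *[OF rv_gt_1[OF assms(1), of "i+1"] rv_gt_1[OF assms(2), of "j+1"]]
      rv_step[OF assms(1), of i] rv_step[OF assms(2), of j] assms(3) by linarith
qed

text \<open>The map x \<mapsto> a + 1/x is decreasing, so each common letter reverses the
  comparison.\<close>

lemma rv_steps_less:
  assumes "pos_seq a" "pos_seq b" "\<forall>k<n. a (i + int k) = b (j + int k)"
  shows "rv a i < rv b j \<longleftrightarrow>
    (if even n then rv a (i+int n) < rv b (j+int n) else rv b (j+int n) < rv a (i+int n))"
  using assms(3)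
proof (induction n)
  case (Suc n)
  have "a (i+int n) = b (j+int n)" using Suc.prems by auto
  then have "b (j+int n) = a (i+int n)" by simp
  show ?case using Suc rv_step_less[OF assms(1,2) \<open>a (i+int n) = b (j+int n)\<close>]
     rv_step_less[OF assms(2,1) \<open>b (j+int n) = a (i+int n)\<close>] by (auto simp: add_ac)
qed auto

text \<open>Uniqueness of the expansion, at two positions that may differ: with \<open>a = b\<close>
  it becomes a criterion for eventual periodicity.\<close>

lemma rv_inj:
  assumes "pos_seq a" "pos_seq b" "rv a i = rv b j"
  shows "a (i + int k) = b (j + int k)"
proof -
  have "rv a (i + int k) = rv b (j + int k)" 
  proof (induction k)
    case (Suc k)
    have "a (i + int k) = b (j + int k)"
      using rv_less[OF assms(1,2)] rv_less[OF assms(2,1)] Suc by (metis less_irrefl nat_neq_iff)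
    then show ?case using Suc rv_step_less[OF assms(1,2), of "i+int k" "j+int k"]
      rv_step_less[OF assms(2,1), of "j+int k" "i+int k"] by (simp add: add_ac)
  qed (use assms in auto)
  then show ?thesis
    using rv_less[OF assms(1,2)] rv_less[OF assms(2,1)] by (metis less_irrefl nat_neq_iff)
qed

lemma rv_inj_eq:
  assumes "pos_seq a" "pos_seq b" "rv a i = rv b i" "i \<le> k"
  shows "a k = b k"
  using rv_inj[OF assms(1-3), of "nat (k - i)"] assms(4) by simp

lemma lv_inj_eq:
  assumes "pos_seq a" "pos_seq b" "lv a i = lv b i" "k \<le> i"
  shows "a k = b k"
  using rv_inj_eq[of "rev_seq a" "rev_seq b" "-i" "-k"] assms by (simp add: rv_rev)

text \<open>The cut sits in the middle of a common window, so around every position \<open>w\<close>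
  agrees with \<open>u\<close> or with \<open>v\<close> up to distance \<open>R\<close>.\<close>

lemma glue:
  assumes "pos_seq u" "pos_seq v" and ag: "\<forall>i. \<bar>i - n\<bar> \<le> int R \<longrightarrow> u i = v i"
    and w: "w = (\<lambda>i. if i \<le> n then u i else v i)"
    and "\<forall>j. markov_lambda u j \<le> s" "\<forall>j. markov_lambda v j \<le> s"
  shows "pos_seq w" "markov_lambda w j \<le> s + 8 / 2^R"
proof -
  show pw: "pos_seq w" using assms by (auto simp: pos_seq_def)
  show "markov_lambda w j \<le> s + 8 / 2^R"
  proof (cases "j \<le> n")
    case True
    have "\<bar>markov_lambda w j - markov_lambda u j\<bar> \<le> 8 / 2^R"
      by (rule lam_close[OF pw assms(1)]) (use True ag w in auto)
    then show ?thesis using assms(5) by (smt (verit))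
  next
    case False
    have "\<bar>markov_lambda w j - markov_lambda v j\<bar> \<le> 8 / 2^R"
      by (rule lam_close[OF pw assms(2)]) (use False ag w in auto)
    then show ?thesis using assms(6) by (smt (verit))
  qed
qed

section \<open>Words with reflected cuts\<close>

text \<open>Markov's condition on two-letter words in a bounded form: around a factor
  \<open>xy\<close> with \<open>x \<noteq> y\<close> the letters read outwards are mirror images
  until, after at most \<open>R\<close> of them, a first difference appears, with \<open>y\<close>
  on the left and \<open>x\<close> on the right.\<close>

definition reflected_cuts :: "nat \<Rightarrow> (int \<Rightarrow> bool) \<Rightarrow> bool" where
  "reflected_cuts R w \<longleftrightarrow> (\<forall>i. w i \<noteq> w (i+1) \<longrightarrow>
     (\<exists>m\<le>R. (\<forall>k<m. w (i - 1 - int k) = w (i + 2 + int k)) \<and>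
            w (i - 1 - int m) = w (i+1) \<and> w (i + 2 + int m) = w i))"

lemma reflected_cutsE:
  assumes "reflected_cuts R w" "w i \<noteq> w (i+1)"
  obtains m where "m \<le> R" "\<And>k. k < m \<Longrightarrow> w (i - 1 - int k) = w (i + 2 + int k)"
    "w (i - 1 - int m) = w (i+1)" "w (i + 2 + int m) = w i"
  using assms unfolding reflected_cuts_def by blast

lemma reflected_cuts_compl:
  assumes "reflected_cuts R w" shows "reflected_cuts R (\<lambda>i. \<not> w i)"
  unfolding reflected_cuts_def
proof (intro allI impI)
  fix i assume "(\<not> w i) \<noteq> (\<not> w (i+1))"
  then have "w i \<noteq> w (i+1)" by blast
  from reflected_cutsE[OF assms this] show "\<exists>m\<le>R. (\<forall>k<m. (\<not> w (i - 1 - int k)) = (\<not> w (i + 2 + int k))) \<and>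
            (\<not> w (i - 1 - int m)) = (\<not> w (i+1)) \<and> (\<not> w (i + 2 + int m)) = (\<not> w i)"
    by (metis (no_types, lifting))
qed

lemma reflected_cuts_rev:
  assumes "reflected_cuts R w" shows "reflected_cuts R (\<lambda>i. w (- i))"
  unfolding reflected_cuts_def
proof (intro allI impI)
  fix i :: int assume "w (- i) \<noteq> w (- (i+1))"
  then have "w (- i - 1) \<noteq> w (- i - 1 + 1)" by simp
  then obtain m where m: "m \<le> R" "\<And>k. k < m \<Longrightarrow> w (- i - 1 - 1 - int k) = w (- i - 1 + 2 + int k)"
    "w (- i - 1 - 1 - int m) = w (- i - 1 + 1)" "w (- i - 1 + 2 + int m) = w (- i - 1)"
    using reflected_cutsE[OF assms] by blast
  have e: "- (i - 1 - int k) = - i - 1 + 2 + int k" "- (i + 2 + int k) = - i - 1 - 1 - int k" for k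
    by auto
  show "\<exists>m\<le>R. (\<forall>k<m. w (- (i - 1 - int k)) = w (- (i + 2 + int k))) \<and>
      w (- (i - 1 - int m)) = w (- (i + 1)) \<and> w (- (i + 2 + int m)) = w (- i)"
    unfolding e using m by (intro exI[of _ m]) auto
qed

section \<open>One of the two letters is isolated\<close>

text \<open>Writing 1 for \<open>True\<close>, the word is 1 1 0 1 0 ... 1 0 0. For
  \<open>k > 0\<close>, the cut before its final 0 0 and the cut after it compare the same right
  tail \<open>Y\<close> with two left words \<open>F\<close> and \<open>E\<close>, and they demand
  first differences of opposite sign. As \<open>E\<close> and \<open>F\<close> agree on
  \<open>q\<close> letters, neither difference can come earlier, and at \<open>q\<close> both words
  have the wrong letter.\<close>

lemma no_unbalanced_pattern:
  assumes rc: "reflected_cuts R w" and p: "w p" "\<not> w (p + 2 * int k + 3)"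
    and pat: "\<And>j. 1 \<le> j \<Longrightarrow> j \<le> 2 * int k + 2 \<Longrightarrow> w (p + j) \<longleftrightarrow> odd j"
  shows False
proof -
  have a: "w (p + 2 * int k + 1)" "\<not> w (p + 2 * int k + 1 + 1)"
    using pat[of "2*int k+1"] pat[of "2*int k+2"] by (auto simp: add.assoc)
  then obtain m where m: "\<And>j. j < m \<Longrightarrow> w (p + 2 * int k + 1 - 1 - int j) = w (p + 2 * int k + 1 + 2 + int j)"
    "\<not> w (p + 2 * int k + 1 - 1 - int m)" "w (p + 2 * int k + 1 + 2 + int m)"
    using reflected_cutsE[OF rc, of "p + 2 * int k + 1"] by metis
  have m0: "m \<noteq> 0" using m(3) p(2) by (cases m) (auto simp: add_ac)
  show False
  proof (cases k)
    case 0
    then show False using m(1)[of 0] m0 p by (auto simp: add.commute)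
  next
    case (Suc k')
    have "w (p + (2 * int k - 1))" using pat[of "2 * int k - 1"] Suc by auto
    then have w1: "w (p + 2 * int k + 1 - 1 - int 1)" by (simp add: algebra_simps)
    have "m \<noteq> 1" using m(2) w1 by auto
    then have m2: "m \<ge> 2" using m0 by auto
    have b: "\<not> w (p + 2 * int k + 3)" "w (p + 2 * int k + 3 + 1)"
      using p m(1)[of 1] m2 w1 by (auto simp: add_ac)
    then obtain n where n: "\<And>j. j < n \<Longrightarrow> w (p + 2 * int k + 3 - 1 - int j) = w (p + 2 * int k + 3 + 2 + int j)"
      "w (p + 2 * int k + 3 - 1 - int n)" "\<not> w (p + 2 * int k + 3 + 2 + int n)"
      using reflected_cutsE[OF rc, of "p + 2 * int k + 3"] by metis
    define l where "l = m - 2"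
    have ml: "m = l + 2" using m2 l_def by auto
    define Y where "Y j = w (p + 2 * int k + 5 + int j)" for j
    define E where "E j = w (p + (2 * int k + 2 - int j))" for j
    define F where "F j = w (p + (2 * int k - 2 - int j))" for j
    have nE: "\<And>j. j < n \<Longrightarrow> E j = Y j" "E n" "\<not> Y n"
      using n unfolding E_def Y_def by (auto simp: algebra_simps)
    have lF: "\<And>j. j < l \<Longrightarrow> F j = Y j" "\<not> F l" "Y l"
    proof -
      show "F j = Y j" if "j < l" for j
        using m(1)[of "j+2"] that ml unfolding F_def Y_def by (auto simp: algebra_simps)
      show "\<not> F l" "Y l" using m(2,3) ml unfolding F_def Y_def by (auto simp: algebra_simps)
    qed
    define q where "q = 2 * k - 2"
    have EF: "E j = F j" if "j < q" for j
      using pat[of "2 * int k + 2 - int j"] pat[of "2 * int k - 2 - int j"] that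
      unfolding E_def F_def q_def by auto
    have Eq: "\<not> E q" using pat[of 4] Suc unfolding E_def q_def by (simp add: of_nat_diff)
    have Fq: "F q" using p Suc unfolding F_def q_def by (simp add: of_nat_diff)
    have "\<not> (n < q \<or> l < q)"
    proof (cases n l rule: linorder_cases)
      case less then show ?thesis using nE(2,3) lF(1)[of n] EF[of n] by auto
    next
      case equal then show ?thesis using nE(3) lF(3) by auto
    next
      case greater then show ?thesis using lF(2,3) nE(1)[of l] EF[of l] by auto
    qed
    moreover have "n \<noteq> q" "l \<noteq> q" using nE(2) Eq lF(2) Fq by auto
    ultimately have "q < n" "q < l" by auto
    then show False using nE(1) lF(1) Eq Fq by auto
  qed
qed

text \<open>Induction on the distance amounts to taking a closest pair of squares; between them the
  letters alternate, which is the excluded pattern.\<close>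

lemma not_both_squares_ordered:
  assumes rc: "reflected_cuts R w"
    and ij: "w i" "w (i+1)" "\<not> w j" "\<not> w (j+1)" "i < j"
  shows False
  using ij
proof (induction "nat (j - i)" arbitrary: i j rule: less_induct)
  case less
  have alt: "w l \<noteq> w (l+1)" if "i < l" "l < j" for l
    using less.hyps[of j l] less.hyps[of l i] less.prems that by auto
  have pat: "w (i + 1 + int r) \<longleftrightarrow> even r" if "i + 1 + int r \<le> j" for r
    using that
  proof (induction r)
    case (Suc r)
    then show ?case using alt[of "i+1+int r"] by (auto simp: add_ac)
  qed (use less.prems in auto)
  define d where "d = nat (j - i - 1)"
  have d: "j = i + 1 + int d" using less.prems d_def by auto
  have "odd d" using pat[of d] d less.prems by auto
  then obtain k where k: "d = 2 * k + 1" by (metis oddE)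
  show False
  proof (rule no_unbalanced_pattern[OF rc less.prems(1), of k])
    show "\<not> w (i + 2 * int k + 3)" using less.prems d k by (auto simp: algebra_simps)
    fix t :: int assume t: "1 \<le> t" "t \<le> 2 * int k + 2"
    have "w (i + t) \<longleftrightarrow> even (nat (t - 1))" using pat[of "nat (t - 1)"] t d k by (auto simp: algebra_simps)
    then show "w (i + t) \<longleftrightarrow> odd t" using t by (auto simp: even_nat_iff)
  qed
qed

lemma not_both_squares:
  assumes rc: "reflected_cuts R w"
  shows "(\<forall>i. w i \<or> w (i+1)) \<or> (\<forall>i. \<not> w i \<or> \<not> w (i+1))"
proof (rule ccontr)
  assume "\<not> ?thesis"
  then obtain i j where ij: "w i" "w (i+1)" "\<not> w j" "\<not> w (j+1)" by blast
  have "i \<noteq> j" using ij by auto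
  then consider "i < j" | "- i - 1 < - j - 1" by linarith
  then show False
  proof cases
    case 1 then show False using not_both_squares_ordered[OF rc ij] by blast
  next
    case 2
    then show False
      using not_both_squares_ordered[OF reflected_cuts_rev[OF rc], of "-i-1" "-j-1"] ij by (auto simp: add.commute)
  qed
qed

section \<open>Desubstitution and bounded periods\<close>

lemma int_orbit:
  assumes "x0 \<in> S" "\<And>x. x \<in> S \<Longrightarrow> s x \<in> S" "\<And>x. x \<in> S \<Longrightarrow> p x \<in> S \<and> s (p x) = x"
  obtains e :: "int \<Rightarrow> 'a" where "\<And>n. e n \<in> S" "\<And>n. e (n+1) = s (e n)"
proof -
  define e where "e n = (if 0 \<le> n then (s ^^ nat n) x0 else (p ^^ nat (- n)) x0)" for n :: int
  have sS: "(s ^^ n) x0 \<in> S" for n by (induction n) (auto simp: assms)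
  have pS: "(p ^^ n) x0 \<in> S" for n by (induction n) (auto simp: assms)
  have "e (n+1) = s (e n)" for n
  proof (cases "0 \<le> n")
    case True
    then show ?thesis by (simp add: e_def nat_add_distrib)
  next
    case False
    then obtain k where k: "- n = int (Suc k)" using that[of "nat (-n) - 1"] by auto
    then have "nat (-n) = Suc k" "nat (-(n+1)) = k" by auto
    moreover have "e (n+1) = (p ^^ k) x0"
      using \<open>nat (-(n+1)) = k\<close> k by (cases k) (auto simp: e_def)
    moreover have "e n = p ((p ^^ k) x0)"
      using \<open>nat (-n) = Suc k\<close> False by (simp add: e_def)
    ultimately show ?thesis using assms(3)[OF pS[of k]] by simp
  qed
  moreover have "e n \<in> S" for n using sS pS by (simp add: e_def)
  ultimately show thesis using that by blast
qed

text \<open>Desubstitution: when \<open>False\<close> is isolated, \<open>w\<close> is the image of \<open>\<lambda>n. w (e n)\<close> under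
  \<open>True \<mapsto> True\<close>, \<open>False \<mapsto> False True\<close>; \<open>e n\<close> is the start of the \<open>n\<close>-th block.\<close>
lemma block_starts:
  assumes iso: "\<forall>i. w i \<or> w (i+1 :: int)"
  obtains e :: "int \<Rightarrow> int" where "\<And>n. w (e n - 1)" "\<And>n. e (n+1) = e n + (if w (e n) then 1 else 2)"
    "\<And>j. \<exists>n. j = e n \<or> j = e n + 1 \<and> \<not> w (e n)"
proof -
  define S where "S = {j. w (j - 1)}"
  obtain x0 where x0: "x0 \<in> S" using iso[rule_format, of 0] unfolding S_def
    by (metis (full_types) add_diff_cancel mem_Collect_eq diff_add_cancel)
  define s where "s j = j + (if w j then 1 else 2)" for j :: int
  \<comment> \<open>The letter at \<open>j - 1\<close> is \<open>True\<close>; it is a block of its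
    own if \<open>True\<close> precedes it, and otherwise it ends a block
    \<open>False True\<close>.\<close>
  define p where "p j = (if w (j - 2) then j - 1 else j - 2)" for j :: int
  have "s x \<in> S" if "x \<in> S" for x
    using iso[rule_format, of x] unfolding S_def s_def by (auto simp: add.commute)
  moreover have "p x \<in> S \<and> s (p x) = x" if "x \<in> S" for x
    using that iso[rule_format, of "x - 3"] unfolding S_def s_def p_def by auto
  ultimately obtain e :: "int \<Rightarrow> int" where e: "\<And>n. e n \<in> S" "\<And>n. e (n+1) = s (e n)"
    using int_orbit[OF x0, of s p] by metis
  have cov: "\<exists>n. j = e n \<or> j = e n + 1 \<and> \<not> w (e n)" for j
  proof (cases "e 0 \<le> j")
    case True
    then show ?thesis
    proof (induction j rule: int_ge_induct)
      case (step j)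
      then obtain n where n: "j = e n \<or> j = e n + 1 \<and> \<not> w (e n)" by blast
      show ?case
      proof (cases "j = e n \<and> \<not> w (e n)")
        case False
        then have "j + 1 = e (n+1)" using n e(2)[of n] by (auto simp: s_def)
        then show ?thesis by blast
      qed auto
    qed blast
  next
    case False
    then have "j \<le> e 0" by simp
    then show ?thesis
    proof (induction j rule: int_le_induct)
      case (step j)
      then obtain n where n: "j = e n \<or> j = e n + 1 \<and> \<not> w (e n)" by blast
      show ?case
      proof (cases "j = e n")
        case True
        have "e n = e (n-1) + (if w (e (n-1)) then 1 else 2)" using e(2)[of "n-1"] by (simp add: s_def)
        then show ?thesis using True by (intro exI[of _ "n-1"]) (auto split: if_splits)
      qed (use n in auto)
    qed blast
  qed
  show thesis by (rule that[of e]) (use e cov in \<open>auto simp: S_def s_def\<close>)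
qed

text \<open>A block start always follows a \<open>True\<close>, so one mirrored pair of letters
  agrees without a counterpart among the blocks: if \<open>k\<close> blocks agree before the first
  difference, then \<open>m > k\<close> letters do, and the bound drops by one.\<close>

lemma desubstitute:
  assumes rc: "reflected_cuts (Suc R) w" and iso: "\<forall>i. w i \<or> w (i+1)"
    and e: "\<And>n. w (e n - 1)" "\<And>n. e (n+1) = e n + (if w (e n) then 1 else 2)"
  shows "reflected_cuts R (\<lambda>n. w (e n))"
  unfolding reflected_cuts_def
proof (intro allI impI)
  fix n assume cut: "w (e n) \<noteq> w (e (n+1))"
  define i where "i = e n"
  have i: "w i \<noteq> w (i+1)" "e (n+2) = i + 3" 
  proof -
    have 1: "e (n+2) = e (n+1) + (if w (e (n+1)) then 1 else 2)" using e(2)[of "n+1"] by (simp add: add.assoc)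
    show "w i \<noteq> w (i+1)" using cut e(2)[of n] iso[rule_format, of i] iso[rule_format, of "i+1"] by (auto simp: i_def add.commute split: if_splits)
    show "e (n+2) = i + 3" using cut e(2)[of n] 1 by (auto simp: i_def)
  qed
  obtain m where m: "m \<le> Suc R" "\<And>k. k < m \<Longrightarrow> w (i - 1 - int k) = w (i + 2 + int k)"
    "w (i - 1 - int m) = w (i+1)" "w (i + 2 + int m) = w i"
    using reflected_cutsE[OF rc i(1)] by blast
  define v where "v n = w (e n)" for n
  have pred: "e (l - 1) = e l - (if v (l-1) then 1 else 2)" for l
    using e(2)[of "l-1"] by (simp add: v_def)
  \<comment> \<open>The \<open>k\<close> matching blocks cover \<open>l\<close> letters on each
    side. Altogether \<open>l + 1\<close> mirrored pairs match, the last one because both of its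
    members precede block starts.\<close>
  have inv: "\<exists>l\<ge>k. e (n - int k) = i - int l \<and> e (n + 2 + int k) = i + 3 + int l \<and>
      (\<forall>q\<le>l. w (i - 1 - int q) = w (i + 2 + int q))" (is "?I k")
    if "\<forall>j<k. v (n - 1 - int j) = v (n + 2 + int j)" for k
    using that
  proof (induction k)
    case 0
    have "w (i - 1)" "w (i + 2)" using e(1)[of n] e(1)[of "n+2"] i(2) by (auto simp: i_def add.commute)
    then show ?case using i(2) by (intro exI[of _ 0]) (auto simp: i_def)
  next
    case (Suc k)
    then obtain l where l: "l \<ge> k" "e (n - int k) = i - int l" "e (n + 2 + int k) = i + 3 + int l"
      "\<forall>q\<le>l. w (i - 1 - int q) = w (i + 2 + int q)" by auto
    have eq: "v (n - 1 - int k) = v (n + 2 + int k)" using Suc.prems by auto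
    define d where "d = (if v (n + 2 + int k) then 1 else 2 :: nat)"
    have e1: "e (n - int (Suc k)) = i - int (l + d)"
      using pred[of "n - int k"] l eq by (auto simp: d_def algebra_simps)
    have e2: "e (n + 2 + int (Suc k)) = i + 3 + int (l + d)"
      using e(2)[of "n + 2 + int k"] l by (auto simp: d_def v_def algebra_simps)
    have end1: "w (i - 1 - int (l+d))" using e(1)[of "n - int (Suc k)"] e1 by (auto simp: algebra_simps)
    have end2: "w (i + 2 + int (l+d))" using e(1)[of "n + 2 + int (Suc k)"] e2 by (auto simp: algebra_simps)
    have mid: "w (i - 1 - int (l+1)) = w (i + 2 + int (l+1))" if "d = 2"
    proof -
      have "\<not> v (n + 2 + int k)" using that by (auto simp: d_def split: if_splits)
      moreover have "e (n - 1 - int k) = i - 1 - int (l+1)" using e1 that by (simp add: algebra_simps)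
      moreover have "e (n + 2 + int k) = i + 2 + int (l+1)" using l by simp
      ultimately show ?thesis using eq by (simp add: v_def)
    qed
    have "w (i - 1 - int q) = w (i + 2 + int q)" if "q \<le> l + d" for q
    proof -
      have "d = 1 \<or> d = 2" by (auto simp: d_def)
      then have "q \<le> l \<or> q = l + d \<or> q = l + 1 \<and> d = 2" using that by linarith
      then consider "q \<le> l" | "q = l + d" | "q = l + 1" "d = 2" by blast
      then show ?thesis using l(4) end1 end2 mid by cases auto
    qed
    moreover have "Suc k \<le> l + d" using l(1) by (auto simp: d_def)
    ultimately show ?case using e1 e2 by blast
  qed
  have "\<exists>k. v (n - 1 - int k) \<noteq> v (n + 2 + int k)"
  proof (rule ccontr)
    assume "\<nexists>k. v (n - 1 - int k) \<noteq> v (n + 2 + int k)"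
    then obtain l where "l \<ge> m" "\<forall>q\<le>l. w (i - 1 - int q) = w (i + 2 + int q)" using inv[of m] by blast
    then show False using m i by auto
  qed
  then obtain k where k: "v (n - 1 - int k) \<noteq> v (n + 2 + int k)" "\<forall>j<k. v (n - 1 - int j) = v (n + 2 + int j)"
    using exists_least_iff[of "\<lambda>k. v (n - 1 - int k) \<noteq> v (n + 2 + int k)"] by blast
  obtain l where l: "l \<ge> k" "e (n - int k) = i - int l" "e (n + 2 + int k) = i + 3 + int l"
      "\<forall>q\<le>l. w (i - 1 - int q) = w (i + 2 + int q)" using inv[OF k(2)] by blast
  have "m > l" using m(3,4) l(4) i by (metis leI)
  have "e (n + 2 + int k) = i + 2 + int (l+1)" using l(3) by simp
  then have R: "w (i + 2 + int (l+1)) = v (n + 2 + int k)" by (simp only: v_def)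
  \<comment> \<open>If the left one of the differing blocks is \<open>True\<close>, the letter in
    question is the one before it, which is \<open>True\<close> as well.\<close>
  have L: "w (i - 1 - int (l+1)) = v (n - 1 - int k)"
  proof (cases "v (n - 1 - int k)")
    case True
    then have "e (n - 1 - int k) - 1 = i - 1 - int (l+1)" using pred[of "n - int k"] l by (simp add: algebra_simps)
    then have "w (i - 1 - int (l+1))" using e(1)[of "n - 1 - int k"] by (simp only:)
    then show ?thesis using True by (simp only:)
  next
    case False
    then have "e (n - 1 - int k) = i - 1 - int (l+1)" using pred[of "n - int k"] l by (simp add: algebra_simps)
    then show ?thesis by (simp add: v_def)
  qed
  have "m = l + 1" using L R k(1) m(2)[of "l+1"] \<open>m > l\<close> by (metis Suc_eq_plus1 Suc_lessI)
  have v1: "v n = w i" "v (n+1) = w (i+1)" using cut i by (auto simp: v_def i_def)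
  show "\<exists>m\<le>R. (\<forall>k<m. w (e (n - 1 - int k)) = w (e (n + 2 + int k))) \<and>
            w (e (n - 1 - int m)) = w (e (n+1)) \<and> w (e (n + 2 + int m)) = w (e n)"
    using k(2) L R m \<open>m = l + 1\<close> l(1) v1 unfolding v_def by (intro exI[of _ k]) auto
qed

text \<open>Since the blocks repeat, \<open>D\<close> consecutive blocks have the same total length
  wherever they start; it lies between \<open>D\<close> and \<open>2 * D\<close>.\<close>

lemma periodic_isolated:
  assumes iso: "\<forall>i. w i \<or> w (i+1)"
    and e: "\<And>n. e (n+1) = e n + (if w (e n) then 1 else 2)"
      "\<And>j. \<exists>n. j = e n \<or> j = e n + 1 \<and> \<not> w (e n)"
    and D: "1 \<le> D" "\<And>n. w (e (n + int D)) = w (e n)"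
  obtains K where "1 \<le> K" "K \<le> 2 * D" "\<And>j. w (j + int K) = w j"
proof -
  have b: "e 0 + int d \<le> e (int d)" "e (int d) \<le> e 0 + 2 * int d" for d
    by (induction d) (use e(1)[of "int _"] in \<open>auto simp: add_ac split: if_splits\<close>)
  define K where "K = nat (e (int D) - e 0)"
  have K0: "e (int D) - e 0 = int K" using b[of D] by (simp add: K_def)
  have K: "e (n + int D) - e n = int K" for n
  proof (induction n rule: int_induct[where k=0])
    case base then show ?case using K0 by simp
  next
    case (step1 i)
    then show ?case using e(1)[of i] e(1)[of "i + int D"] D(2)[of i] by (simp add: algebra_simps)
  next
    case (step2 i)
    then show ?case using e(1)[of "i-1"] e(1)[of "i - 1 + int D"] D(2)[of "i-1"] by (simp add: algebra_simps)
  qed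
  have "w (j + int K) = w j" for j
  proof -
    obtain n where "j = e n \<or> j = e n + 1 \<and> \<not> w (e n)" using e(2) by blast
    then show ?thesis
    proof
      assume j: "j = e n"
      then have "j + int K = e (n + int D)" using K[of n] by simp
      then show ?thesis using j D(2)[of n] by simp
    next
      assume j: "j = e n + 1 \<and> \<not> w (e n)"
      then have "j + int K = e (n + int D) + 1" using K[of n] by simp
      then show ?thesis using j D(2)[of n] iso by metis
    qed
  qed
  moreover have "1 \<le> K" "K \<le> 2 * D" using b[of D] K0 D(1) by linarith+
  ultimately show thesis using that by blast
qed

text \<open>Each desubstitution lowers \<open>R\<close> by one and at most doubles the period. For
  \<open>R = 0\<close> a single cut forces cuts everywhere, so the word is constant or
  alternating.\<close>

lemma reflected_cuts_periodic:
  assumes "reflected_cuts R w"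
  shows "\<exists>D\<ge>1. D \<le> 2 ^ Suc R \<and> (\<forall>i. w (i + int D) = w i)"
  using assms
proof (induction R arbitrary: w)
  case (0 w)
  have nb: "w (i+2) = w i \<and> w (i-1) = w (i+1)" if ne: "w i \<noteq> w (i+1)" for i
  proof -
    obtain m where "m \<le> 0" "w (i - 1 - int m) = w (i+1)" "w (i + 2 + int m) = w i"
      using reflected_cutsE[OF 0 ne] by blast
    then show ?thesis by simp
  qed
  show ?case
  proof (cases "\<exists>i. w i \<noteq> w (i+1)")
    case True
    then obtain i0 where i0: "w i0 \<noteq> w (i0+1)" by blast
    have cut: "w i \<noteq> w (i+1)" for i
    proof (induction i rule: int_induct[where k=i0])
      case (step1 i)
      then have "w (i+2) = w i" "w (i+1) \<noteq> w i" using nb by auto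
      then show ?case by (simp add: add.assoc)
    next
      case (step2 i)
      then have "w (i-1) = w (i+1)" "w (i+1) \<noteq> w i" using nb by auto
      then show ?case by simp
    qed (rule i0)
    have "w (i + int 2) = w i" for i using nb[OF cut[of i]] by simp
    then show ?thesis by (intro exI[of _ 2]) auto
  next
    case False
    then have f: "w i = w (i+1)" for i by blast
    have "w (i + int 1) = w i" for i using f[of i] by simp
    then show ?thesis by (intro exI[of _ 1] conjI allI) (simp_all only: le_refl one_le_power one_le_numeral)
  qed
next
  case (Suc R)
  have main: "\<exists>D\<ge>1. D \<le> 2 ^ Suc (Suc R) \<and> (\<forall>i. w (i + int D) = w i)"
    if rc: "reflected_cuts (Suc R) w" and iso: "\<forall>i. w i \<or> w (i+1)" for w
  proof (rule block_starts[OF iso])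
    fix e :: "int \<Rightarrow> int" assume e: "\<And>n. w (e n - 1)" "\<And>n. e (n+1) = e n + (if w (e n) then 1 else 2)"
      "\<And>j. \<exists>n. j = e n \<or> j = e n + 1 \<and> \<not> w (e n)"
    have "\<exists>D\<ge>1. D \<le> 2 ^ Suc R \<and> (\<forall>n. w (e (n + int D)) = w (e n))"
      by (rule Suc.IH[OF desubstitute[OF rc iso, where e=e, OF e(1) e(2)]])
    then obtain D where D: "D \<ge> 1" "D \<le> 2 ^ Suc R" "\<And>n. w (e (n + int D)) = w (e n)"
      by blast
    show ?thesis
    proof (rule periodic_isolated[OF iso, where e=e and D=D, OF e(2) e(3) D(1) D(3)])
      fix K assume K: "1 \<le> K" "K \<le> 2 * D" "\<And>j. w (j + int K) = w j"
      have "K \<le> 2 ^ Suc (Suc R)" using K(2) D(2) by simp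
      then show ?thesis using K(1,3) by blast
    qed
  qed
  show ?case
  proof (cases "\<forall>i. w i \<or> w (i+1)")
    case True then show ?thesis by (rule main[OF Suc.prems])
  next
    case False
    then have iso: "\<forall>i. \<not> w i \<or> \<not> w (i+1)" using not_both_squares[OF Suc.prems] by blast
    show ?thesis using main[OF reflected_cuts_compl[OF Suc.prems] iso] by (simp only: simp_thms)
  qed
qed

text \<open>In a sequence over 1 and 2 whose Markov value is below 3 put \<open>u i \<longleftrightarrow> a i = 2\<close>. At a change
  \<open>\<dots> Z 2 2 | 1 1 Y \<dots>\<close> the identity \<open>\<lambda> = 3 + 1/(2 + 1/Z) - 1/(2 + 1/Y)\<close>, with \<open>Z\<close> read to the left,
  forces \<open>Z < Y\<close>; if \<open>\<lambda>\<close> stays away from 3, the comparison is decided within boundedly many letters.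
  After the runs are shown to be even, halving them turns this into \<open>reflected_cuts\<close>.\<close>
definition paired_cuts :: "nat \<Rightarrow> (int \<Rightarrow> bool) \<Rightarrow> bool" where
  "paired_cuts R u \<longleftrightarrow> (\<forall>i. u i \<noteq> u (i+1) \<longrightarrow> u (i-1) = u i \<and> u (i+2) = u (i+1) \<and>
     (\<exists>m\<le>R. (\<forall>k<m. u (i - 2 - int k) = u (i + 3 + int k)) \<and>
            u (i + 3 + int m) = (if even m then u i else u (i+1)) \<and>
            u (i - 2 - int m) = (if even m then u (i+1) else u i)))"

lemma paired_cutsE:
  assumes "paired_cuts R u" "u i \<noteq> u (i+1)"
  obtains m where "u (i-1) = u i" "u (i+2) = u (i+1)" "m \<le> R" "\<And>k. k < m \<Longrightarrow> u (i - 2 - int k) = u (i + 3 + int k)"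
    "u (i + 3 + int m) = (if even m then u i else u (i+1))"
    "u (i - 2 - int m) = (if even m then u (i+1) else u i)"
  using assms unfolding paired_cuts_def by blast

section \<open>From paired cuts to reflected cuts\<close>

text \<open>Infinite descent: to the left of an odd run, the mirror image of what follows its first
  two letters contains a shorter odd run of the same letter.\<close>

lemma no_odd_run:
  assumes pc: "paired_cuts R u" and "odd j" "u i \<noteq> c" "\<forall>k\<in>{1..j}. u (i + int k) = c" "u (i + int j + 1) \<noteq> c"
  shows False
  using assms(2-)
proof (induction j arbitrary: i rule: less_induct)
  case (less j)
  have "j \<ge> 1" using less.prems(1) by (cases j) auto
  then have u1: "u (i+1) = c" using less.prems(3)[rule_format, of 1] by auto
  obtain m where m: "u (i-1) = u i" "u (i+2) = u (i+1)" "\<And>k. k < m \<Longrightarrow> u (i - 2 - int k) = u (i + 3 + int k)"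
    "u (i + 3 + int m) = (if even m then u i else u (i+1))"
    "u (i - 2 - int m) = (if even m then u (i+1) else u i)"
  proof -
    have ne: "u i \<noteq> u (i+1)" using u1 less.prems(2) by simp
    show thesis by (rule paired_cutsE[OF pc ne]) (rule that)
  qed
  have "j \<noteq> 1" using m(2) u1 less.prems(4) by (auto simp: add.commute)
  then obtain l where l: "j = l + 2" "odd l" using less.prems(1) by (cases j; cases "j-1") auto
  have rc: "u (i + 3 + int k) = c" if "k < l" for k
    using less.prems(3)[rule_format, of "k+3"] that l by (auto simp: algebra_simps)
  have rl: "u (i + 3 + int l) \<noteq> c" using less.prems(4) l by (auto simp: algebra_simps)
  define n where "n = min m l"
  have run: "u (i - 2 - int n + int k) = c" if "k \<in> {1..n}" for k
  proof -
    have e: "i - 2 - int n + int k = i - 2 - int (n - k)" using that by auto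
    have "n - k < m" "n - k < l" using that by (auto simp: n_def)
    then show ?thesis using m(3)[of "n-k"] rc[of "n-k"] unfolding e by auto
  qed
  have "m \<noteq> l" using m(4) rl u1 l by auto
  \<comment> \<open>Where the mirror breaks inside the run, the right letter is still
    \<open>c\<close>, so \<open>m\<close> is odd and the left letter is not
    \<open>c\<close>.\<close>
  have "odd n"
    using rc[of m] m(4) u1 less.prems(2) l \<open>m \<noteq> l\<close> by (cases "m < l") (auto simp: n_def min_def split: if_splits)
  moreover have "u (i - 2 - int n) \<noteq> c"
  proof (cases "m < l")
    case True then show ?thesis using m(5) \<open>odd n\<close> less.prems(2) by (auto simp: n_def)
  next
    case False
    then have "l < m" "n = l" using \<open>m \<noteq> l\<close> by (auto simp: n_def)
    then show ?thesis using m(3)[of l] rl by auto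
  qed
  moreover have "u (i - 2 - int n + int n + 1) \<noteq> c" using m(1) less.prems(2) by simp
  moreover have "n < j" using l by (simp add: n_def)
  ultimately show False using less.IH[of n "i - 2 - int n"] run by blast
qed

lemma cuts_same_parity:
  assumes pc: "paired_cuts R u" and "u i \<noteq> u (i+1)" "u j \<noteq> u (j+1)" "i < j"
  shows "even (j - i)"
  using assms(2-)
proof (induction "nat (j - i)" arbitrary: i j rule: less_induct)
  case less
  show ?case
  proof (cases "\<exists>k. i < k \<and> k < j \<and> u k \<noteq> u (k+1)")
    case True
    then obtain k where k: "i < k" "k < j" "u k \<noteq> u (k+1)" by blast
    have "even (k - i)" "even (j - k)" using less.hyps[of k i] less.hyps[of j k] less.prems k by auto
    then show ?thesis by presburger
  next
    case False
    define d where "d = nat (j - i)"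
    have d: "j = i + int d" "d \<ge> 1" using less.prems by (auto simp: d_def)
    have run: "u (i + int k) = u (i+1)" if "k \<in> {1..d}" for k
    proof -
      have "1 \<le> k \<Longrightarrow> k \<le> d \<Longrightarrow> u (i + int k) = u (i+1)"
      proof (induction k rule: dec_induct)
        case (step n)
        then have "u (i + int n) = u (i + int n + 1)" using False d by auto
        then show ?case using step by (auto simp: add_ac)
      qed auto
      then show ?thesis using that by auto
    qed
    have "u (i + int d) = u (i+1)" using run[of d] d by auto
    then have "u (i + int d + 1) \<noteq> u (i+1)" using less.prems d by auto
    then have "\<not> odd d" using no_odd_run[OF pc, of d i "u (i+1)"] run less.prems by auto
    then show ?thesis using d by simp
  qed
qed

text \<open>All cuts have the same parity, so the letters come in equal pairs and \<open>w\<close>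
  keeps one letter per pair. A first difference after an odd number of letters would split a
  pair.\<close>

lemma paired_cuts_periodic:
  assumes pc: "paired_cuts R u"
  shows "\<exists>D\<ge>1. D \<le> 2 ^ (R + 2) \<and> (\<forall>i. u (i + int D) = u i)"
proof (cases "\<exists>i. u i \<noteq> u (i+1)")
  case False
  then have f: "u i = u (i+1)" for i by blast
    have "u (i + int 1) = u i" for i using f[of i] by simp
  then show ?thesis by (intro exI[of _ 1] conjI allI) (simp_all only: le_refl one_le_power one_le_numeral)
next
  case True
  then obtain i0 where i0: "u i0 \<noteq> u (i0+1)" by blast
  have pair: "u (i0 + 2*k + 1) = u (i0 + 2*k + 2)" for k
  proof (rule ccontr)
    assume "\<not> ?thesis"
    then have c: "u (i0 + 2*k + 1) \<noteq> u (i0 + 2*k + 1 + 1)" by (simp add: add.assoc)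
    have "i0 < i0 + 2*k+1 \<or> i0 + 2*k+1 < i0" by presburger
    then have "even (2*k+1)"
      using cuts_same_parity[OF pc i0 c] cuts_same_parity[OF pc c i0] by auto
    then show False by simp
  qed
  define w where "w k = u (i0 + 2*k + 1)" for k
  have "reflected_cuts R w" unfolding reflected_cuts_def
  proof (intro allI impI)
    fix k assume cut: "w k \<noteq> w (k+1)"
    define i where "i = i0 + 2*k + 2"
    have ui: "u i = w k" "u (i+1) = w (k+1)" using pair[of k] by (auto simp: i_def w_def algebra_simps)
    then have "u i \<noteq> u (i+1)" using cut by simp
    then obtain m where m: "m \<le> R" "\<And>k. k < m \<Longrightarrow> u (i - 2 - int k) = u (i + 3 + int k)"
      "u (i + 3 + int m) = (if even m then u i else u (i+1))"
      "u (i - 2 - int m) = (if even m then u (i+1) else u i)"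
      by (rule paired_cutsE[OF pc]) (rule that)
    have L: "u (i - 2 - int (2*q)) = w (k - 1 - int q)" "u (i - 2 - int (2*q+1)) = w (k - 1 - int q)" for q
      using pair[of "k - 1 - int q"] by (auto simp: i_def w_def algebra_simps)
    have Rr: "u (i + 3 + int (2*q)) = w (k + 2 + int q)" "u (i + 3 + int (2*q+1)) = w (k + 2 + int q)" for q
      using pair[of "k + 2 + int q"] by (auto simp: i_def w_def algebra_simps)
    have "even m"
    proof (rule ccontr)
      assume "odd m"
      then obtain q where q: "m = 2*q+1" by (metis oddE)
      then have "w (k - 1 - int q) = w (k + 2 + int q)" using m(2)[of "2*q"] L(1)[of q] Rr(1)[of q] by auto
      then show False using m(3,4) L(2)[of q] Rr(2)[of q] q ui cut by auto
    qed
    then obtain q where q: "m = 2*q" by (metis evenE)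
    show "\<exists>m\<le>R. (\<forall>ka<m. w (k - 1 - int ka) = w (k + 2 + int ka)) \<and>
               w (k - 1 - int m) = w (k + 1) \<and> w (k + 2 + int m) = w k"
    proof (intro exI[of _ q] conjI allI impI)
      fix r assume "r < q"
      then show "w (k - 1 - int r) = w (k + 2 + int r)" using m(2)[of "2*r"] L(1)[of r] Rr(1)[of r] q by auto
    qed (use m q L(1)[of q] Rr(1)[of q] ui in auto)
  qed
  then obtain D where D: "D \<ge> 1" "D \<le> 2 ^ Suc R" "\<And>k. w (k + int D) = w k"
    using reflected_cuts_periodic by blast
  have "u (i + int (2*D)) = u i" for i
  proof -
    obtain k where "i = i0 + 2*k + 1 \<or> i = i0 + 2*k + 2"
    proof (cases "even (i - i0)")
      case True then show ?thesis using that[of "(i - i0) div 2 - 1"] by auto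
    next
      case False
      then have "i = i0 + 2 * ((i - i0) div 2) + 1" by presburger
      then show ?thesis using that by blast
    qed
    then show ?thesis using D(3)[of k] pair[of k] pair[of "k + int D"] by (auto simp: w_def algebra_simps)
  qed
  then show ?thesis using D by (intro exI[of _ "2*D"]) auto
qed

section \<open>The spectrum, limits of sequences, and discreteness below 3\<close>

text \<open>The equation \<open>markov_value a = ereal s\<close> in real terms, so that estimates
  avoid extended reals.\<close>

definition lam_sup :: "(int \<Rightarrow> nat) \<Rightarrow> real \<Rightarrow> bool" where
  "lam_sup a s \<longleftrightarrow> (\<forall>j. markov_lambda a j \<le> s) \<and> (\<forall>e>0. \<exists>j. s - e < markov_lambda a j)"

lemma markov_value_le: "markov_value a \<le> ereal s \<longleftrightarrow> (\<forall>j. markov_lambda a j \<le> s)"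
  by (simp add: markov_value_def SUP_le_iff)

lemma markov_value_eq: "markov_value a = ereal s \<longleftrightarrow> lam_sup a s"
proof
  assume m: "markov_value a = ereal s"
  have "\<exists>j. s - e < markov_lambda a j" if "0 < e" for e
  proof -
    have "ereal (s - e) < markov_value a" using m that by simp
    then show ?thesis unfolding markov_value_def less_SUP_iff by auto
  qed
  moreover have "\<forall>j. markov_lambda a j \<le> s" using m markov_value_le[of a s] by simp
  ultimately show "lam_sup a s" by (simp add: lam_sup_def)
next
  assume s: "lam_sup a s"
  show "markov_value a = ereal s"
  proof (rule antisym)
    show "markov_value a \<le> ereal s" unfolding markov_value_le using s unfolding lam_sup_def by blast
    show "ereal s \<le> markov_value a"
    proof (rule ccontr)
      assume "\<not> ?thesis"
      then have "markov_value a < ereal s" by simp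
      then obtain x where x: "markov_value a < ereal x" "ereal x < ereal s"
        using ereal_dense2 by blast
      then obtain j where "s - (s - x) < markov_lambda a j"
        using s x(2) unfolding lam_sup_def by (auto dest!: spec[of _ "s - x"])
      moreover have "markov_lambda a j \<le> x" using x(1) markov_value_le[of a x] by auto
      ultimately show False by simp
    qed
  qed
qed

lemma spectrum_iff: "t \<in> markov_spectrum \<longleftrightarrow> (\<exists>a. pos_seq a \<and> lam_sup a t)"
  by (simp add: markov_spectrum_def markov_value_eq)

lemma bounded_lam_sup:
  assumes "\<forall>j. markov_lambda a j \<le> s"
  obtains s' where "lam_sup a s'" "s' \<le> s"
proof -
  have bd: "bdd_above (range (markov_lambda a))" using assms by (auto simp: bdd_above_def)
  define s' where "s' = (SUP j. markov_lambda a j)"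
  have "\<exists>j. s' - e < markov_lambda a j" if "0 < e" for e
  proof -
    have "s' - e < (SUP j. markov_lambda a j)" using that by (simp add: s'_def)
    then show ?thesis using less_cSUP_iff[OF _ bd, of "s' - e"] by auto
  qed
  moreover have "\<forall>j. markov_lambda a j \<le> s'" unfolding s'_def using cSUP_upper[OF _ bd] by auto
  ultimately have "lam_sup a s'" unfolding lam_sup_def by blast
  moreover have "s' \<le> s" unfolding s'_def using assms by (intro cSUP_least) auto
  ultimately show thesis using that by blast
qed

section \<open>Compactness and attained suprema\<close>

lemma subsequence_limit:
  fixes f :: "nat \<Rightarrow> int \<Rightarrow> nat"
  assumes bd: "\<And>n i. f n i \<le> A"
  obtains g r where "strict_mono r" "\<And>i. \<forall>\<^sub>F n in sequentially. f (r n) i = g i"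
proof -
  interpret subseqs "\<lambda>k s. \<exists>c. \<forall>n. f (s n) (from_nat k) = c"
  proof
    fix k and s :: "nat \<Rightarrow> nat" assume "strict_mono s"
    have "(\<lambda>n. f (s n) (from_nat k)) ` UNIV \<subseteq> {..A}" using bd by auto
    then have "finite ((\<lambda>n. f (s n) (from_nat k)) ` UNIV)" using finite_subset by blast
    then obtain n0 where "infinite {n \<in> UNIV. f (s n) (from_nat k) = f (s n0) (from_nat k)}"
      using pigeonhole_infinite[of UNIV "\<lambda>n. f (s n) (from_nat k)"] by auto
    then obtain r' :: "nat \<Rightarrow> nat" where "strict_mono r'" "\<forall>n. r' n \<in> {n \<in> UNIV. f (s n) (from_nat k) = f (s n0) (from_nat k)}"
      using infinite_enumerate by blast
    then show "\<exists>r' :: nat \<Rightarrow> nat. strict_mono r' \<and> (\<exists>c. \<forall>n. f ((s \<circ> r') n) (from_nat k) = c)"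
      by auto
  qed
  have "\<exists>c. \<forall>n. f ((diagseq \<circ> ((+) (Suc k))) n) (from_nat k) = c" for k
    by (rule diagseq_holds) auto
  then obtain c where c: "\<And>k n. f ((diagseq \<circ> ((+) (Suc k))) n) (from_nat k) = c k"
    by metis
  show thesis
  proof (rule that[of diagseq "\<lambda>i. c (to_nat i)"])
    show "strict_mono diagseq" by (rule subseq_diagseq)
    show "\<forall>\<^sub>F n in sequentially. f (diagseq n) i = c (to_nat i)" for i
      unfolding eventually_sequentially
    proof (intro exI[of _ "Suc (to_nat i)"] allI impI)
      fix n assume "Suc (to_nat i) \<le> n"
      then obtain d where "n = Suc (to_nat i) + d" using le_Suc_ex by blast
      then show "f (diagseq n) i = c (to_nat i)" using c[of "to_nat i" d] by simp
    qed
  qed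
qed

lemma lam_tendsto:
  assumes "\<And>n. pos_seq (f n)" "pos_seq g" "\<And>i. \<forall>\<^sub>F n in sequentially. f n i = g i"
  shows "(\<lambda>n. markov_lambda (f n) j) \<longlonglongrightarrow> markov_lambda g j"
proof (rule metric_LIMSEQ_I)
  fix e :: real assume "0 < e"
  then obtain R :: nat where R: "8 / 2^R < e" using err_small by blast
  have "\<forall>\<^sub>F n in sequentially. \<forall>i\<in>{j - int R..j + int R}. f n i = g i"
    using assms(3) by (intro eventually_ball_finite) auto
  then obtain N where N: "\<forall>n\<ge>N. \<forall>i\<in>{j - int R..j + int R}. f n i = g i"
    unfolding eventually_sequentially by blast
  have "\<bar>markov_lambda (f n) j - markov_lambda g j\<bar> \<le> 8 / 2^R" if "n \<ge> N" for n
    by (rule lam_close[OF assms(1,2)]) (use N that in auto)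
  then show "\<exists>N. \<forall>n\<ge>N. dist (markov_lambda (f n) j) (markov_lambda g j) < e"
    using R unfolding dist_real_def by (meson le_less_trans)
qed

lemma limit_sequence:
  assumes pf: "\<And>n. pos_seq (f n)" and le: "\<And>n j. markov_lambda (f n) j \<le> s n"
    and s: "s \<longlonglongrightarrow> t" and l0: "(\<lambda>n. markov_lambda (f n) 0) \<longlonglongrightarrow> t"
  shows "\<exists>g r. pos_seq g \<and> strict_mono (r :: nat \<Rightarrow> nat) \<and> (\<forall>i. \<forall>\<^sub>F n in sequentially. f (r n) i = g i) \<and>
    markov_lambda g 0 = t \<and> (\<forall>j. markov_lambda g j \<le> t)"
proof -
  obtain K where K: "\<And>n. s n \<le> K"
    using convergent_imp_Bseq[OF convergentI[OF s]] unfolding Bseq_def by (metis abs_le_D1 real_norm_def)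
  have "f n i \<le> nat \<lceil>K\<rceil>" for n i
    using lam_gt[OF pf, of n i] le[of n i] K[of n] by linarith
  then obtain g r where gr: "strict_mono (r :: nat \<Rightarrow> nat)" "\<And>i. \<forall>\<^sub>F n in sequentially. f (r n) i = g i"
    using subsequence_limit by blast
  have pg: "pos_seq g" unfolding pos_seq_def
  proof
    fix i obtain n where "f (r n) i = g i" using gr(2)[of i] eventually_sequentially by auto
    then show "0 < g i" using pf[of "r n"] by (metis pos_seq_def)
  qed
  note lt = lam_tendsto[of "\<lambda>n. f (r n)", OF pf pg gr(2)]
  have "(\<lambda>n. markov_lambda (f (r n)) 0) \<longlonglongrightarrow> t" using LIMSEQ_subseq_LIMSEQ[OF l0 gr(1)] by (simp add: o_def)
  then have "markov_lambda g 0 = t" using lt LIMSEQ_unique by blast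
  moreover have "markov_lambda g j \<le> t" for j
    using LIMSEQ_le[OF lt[of j], of "\<lambda>n. s (r n)"] LIMSEQ_subseq_LIMSEQ[OF s gr(1)] le by (auto simp: o_def)
  ultimately show ?thesis using pg gr by (intro exI[of _ g] exI[of _ r] conjI allI)
qed

text \<open>Recentre \<open>b\<close> at positions whose values tend to the supremum and pass to a
  limit sequence.\<close>

lemma sup_attained:
  assumes "pos_seq b" "lam_sup b s"
  obtains b' where "pos_seq b'" "markov_lambda b' 0 = s" "\<And>j. markov_lambda b' j \<le> s"
proof -
  have "\<exists>j. s - inverse (real (Suc n)) < markov_lambda b j" for n
    using assms(2) unfolding lam_sup_def by simp
  then obtain j where j: "\<And>n. s - inverse (real (Suc n)) < markov_lambda b (j n)" by metis
  have le: "markov_lambda b k \<le> s" for k using assms(2) by (simp add: lam_sup_def)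
  have lim: "(\<lambda>n. s + - inverse (real (Suc n))) \<longlonglongrightarrow> s"
    by (rule LIMSEQ_inverse_real_of_nat_add_minus)
  have "(\<lambda>n. markov_lambda b (j n)) \<longlonglongrightarrow> s"
  proof (rule real_tendsto_sandwich[OF _ _ lim tendsto_const])
    show "\<forall>\<^sub>F n in sequentially. s + - inverse (real (Suc n)) \<le> markov_lambda b (j n)"
      using j by (intro always_eventually allI) (simp add: less_imp_le)
    show "\<forall>\<^sub>F n in sequentially. markov_lambda b (j n) \<le> s"
      using le by (intro always_eventually allI)
  qed
  then have l0: "(\<lambda>n. markov_lambda (shift_seq (j n) b) 0) \<longlonglongrightarrow> s"
    using assms(1) by (simp add: lam_shift)
  have "\<And>n. pos_seq (shift_seq (j n) b)" using assms(1) by simp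
  moreover have "\<And>n i. markov_lambda (shift_seq (j n) b) i \<le> s"
    using assms(1) le by (simp add: lam_shift)
  ultimately obtain g where "pos_seq g" "markov_lambda g 0 = s" "\<forall>j. markov_lambda g j \<le> s"
    using limit_sequence[of "\<lambda>n. shift_seq (j n) b" "\<lambda>_. s" s, OF _ _ tendsto_const l0]
    by auto
  then show thesis by (intro that[of g]) auto
qed

text \<open>The form in which a point of \<open>M'\<close> is used: every approximant is centred
  where its supremum is attained. That these suprema tend to \<open>t\<close> follows from the
  agreement on long windows.\<close>

definition spectrum_limit :: "(int \<Rightarrow> nat) \<Rightarrow> real \<Rightarrow> bool" where
  "spectrum_limit a t \<longleftrightarrow> pos_seq a \<and> markov_lambda a 0 = t \<and> (\<forall>j. markov_lambda a j \<le> t) \<and>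
     (\<forall>N::nat. \<exists>b. pos_seq b \<and> (\<forall>i. \<bar>i\<bar> \<le> int N \<longrightarrow> b i = a i) \<and>
        (\<forall>j. markov_lambda b j \<le> markov_lambda b 0) \<and> markov_lambda b 0 \<noteq> t)"

lemma spectrum_limit_rev: assumes "spectrum_limit a t" shows "spectrum_limit (rev_seq a) t"
  unfolding spectrum_limit_def
proof (intro conjI allI)
  have a: "pos_seq a" "markov_lambda a 0 = t" "\<And>j. markov_lambda a j \<le> t"
    using assms by (auto simp: spectrum_limit_def)
  then show "pos_seq (rev_seq a)" "markov_lambda (rev_seq a) 0 = t" "\<And>j. markov_lambda (rev_seq a) j \<le> t"
    by (auto simp: lam_rev)
  fix N :: nat
  obtain b where b: "pos_seq b" "\<forall>i. \<bar>i\<bar> \<le> int N \<longrightarrow> b i = a i"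
        "\<forall>j. markov_lambda b j \<le> markov_lambda b 0" "markov_lambda b 0 \<noteq> t"
    using assms unfolding spectrum_limit_def by blast
  then show "\<exists>b. pos_seq b \<and> (\<forall>i. \<bar>i\<bar> \<le> int N \<longrightarrow> b i = rev_seq a i) \<and>
        (\<forall>j. markov_lambda b j \<le> markov_lambda b 0) \<and> markov_lambda b 0 \<noteq> t"
    by (intro exI[of _ "rev_seq b"]) (auto simp: lam_rev)
qed

lemma islimpt_spectrum_limit:
  assumes "t islimpt markov_spectrum"
  obtains a where "spectrum_limit a t"
proof -
  obtain s where s: "\<And>n. s n \<in> markov_spectrum - {t}" "s \<longlonglongrightarrow> t"
    using assms unfolding islimpt_sequential by blast
  have "\<exists>b. pos_seq b \<and> markov_lambda b 0 = s n \<and> (\<forall>j. markov_lambda b j \<le> s n)" for n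
    using s(1)[of n] sup_attained unfolding spectrum_iff Diff_iff by metis
  then obtain f where f: "\<And>n. pos_seq (f n)" "\<And>n. markov_lambda (f n) 0 = s n"
    "\<And>n j. markov_lambda (f n) j \<le> s n" by metis
  have "(\<lambda>n. markov_lambda (f n) 0) \<longlonglongrightarrow> t" using f(2) s(2) by simp
  then obtain g r where g: "pos_seq g" "strict_mono (r :: nat \<Rightarrow> nat)" "\<forall>i. \<forall>\<^sub>F n in sequentially. f (r n) i = g i"
    "markov_lambda g 0 = t" "\<forall>j. markov_lambda g j \<le> t"
    using limit_sequence[where f=f and s=s and t=t, OF f(1) f(3) s(2)] by blast
  have "\<exists>b. pos_seq b \<and> (\<forall>i. \<bar>i\<bar> \<le> int N \<longrightarrow> b i = g i) \<and>
        (\<forall>j. markov_lambda b j \<le> markov_lambda b 0) \<and> markov_lambda b 0 \<noteq> t" for N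
  proof -
    have "\<forall>\<^sub>F n in sequentially. \<forall>i\<in>{- int N..int N}. f (r n) i = g i"
      using g(3) by (intro eventually_ball_finite) auto
    then obtain n where n: "\<forall>i\<in>{- int N..int N}. f (r n) i = g i"
      unfolding eventually_sequentially by auto
    have "\<forall>i. \<bar>i\<bar> \<le> int N \<longrightarrow> f (r n) i = g i" using n by (simp add: abs_le_iff)
    then show ?thesis using f s(1)[of "r n"] by (intro exI[of _ "f (r n)"]) simp
  qed
  then have "spectrum_limit g t" using g unfolding spectrum_limit_def by blast
  then show thesis by (rule that)
qed

section \<open>Finiteness of the spectrum below \<open>3 - d\<close>\<close>

lemma cut_21:
  assumes p: "pos_seq a" and le: "\<And>j. markov_lambda a j \<le> 3 - d" and d: "2 / 2^R < d"
    and i: "a i = 2" "a (i+1) = 1"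
  shows "a (i-1) = 2 \<and> a (i+2) = 1 \<and> (\<exists>m\<le>R. (\<forall>k<m. a (i - 2 - int k) = a (i + 3 + int k)) \<and>
     a (i + 3 + int m) = (if even m then 2 else 1) \<and> a (i - 2 - int m) = (if even m then 1 else 2))"
proof -
  have d0: "0 < d" using d by (rule le_less_trans[rotated]) simp
  have let12: "a j = 1 \<or> a j = 2" for j
  proof -
    have "real (a j) < 3" using lam_gt[OF p, of j] le[of j] d0 by linarith
    moreover have "0 < a j" using p by (simp add: pos_seq_def)
    ultimately show ?thesis by linarith
  qed
  have lam: "markov_lambda a i = 2 + 1 / rv a (i+1) + 1 / lv a (i-1)"
    using lam_eq_mid[OF p, of i] i by simp
  have r1: "rv a (i+1) = 1 + 1 / rv a (i+2)" using rv_step[OF p, of "i+1"] i by (simp add: add.assoc)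
  have rv1: "1 < rv a (i+1)" "rv a (i+1) < 2" using r1 inv_rv[OF p, of "i+2"] by auto
  \<comment> \<open>A factor 1 2 1 gives \<lambda> > 2 + 1/2 + 1/2.\<close>
  have am: "a (i-1) = 2"
  proof (rule ccontr)
    assume "a (i-1) \<noteq> 2"
    then have "a (i-1) = 1" using let12 by blast
    then have "lv a (i-1) < 2" using lv_bounds[OF p, of "i-1"] by simp
    then have "1/2 < 1 / lv a (i-1)" using lv_gt_1[OF p, of "i-1"] by (simp add: field_simps)
    moreover have "1/2 < 1 / rv a (i+1)" using rv1 by (simp add: field_simps)
    ultimately show False using lam le[of i] d0 by linarith
  qed
  \<comment> \<open>A factor 2 2 1 2 gives \<lambda> > 2 + 2/3 + 1/3.\<close>
  have ap: "a (i+2) = 1"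
  proof (rule ccontr)
    assume "a (i+2) \<noteq> 1"
    then have "a (i+2) = 2" using let12 by blast
    then have "2 < rv a (i+2)" using rv_bounds[OF p, of "i+2"] by simp
    then have "1 / rv a (i+2) < 1/2" by (simp add: field_simps)
    then have "rv a (i+1) < 3/2" using r1 by linarith
    then have "2/3 < 1 / rv a (i+1)" using rv1 by (simp add: field_simps)
    moreover have "lv a (i-1) < 3" using lv_bounds[OF p, of "i-1"] am by simp
    then have "1/3 < 1 / lv a (i-1)" using lv_gt_1[OF p, of "i-1"] by (simp add: field_simps)
    ultimately show False using lam le[of i] d0 by linarith
  qed
  define Y where "Y = rv a (i+3)"
  define Z where "Z = lv a (i-2)"
  have YZ: "1 < Y" "1 < Z" using rv_gt_1[OF p] lv_gt_1[OF p] by (auto simp: Y_def Z_def)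
  have e1: "1 / (1 + 1 / (1 + 1/Y)) = 1 - Y / (2*Y+1)"
  proof -
    have "1 + 1/Y = (Y+1)/Y" using YZ by (simp add: add_divide_distrib)
    then have "1 + 1 / (1 + 1/Y) = (2*Y+1)/(Y+1)" using YZ by (simp add: field_simps)
    then have "1 / (1 + 1 / (1 + 1/Y)) = (Y+1)/(2*Y+1)" by simp
    also have "\<dots> = 1 - Y / (2*Y+1)" using YZ by (simp add: field_simps)
    finally show ?thesis .
  qed
  have "rv a (i+2) = 1 + 1/Y" using rv_step[OF p, of "i+2"] ap by (simp add: Y_def add.assoc)
  then have "1 / rv a (i+1) = 1 - Y / (2*Y+1)" unfolding r1 using e1 by simp
  have "lv a (i-1) = 2 + 1/Z" using lv_step[OF p, of "i-1"] am by (simp add: Z_def)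
  moreover have "2 + 1/Z = (2*Z+1)/Z" using YZ by (simp add: add_divide_distrib)
  ultimately have "1 / lv a (i-1) = Z / (2*Z+1)" by simp
  with \<open>1 / rv a (i+1) = 1 - Y / (2*Y+1)\<close> have "d \<le> Y / (2*Y+1) - Z / (2*Z+1)"
    using lam le[of i] by linarith
  also have "\<dots> = (Y - Z) / ((2*Y+1)*(2*Z+1))"
  proof -
    have "2*Y+1 \<noteq> 0" "2*Z+1 \<noteq> 0" using YZ by auto
    then have "Y / (2*Y+1) - Z / (2*Z+1) = (Y*(2*Z+1) - Z*(2*Y+1)) / ((2*Y+1)*(2*Z+1))"
      by (rule diff_frac_eq)
    moreover have "Y*(2*Z+1) - Z*(2*Y+1) = Y - Z" by (simp add: algebra_simps)
    ultimately show ?thesis by simp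
  qed
  finally have dd: "d \<le> (Y - Z) / ((2*Y+1)*(2*Z+1))" .
  have "1 < (2*Y+1)*(2*Z+1)" using YZ by (intro less_1_mult) auto
  then have ddYZ: "d \<le> Y - Z" "Z < Y"
  proof -
    show "Z < Y"
    proof (rule ccontr)
      assume "\<not> Z < Y"
      then have "(Y - Z) / ((2*Y+1)*(2*Z+1)) \<le> 0"
        using \<open>1 < (2*Y+1)*(2*Z+1)\<close> by (intro divide_nonpos_pos) auto
      then show False using dd d0 by linarith
    qed
    then have "(Y - Z) / ((2*Y+1)*(2*Z+1)) \<le> (Y - Z) / 1"
      using \<open>1 < (2*Y+1)*(2*Z+1)\<close> by (intro divide_left_mono) auto
    then show "d \<le> Y - Z" using dd by simp
  qed
  \<comment> \<open>The two halves read outwards from the cut, both started at 0 so that they can be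
    compared as right quotients. Agreement at all indices up to \<open>R\<close> would give
    \<open>Y - Z \<le> 2 / 2^R < d\<close>.\<close>
  define A where "A = shift_seq (i+3) a"
  define B where "B = shift_seq (2-i) (rev_seq a)"
  have pAB: "pos_seq A" "pos_seq B" using p by (auto simp: A_def B_def)
  have rAB: "rv A 0 = Y" "rv B 0 = Z" by (simp_all add: A_def B_def Y_def Z_def rv_shift rv_rev)
  have AB: "A (int k) = a (i + 3 + int k)" "B (int k) = a (i - 2 - int k)" for k
    by (simp_all add: A_def B_def algebra_simps)
  have "\<exists>m\<le>R. A (int m) \<noteq> B (int m)"
  proof (rule ccontr)
    assume "\<not> ?thesis"
    then have eq: "A k = B k" if "0 \<le> k" "k \<le> int R" for k
      using that by (metis nat_0_le nat_le_iff)
    have "\<bar>rv A 0 - rv B 0\<bar> \<le> 2 / 2^R" by (rule rv_close[OF pAB]) (use eq in auto)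
    then show False using rAB ddYZ d by simp
  qed
  then obtain m0 where m0: "m0 \<le> R" "A (int m0) \<noteq> B (int m0)" by blast
  define m where "m = (LEAST m. A (int m) \<noteq> B (int m))"
  have mR: "m \<le> R" using m0 Least_le[of "\<lambda>m. A (int m) \<noteq> B (int m)" m0] by (simp add: m_def)
  have mne: "A (int m) \<noteq> B (int m)" unfolding m_def by (rule LeastI) (rule m0)
  have mlt: "A (int k) = B (int k)" if "k < m" for k using not_less_Least that unfolding m_def by blast
  have "rv B 0 < rv A 0" using rAB ddYZ by simp
  then have ord: "if even m then rv B (int m) < rv A (int m) else rv A (int m) < rv B (int m)"
    using rv_steps_less[OF pAB(2,1), of m 0 0] mlt by (cases "even m") auto
  have "if even m then B (int m) < A (int m) else A (int m) < B (int m)"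
    using ord rv_less[OF pAB, of "int m" "int m"] rv_less[OF pAB(2,1), of "int m" "int m"] mne
    by (cases "even m"; cases "A (int m)" "B (int m)" rule: linorder_cases) auto
  then have "A (int m) = (if even m then 2 else 1)" "B (int m) = (if even m then 1 else 2)"
    using let12[of "i + 3 + int m"] let12[of "i - 2 - int m"] unfolding AB by (auto split: if_splits)
  then show ?thesis using am ap mR mlt unfolding AB by (intro conjI exI[of _ m]) auto
qed

lemma low_paired_cuts:
  assumes p: "pos_seq a" and le: "\<And>j. markov_lambda a j \<le> 3 - d" and d: "2 / 2^R < d"
  shows "paired_cuts R (\<lambda>i. a i = 2)" "a i = 1 \<or> a i = 2"
proof -
  have let12: "a j = 1 \<or> a j = 2" for j
  proof -
    have "0 < d" using d by (rule le_less_trans[rotated]) simp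
    then have "real (a j) < 3" using lam_gt[OF p, of j] le[of j] by linarith
    moreover have "0 < a j" using p by (simp add: pos_seq_def)
    ultimately show ?thesis by linarith
  qed
  then show "a i = 1 \<or> a i = 2" .
  have two: "a j = 2 \<longleftrightarrow> a j \<noteq> 1" for j using let12[of j] by auto
  show "paired_cuts R (\<lambda>i. a i = 2)" unfolding paired_cuts_def
  proof (intro allI impI)
    fix i assume cut: "(a i = 2) \<noteq> (a (i+1) = 2)"
    show "(a (i-1) = 2) = (a i = 2) \<and> (a (i+2) = 2) = (a (i+1) = 2) \<and>
     (\<exists>m\<le>R. (\<forall>k<m. (a (i - 2 - int k) = 2) = (a (i + 3 + int k) = 2)) \<and>
            (a (i + 3 + int m) = 2) = (if even m then a i = 2 else a (i+1) = 2) \<and>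
            (a (i - 2 - int m) = 2) = (if even m then a (i+1) = 2 else a i = 2))"
    proof (cases "a i = 2")
      case True
      then have "a (i+1) = 1" using cut let12[of "i+1"] by auto
      from cut_21[OF p le d True this] obtain m where
        "a (i-1) = 2" "a (i+2) = 1" "m \<le> R" "\<forall>k<m. a (i - 2 - int k) = a (i + 3 + int k)"
        "a (i + 3 + int m) = (if even m then 2 else 1)" "a (i - 2 - int m) = (if even m then 1 else 2)"
        by blast
      then show ?thesis using True \<open>a (i+1) = 1\<close> by (intro conjI exI[of _ m]) auto
    next
      case False
      then have a1: "a i = 1" "a (i+1) = 2" using cut let12[of i] by auto
      have "rev_seq a (-i-1) = 2" "rev_seq a (-i-1+1) = 1" using a1 by (auto simp: add.commute)
      from cut_21[of "rev_seq a", OF _ _ d this] p le obtain m where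
        m: "rev_seq a (-i-1-1) = 2" "rev_seq a (-i-1+2) = 1" "m \<le> R"
        "\<forall>k<m. rev_seq a (-i-1 - 2 - int k) = rev_seq a (-i-1 + 3 + int k)"
        "rev_seq a (-i-1 + 3 + int m) = (if even m then 2 else 1)"
        "rev_seq a (-i-1 - 2 - int m) = (if even m then 1 else 2)"
        by (auto simp: lam_rev)
      have e: "rev_seq a (-i-1-1) = a (i+2)" "rev_seq a (-i-1+2) = a (i-1)"
        "rev_seq a (-i-1 - 2 - int k) = a (i + 3 + int k)" "rev_seq a (-i-1 + 3 + int k) = a (i - 2 - int k)" for k
        by (simp_all add: algebra_simps)
      show ?thesis using m a1 unfolding e by (intro conjI exI[of _ m]) auto
    qed
  qed
qed

text \<open>These values come from sequences over 1 and 2 with bounded periods. The factorial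
  \<open>T\<close> is a common multiple of all these periods, and there are finitely many
  \<open>T\<close>-periodic sequences.\<close>

lemma finite_low_spectrum:
  assumes "0 < d" shows "finite {t \<in> markov_spectrum. t \<le> 3 - d}"
proof -
  obtain R :: nat where "8 / 2^R < d" using err_small[OF assms] by blast
  then have R: "2 / 2^R < d" by (rule le_less_trans[rotated]) (simp add: divide_right_mono)
  define T :: nat where "T = fact (2 ^ (R + 2))"
  define S where "S = {a :: int \<Rightarrow> nat. (\<forall>i. a i \<in> {1,2}) \<and> (\<forall>i. a (i + int T) = a i)}"
  have "finite S"
  proof (rule finite_imageD)
    show "finite ((\<lambda>a. map (\<lambda>k. a (int k)) [0..<T]) ` S)"
      by (rule finite_subset[OF _ finite_lists_length_eq[of "{1,2}" T]]) (auto simp: S_def)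
    show "inj_on (\<lambda>a. map (\<lambda>k. a (int k)) [0..<T]) S"
    proof (rule inj_onI, rule ext)
      fix a b i assume ab: "a \<in> S" "b \<in> S" "map (\<lambda>k. a (int k)) [0..<T] = map (\<lambda>k. b (int k)) [0..<T]"
      have T0: "0 < T" by (simp add: T_def)
      have per: "c i = c (i mod int T)" if "c \<in> S" for c i
      proof -
        have "c (j + int n * int T) = c j" for j n
        proof (induction n)
          case (Suc n)
          have "c (j + int (Suc n) * int T) = c ((j + int n * int T) + int T)" by (simp add: algebra_simps)
          then show ?case using Suc that by (simp add: S_def)
        qed simp
        then have shift: "c (j + m * int T) = c j" if "0 \<le> m" for j m using that by (metis nat_0_le)
        have dm: "i = i mod int T + (i div int T) * int T" by simp
        show ?thesis
        proof (cases "0 \<le> i div int T")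
          case True then show ?thesis using shift[OF True, of "i mod int T"] dm by simp
        next
          case False
          then have "c (i + (- (i div int T)) * int T) = c i" by (intro shift) simp
          then show ?thesis using dm by (simp add: minus_div_mult_eq_mod)
        qed
      qed
      have "nat (i mod int T) < T" using T0 by (simp add: nat_less_iff)
      moreover have "\<forall>k<T. a (int k) = b (int k)" using ab(3) by auto
      ultimately have "a (int (nat (i mod int T))) = b (int (nat (i mod int T)))" by blast
      then show "a i = b i" using per[OF ab(1), of i] per[OF ab(2), of i] T0 by simp
    qed
  qed
  moreover have "{t \<in> markov_spectrum. t \<le> 3 - d} \<subseteq> (\<lambda>a. real_of_ereal (markov_value a)) ` S"
  proof
    fix t assume "t \<in> {t \<in> markov_spectrum. t \<le> 3 - d}"
    then obtain a where a: "pos_seq a" "lam_sup a t" "t \<le> 3 - d" by (auto simp: spectrum_iff)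
    have le: "markov_lambda a j \<le> 3 - d" for j using a(2,3) unfolding lam_sup_def by (meson order_trans)
    note pc = low_paired_cuts[OF a(1) le R]
    obtain D where D: "1 \<le> D" "D \<le> 2 ^ (R+2)" "\<And>i. (a (i + int D) = 2) = (a i = 2)"
      using paired_cuts_periodic[OF pc(1)] by blast
    have perD: "a (i + int D) = a i" for i using D(3)[of i] pc(2)[of i] pc(2)[of "i + int D"] by auto
    have "a (i + int (n * D)) = a i" for i n
    proof (induction n)
      case (Suc n)
      have "a (i + int (Suc n * D)) = a ((i + int (n*D)) + int D)" by (simp add: algebra_simps)
      then show ?case using Suc perD by simp
    qed simp
    moreover have "D dvd T" unfolding T_def using D by (intro dvd_fact) auto
    ultimately have "a (i + int T) = a i" for i by (metis dvdE mult.commute)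
    then have "a \<in> S" using pc(2) by (auto simp: S_def)
    moreover have "t = real_of_ereal (markov_value a)" using a(2) by (simp flip: markov_value_eq)
    ultimately show "t \<in> (\<lambda>a. real_of_ereal (markov_value a)) ` S" by blast
  qed
  ultimately show ?thesis using finite_surj by blast
qed

lemma islimpt_ge_3:
  assumes "t islimpt markov_spectrum" shows "3 \<le> t"
proof (rule ccontr)
  assume "\<not> 3 \<le> t"
  define d where "d = (3 - t) / 2"
  have d: "0 < d" "t + d = 3 - d" using \<open>\<not> 3 \<le> t\<close> by (auto simp: d_def field_simps)
  have "infinite (markov_spectrum \<inter> ball t d)" using assms d(1) by (simp add: islimpt_eq_infinite_ball)
  moreover have "markov_spectrum \<inter> ball t d \<subseteq> {t \<in> markov_spectrum. t \<le> 3 - d}"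
    using d by (auto simp: dist_real_def)
  ultimately show False using finite_low_spectrum[OF d(1)] finite_subset by blast
qed

section \<open>Perturbing a tail of 1s\<close>

text \<open>The condition \<open>3 < s\<close> leaves room for another 22 in the tail. The bound at
  the left end confines the supremum to finitely many positions, where a change of \<lambda> can be
  detected.\<close>

definition perturbable :: "(int \<Rightarrow> nat) \<Rightarrow> real \<Rightarrow> bool" where
  "perturbable c s \<longleftrightarrow> pos_seq c \<and> lam_sup c s \<and> 3 < s \<and> (\<exists>K. \<forall>i\<ge>K. c i = 1) \<and>
     (\<exists>d>0. \<exists>J. \<forall>j\<le>J. markov_lambda c j \<le> s - d)"

text \<open>The sequence \<open>\<dots> 1 1 2 2 1 1 \<dots>\<close>, of Markov value exactly 3: appending it far to the right
  of a sequence ending in 1s costs nothing above level 3.\<close>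
definition seq22 :: "int \<Rightarrow> nat" where
  "seq22 i = (if i = 0 \<or> i = 1 then 2 else 1)"

lemma pos_seq22 [simp]: "pos_seq seq22"
  by (simp add: pos_seq_def seq22_def)

text \<open>Here \<open>p\<close> is the golden ratio, and the last identity is
  \<open>p^2 + p^(-2) = 3\<close>, since \<open>1 + p = p^2\<close>.\<close>

lemma ones_value:
  defines "p \<equiv> rv (\<lambda>_. 1) 0"
  shows "1 < p" "p = 1 + 1/p" "(1 + p) + 1 / (1 + p) = 3"
proof -
  have pos: "pos_seq (\<lambda>_. 1)" by (simp add: pos_seq_def)
  show p1: "1 < p" unfolding p_def by (rule rv_gt_1[OF pos])
  have "rv (\<lambda>_. 1) 1 = p" by (simp add: rv_def p_def)
  then show e: "p = 1 + 1/p" using rv_step[OF pos, of 0] by (simp add: p_def)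
  then have "p * p = p + 1" using p1 by (simp add: field_simps)
  then have "(1 + p) * (1 + p) + 1 = 3 * (1 + p)" by (simp add: algebra_simps)
  then show "(1 + p) + 1 / (1 + p) = 3" using p1 by (simp add: field_simps)
qed

lemma lam_seq22: "markov_lambda seq22 0 = 3" "markov_lambda seq22 1 = 3" "markov_lambda seq22 j \<le> 3"
proof -
  define p where "p = rv (\<lambda>_. 1) 0"
  note p = ones_value[folded p_def]
  have r2: "rv seq22 2 = p"
  proof -
    have "rv seq22 2 = rv (\<lambda>_. 1) 2" by (rule rv_cong) (simp add: seq22_def)
    then show ?thesis by (simp add: rv_def p_def)
  qed
  have l1: "lv seq22 (-1) = p"
  proof -
    have "lv seq22 (-1) = lv (\<lambda>_. 1) (-1)" by (rule lv_cong) (simp add: seq22_def)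
    then show ?thesis by (simp add: rv_def lv_def p_def)
  qed
  have r1: "rv seq22 1 = 1 + p" using rv_step[of seq22 1] r2 p(2) by (simp add: seq22_def)
  have l0: "lv seq22 0 = 1 + p" using lv_step[of seq22 0] l1 p(2) by (simp add: seq22_def)
  have "markov_lambda seq22 0 = lv seq22 0 + 1 / rv seq22 1" using lam_eq_lv[of seq22 0] by simp
  then show 0: "markov_lambda seq22 0 = 3" using l0 r1 p(3) by simp
  have "markov_lambda seq22 1 = rv seq22 1 + 1 / lv seq22 0" using lam_eq[of seq22 1] by simp
  then show 1: "markov_lambda seq22 1 = 3" using l0 r1 p(3) by simp
  show "markov_lambda seq22 j \<le> 3"
  proof (cases "j = 0 \<or> j = 1")
    case False
    then have "seq22 j = 1" by (simp add: seq22_def)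
    then show ?thesis using lam_lt[OF pos_seq22, of j] by simp
  qed (use 0 1 in auto)
qed

definition append22 :: "(int \<Rightarrow> nat) \<Rightarrow> int \<Rightarrow> int \<Rightarrow> int \<Rightarrow> nat" where
  "append22 c n k i = (if i \<le> n then c i else seq22 (i - k))"

lemma pos_append22: "pos_seq c \<Longrightarrow> pos_seq (append22 c n k)"
  by (simp add: append22_def pos_seq_def seq22_def)

text \<open>On the window of radius \<open>R\<close> around \<open>n\<close> both \<open>c\<close>
  and the shifted \<open>seq22\<close> consist of 1s. A position up to \<open>n\<close> therefore
  sees \<open>c\<close>, and a later one sees \<open>seq22\<close>, whose values are at most
  3.\<close>

lemma append22_lam:
  assumes pc: "pos_seq c" and K: "\<forall>i\<ge>K. c i = 1" and k: "K + 2 * int R < k"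
  defines "n \<equiv> K + int R"
  shows "j \<le> n \<Longrightarrow> \<bar>markov_lambda (append22 c n k) j - markov_lambda c j\<bar> \<le> 8 / 2^R"
    "n < j \<Longrightarrow> markov_lambda (append22 c n k) j \<le> 3 + 8 / 2^R"
    "j + int Q < k \<Longrightarrow> \<bar>markov_lambda (append22 c n k) j - markov_lambda c j\<bar> \<le> 8 / 2^Q"
proof -
  have ag: "append22 c n k i = c i" if "i < k" for i
    using that K unfolding append22_def n_def seq22_def by auto
  show "\<bar>markov_lambda (append22 c n k) j - markov_lambda c j\<bar> \<le> 8 / 2^Q" if "j + int Q < k" for j Q
    by (rule lam_close[OF pos_append22[OF pc] pc]) (use that ag in auto)
  then show "j \<le> n \<Longrightarrow> \<bar>markov_lambda (append22 c n k) j - markov_lambda c j\<bar> \<le> 8 / 2^R"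
    using k unfolding n_def by auto
  assume "n < j"
  have ag2: "append22 c n k i = shift_seq (-k) seq22 i" if "K \<le> i" for i
    using that K k unfolding append22_def n_def seq22_def by auto
  have "\<bar>markov_lambda (append22 c n k) j - markov_lambda (shift_seq (-k) seq22) j\<bar> \<le> 8 / 2^R"
    by (rule lam_close[OF pos_append22[OF pc]]) (use \<open>n < j\<close> ag2 n_def in auto)
  moreover have "markov_lambda (shift_seq (-k) seq22) j \<le> 3"
    using lam_seq22(3)[of "j - k"] by (simp add: lam_shift)
  ultimately show "markov_lambda (append22 c n k) j \<le> 3 + 8 / 2^R" by linarith
qed

lemma sup_attained_finite:
  assumes s: "lam_sup c s" and F: "finite F" and out: "\<forall>j. j \<notin> F \<longrightarrow> markov_lambda c j \<le> s - e" and "0 < e"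
  shows "\<exists>j\<in>F. markov_lambda c j = s"
proof (rule ccontr)
  assume no: "\<not> ?thesis"
  have le: "markov_lambda c j \<le> s" for j using s by (simp add: lam_sup_def)
  define m where "m = Max (insert (s - e) (markov_lambda c ` F))"
  have fin: "finite (insert (s - e) (markov_lambda c ` F))" using F by simp
  have "m < s" unfolding m_def using fin no le \<open>0 < e\<close>
    by (subst Max_less_iff) (auto simp: order_less_le)
  moreover have "markov_lambda c j \<le> m" for j
  proof (cases "j \<in> F")
    case True then show ?thesis unfolding m_def using fin by (intro Max_ge) auto
  next
    case False
    then have "markov_lambda c j \<le> s - e" using out by blast
    also have "s - e \<le> m" unfolding m_def using fin by (intro Max_ge) auto
    finally show ?thesis .
  qed
  moreover obtain j where "s - (s - m) < markov_lambda c j"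
    using s \<open>m < s\<close> unfolding lam_sup_def by (metis diff_gt_0_iff_gt)
  ultimately show False by (simp add: leD)
qed

text \<open>The left halves coincide, so equal \<lambda> would force equal right halves; but at
  \<open>k\<close> one sequence has a 2 and the other a 1.\<close>

lemma append22_lam_inj:
  assumes pc: "pos_seq c" and "n < k" "k < k'" "j \<le> n"
  shows "markov_lambda (append22 c n k) j \<noteq> markov_lambda (append22 c n k') j"
proof
  assume eq: "markov_lambda (append22 c n k) j = markov_lambda (append22 c n k') j"
  have "lv (append22 c n k) (j-1) = lv (append22 c n k') (j-1)"
    by (rule lv_cong) (use assms in \<open>auto simp: append22_def\<close>)
  then have "rv (append22 c n k) j = rv (append22 c n k') j"
    using eq lam_eq[OF pos_append22[OF pc]] by simp
  then have "append22 c n k k = append22 c n k' k"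
    by (rule rv_inj_eq[OF pos_append22[OF pc] pos_append22[OF pc]]) (use assms in auto)
  then show False using assms by (auto simp: append22_def seq22_def)
qed

text \<open>All late placements of the 22 are considered. If each of them kept the supremum
  \<open>s\<close>, each would attain it between \<open>J\<close> and \<open>n\<close>, two of them
  at the same position, against \<open>append22_lam_inj\<close>.\<close>

lemma perturb:
  assumes "perturbable c s" "0 < e"
  shows "\<exists>c' s'. perturbable c' s' \<and> s' \<noteq> s \<and> \<bar>s' - s\<bar> < e"
proof -
  obtain K d J where c: "pos_seq c" "lam_sup c s" "3 < s" "\<forall>i\<ge>K. c i = 1" "0 < d"
    "\<forall>j\<le>J. markov_lambda c j \<le> s - d"
    using assms(1) unfolding perturbable_def by blast
  \<comment> \<open>A quarter of the smallest margin: the error allowed, the gap at the left end,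
    the height above 3.\<close>
  define e' where "e' = min e (min d (s - 3)) / 4"
  have e': "0 < e'" "4 * e' \<le> e" "4 * e' \<le> d" "4 * e' \<le> s - 3"
    using assms(2) c(3,5) by (auto simp: e'_def)
  obtain R where R: "8 / 2^R < e'" using err_small[OF e'(1)] by blast
  obtain j1 where j1: "s - e' < markov_lambda c j1" using c(2) e'(1) unfolding lam_sup_def by blast
  have le: "markov_lambda c j \<le> s" for j using c(2) by (simp add: lam_sup_def)
  define n where "n = K + int R"
  \<comment> \<open>So far out that the values up to \<open>J\<close> and at the witness
    \<open>j1\<close> change by less than \<open>e'\<close>.\<close>
  define k0 where "k0 = max (K + 2 * int R) (max (J + int R) (j1 + int R)) + 1"
  define C where "C k = append22 c n (k0 + int k)" for k
  have pC: "pos_seq (C k)" for k unfolding C_def by (rule pos_append22[OF c(1)])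
  have k: "K + 2 * int R < k0 + int k" for k unfolding k0_def by auto
  note lam = append22_lam[OF c(1,4) k, folded n_def, folded C_def]
  have up: "markov_lambda (C k) j \<le> s + e'" for k j
  proof (cases "j \<le> n")
    case True then show ?thesis using lam(1)[OF True, of k] le[of j] R by linarith
  next
    case False
    then have "n < j" by simp
    then show ?thesis using lam(2)[OF \<open>n < j\<close>, of k] R c(3) by linarith
  qed
  have right: "markov_lambda (C k) j \<le> s - 3 * e'" if "n < j" for k j
    using lam(2)[OF that, of k] R e' by linarith
  have left: "markov_lambda (C k) j \<le> s - d + e'" if "j \<le> J" for k j
  proof -
    have "j + int R < k0 + int k" using that unfolding k0_def by auto
    then show ?thesis using lam(3)[of j R k] c(6) that R by fastforce
  qed
  have low: "s - 2 * e' < markov_lambda (C k) j1" for k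
  proof -
    have "j1 + int R < k0 + int k" unfolding k0_def by auto
    then show ?thesis using lam(3)[of j1 R k] j1 R by linarith
  qed
  have "\<exists>k. \<not> lam_sup (C k) s"
  proof (rule ccontr)
    assume "\<nexists>k. \<not> lam_sup (C k) s"
    then have sk: "lam_sup (C k) s" for k by blast
    have "\<exists>j\<in>{J<..n}. markov_lambda (C k) j = s" for k
    proof (rule sup_attained_finite[OF sk])
      show "\<forall>j. j \<notin> {J<..n} \<longrightarrow> markov_lambda (C k) j \<le> s - 3 * e'"
      proof (intro allI impI)
        fix j assume "j \<notin> {J<..n}"
        then consider "j \<le> J" | "n < j" by fastforce
        then show "markov_lambda (C k) j \<le> s - 3 * e'"
        proof cases
          case 1 then show ?thesis using left[OF 1, of k] e' by linarith
        next
          case 2 then show ?thesis by (rule right)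
        qed
      qed
    qed (use e' in auto)
    then obtain jf where jf: "\<And>k. jf k \<in> {J<..n}" "\<And>k. markov_lambda (C k) (jf k) = s" by metis
    have "\<not> inj jf"
    proof
      assume "inj jf"
      moreover have "finite (range jf)" by (rule finite_subset[of _ "{J<..n}"]) (use jf in auto)
      ultimately show False using finite_imageD infinite_UNIV_nat by blast
    qed
    then obtain k k' where kk: "k < k'" "jf k = jf k'" unfolding inj_def by (metis linorder_neqE_nat)
    have "markov_lambda (C k) (jf k) \<noteq> markov_lambda (C k') (jf k)"
      unfolding C_def by (rule append22_lam_inj[OF c(1)]) (use kk jf(1)[of k] k[of k] n_def in auto)
    then show False using jf(2)[of k] jf(2)[of k'] kk by simp
  qed
  then obtain k where nk: "\<not> lam_sup (C k) s" by blast
  obtain s' where s': "lam_sup (C k) s'" "s' \<le> s + e'" using bounded_lam_sup up by blast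
  have ls: "s - 2 * e' < s'" using low[of k] s'(1) unfolding lam_sup_def by (meson less_le_trans)
  have "perturbable (C k) s'" unfolding perturbable_def
  proof (intro conjI)
    show "\<exists>K. \<forall>i\<ge>K. C k i = 1"
      by (rule exI[of _ "max n (k0 + int k) + 2"]) (auto simp: C_def append22_def seq22_def)
    show "3 < s'" using ls e' by linarith
    show "\<exists>d>0. \<exists>J. \<forall>j\<le>J. markov_lambda (C k) j \<le> s' - d"
    proof (intro exI[of _ e'] conjI exI[of _ J] allI impI)
      fix j assume "j \<le> J"
      then show "markov_lambda (C k) j \<le> s' - e'" using left[of j k] ls e' by linarith
    qed (rule e'(1))
  qed (use pC s' in auto)
  moreover have "s' \<noteq> s" using nk s'(1) by blast
  moreover have "\<bar>s' - s\<bar> < e" using ls s'(2) e' by linarith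
  ultimately show ?thesis by blast
qed

section \<open>Limits of limit points of the spectrum\<close>

abbreviation spectrum_limits :: "real set" where
  "spectrum_limits \<equiv> {t. t islimpt markov_spectrum}"

lemma perturbable_islimpt: assumes "perturbable c s" shows "s islimpt markov_spectrum"
  unfolding islimpt_approachable
proof (intro allI impI)
  fix e :: real assume "0 < e"
  then obtain c' s' where c': "perturbable c' s'" "s' \<noteq> s" "\<bar>s' - s\<bar> < e" using perturb[OF assms] by blast
  have "s' \<in> markov_spectrum" using c'(1) unfolding perturbable_def spectrum_iff by blast
  then show "\<exists>x'\<in>markov_spectrum. x' \<noteq> s \<and> dist x' s < e"
    using c' by (auto simp: dist_real_def)
qed

lemma perturbable_islimpt2: assumes "perturbable c s" shows "s islimpt spectrum_limits"
proof (rule islimpt_approachable[THEN iffD2], intro allI impI)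
  fix e :: real assume "0 < e"
  then obtain c' s' where c': "perturbable c' s'" "s' \<noteq> s" "\<bar>s' - s\<bar> < e" using perturb[OF assms] by blast
  then show "\<exists>x'\<in>spectrum_limits. x' \<noteq> s \<and> dist x' s < e"
    using perturbable_islimpt by (auto simp: dist_real_def)
qed

text \<open>Values of perturbable sequences lie in \<open>M''\<close>, which is closed.\<close>

lemma islimpt2_approx:
  assumes "\<And>e. 0 < e \<Longrightarrow> \<exists>c s. perturbable c s \<and> \<bar>s - t\<bar> < e"
  shows "t islimpt spectrum_limits"
proof -
  have "\<forall>e>0. \<exists>x\<in>{s. s islimpt spectrum_limits}. dist x t < e"
  proof (intro allI impI)
    fix e :: real assume "0 < e"
    then obtain c s where "perturbable c s" "\<bar>s - t\<bar> < e" using assms by blast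
    then show "\<exists>x\<in>{s. s islimpt spectrum_limits}. dist x t < e"
      using perturbable_islimpt2 by (auto simp: dist_real_def)
  qed
  then have "t \<in> closure {s. s islimpt spectrum_limits}" by (simp add: closure_approachable)
  then show ?thesis by (simp add: closure_closed[OF closed_limpts])
qed

text \<open>The value of \<open>seq22\<close> is exactly 3, too low for \<open>perturbable\<close>;
  a second 22 lifts it slightly above 3.\<close>

lemma three_islimpt2: "3 islimpt spectrum_limits"
proof (rule islimpt2_approx)
  fix e :: real assume "0 < e"
  then obtain R where R: "8 / 2^R < e" using err_small by blast
  define n :: int where "n = 2 + int R"
  \<comment> \<open>Odd, so that an even number of letters, counted from position 1, precedes the
    change from 1 to 2 and \<open>rv\<close> at 1 increases.\<close>
  define k :: nat where "k = 2 * R + 3"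
  define c where "c = append22 seq22 n (int k)"
  have pc: "pos_seq c" unfolding c_def by (rule pos_append22) simp
  have K: "\<forall>i\<ge>2. seq22 i = 1" by (simp add: seq22_def)
  have k: "2 + 2 * int R < int k" by (simp add: k_def)
  note lam = append22_lam[OF pos_seq22 K k, folded n_def, folded c_def]
  have up: "markov_lambda c j \<le> 3 + 8 / 2^R" for j
  proof (cases "j \<le> n")
    case True then show ?thesis using lam(1)[OF True] lam_seq22(3)[of j] by linarith
  qed (use lam(2) in auto)
  have ck: "c (int k) = 2" "seq22 (int k) = 1" by (auto simp: c_def append22_def seq22_def n_def k_def)
  have "rv seq22 1 < rv c 1"
  proof -
    have ag: "\<forall>l<k-1. seq22 (1 + int l) = c (1 + int l)"
      by (auto simp: c_def append22_def seq22_def n_def k_def)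
    have "rv seq22 (int k) < rv c (int k)" by (rule rv_less[OF pos_seq22 pc]) (simp add: ck)
    then show ?thesis using rv_steps_less[OF pos_seq22 pc ag] by (simp add: k_def add.commute)
  qed
  moreover have "lv seq22 0 = lv c 0" by (rule lv_cong) (auto simp: c_def append22_def n_def)
  ultimately have gt: "3 < markov_lambda c 1"
    using lam_eq[OF pos_seq22, of 1] lam_eq[OF pc, of 1] lam_seq22(2) by simp
  obtain s where s: "lam_sup c s" "s \<le> 3 + 8 / 2^R" using bounded_lam_sup up by blast
  have s3: "3 < s" using gt s(1) unfolding lam_sup_def by (meson less_le_trans)
  have "perturbable c s" unfolding perturbable_def
  proof (intro conjI)
    show "\<exists>K. \<forall>i\<ge>K. c i = 1"
      by (rule exI[of _ "max n (int k) + 2"]) (auto simp: c_def append22_def seq22_def)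
    show "\<exists>d>0. \<exists>J. \<forall>j\<le>J. markov_lambda c j \<le> s - d"
    proof (intro exI[of _ "s - 3"] conjI exI[of _ "-1"] allI impI)
      fix j :: int assume "j \<le> -1"
      then have "c j = 1" by (auto simp: c_def append22_def seq22_def n_def)
      then show "markov_lambda c j \<le> s - (s - 3)" using lam_lt[OF pc, of j] by simp
    qed (use s3 in auto)
  qed (use pc s s3 in auto)
  moreover have "\<bar>s - 3\<bar> < e" using s3 s(2) R by linarith
  ultimately show "\<exists>c s. perturbable c s \<and> \<bar>s - 3\<bar> < e" by blast
qed

section \<open>Connecting to the hub in a good interval\<close>

lemma sft_shift:
  assumes "subshift_of_finite_type S" "a \<in> S" shows "shift_seq k a \<in> S"
proof -
  obtain A W where S: "S = {a. (\<forall>i. a i \<in> {1..A}) \<and> (\<forall>w\<in>W. \<forall>i. \<not> occurs_at w a i)}"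
    using assms(1) unfolding subshift_of_finite_type_def by blast
  have "occurs_at w (shift_seq k a) i = occurs_at w a (i + k)" for w i
    by (simp add: occurs_at_def algebra_simps)
  then show ?thesis using assms(2) unfolding S by simp
qed

lemma sft_pos: assumes "subshift_of_finite_type S" "a \<in> S" shows "pos_seq a"
proof -
  obtain A W where S: "S = {a. (\<forall>i. a i \<in> {1..A}) \<and> (\<forall>w\<in>W. \<forall>i. \<not> occurs_at w a i)}"
    using assms(1) unfolding subshift_of_finite_type_def by blast
  have "a i \<in> {1..A}" for i using assms(2) unfolding S by blast
  then show ?thesis by (simp add: pos_seq_def Suc_le_eq)
qed

lemma continue_with_self:
  assumes "\<forall>i\<le>int N. w i = a i"
  shows "continue_with a N (\<lambda>n. shift_seq (int N + 1) w (int n)) = w"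
  using assms by (auto simp: continue_with_def)

text \<open>Goodness applied to the two continuations of \<open>a\<close> after \<open>N\<close>
  given by \<open>a\<close> itself and by \<open>w\<close>. Both sequences lie in \<Sigma>(C)
  because their values are below \<open>y\<close>, and the maximum in the conclusion of goodness is
  at most \<open>s\<close>.\<close>

lemma connect_to_B:
  assumes assoc: "associated_subshifts x y B C"
    and a: "pos_seq a" "\<forall>j. markov_lambda a j \<le> markov_lambda a 0" "markov_lambda a 0 \<le> s"
    and w: "pos_seq w" "\<forall>i\<le>int N. w i = a i" "w (int N + 1) \<noteq> a (int N + 1)"
      "\<forall>j. markov_lambda w j \<le> s"
    and s: "x \<le> s" "s < y"
  shows "\<exists>c b p. pos_seq c \<and> (\<forall>i\<le>int N. c i = a i) \<and> b \<in> B \<and> (\<forall>i\<ge>p. c i = b (i - p)) \<and>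
    (\<forall>j. markov_lambda c j \<le> s)"
proof -
  have B: "subshift_of_finite_type B" and C: "subshift_of_finite_type C"
    using assoc unfolding associated_subshifts_def sym_trans_sft_def by auto
  have "lam_sup a (markov_lambda a 0)" using a(2) by (auto simp: lam_sup_def intro!: exI[of _ 0])
  then have ma: "markov_value a = ereal (markov_lambda a 0)" by (simp add: markov_value_eq)
  have ms: "markov_value a \<le> ereal s" using ma a(3) by simp
  have mw: "markov_value w \<le> ereal s" using w(4) by (simp add: markov_value_le)
  have ays: "markov_value a < ereal y" "markov_value w < ereal y"
    using ms mw s(2) by (auto intro: le_less_trans)
  have aC: "a \<in> C" "w \<in> C"
    using assoc ays a(1) w(1) unfolding associated_subshifts_def by auto
  define v1 where "v1 = (\<lambda>n. shift_seq (int N + 1) a (int n))"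
  define v2 where "v2 = (\<lambda>n. shift_seq (int N + 1) w (int n))"
  have v: "v1 \<in> one_sided C" "v2 \<in> one_sided C"
    unfolding one_sided_def v1_def v2_def
    using imageI[OF sft_shift[OF C aC(1)], of "\<lambda>a n. a (int n)" "int N + 1"]
      imageI[OF sft_shift[OF C aC(2)], of "\<lambda>a n. a (int n)" "int N + 1"] by simp_all
  have cw: "continue_with a N v1 = a" "continue_with a N v2 = w"
    unfolding v1_def v2_def using continue_with_self[of N w a] continue_with_self[of N a a] w(2) by blast+
  have "v1 0 \<noteq> v2 0" using w(3) by (simp add: v1_def v2_def add.commute)
  have goodP: "\<forall>a. pos_seq a \<and> markov_value a = ereal (markov_lambda a 0) \<and> markov_value a < ereal y \<longrightarrow>
        (\<forall>N. \<forall>v1\<in>one_sided C. \<forall>v2\<in>one_sided C.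
           v1 0 \<noteq> v2 0 \<and>
           markov_value (continue_with a N v1) < ereal y \<and>
           markov_value (continue_with a N v2) < ereal y \<longrightarrow>
           (\<exists>\<tau>. (\<forall>k\<in>set \<tau>. 0 < k) \<and> (\<exists>vB\<in>one_sided B.
              markov_value (continue_with a N (\<tau> \<frown> vB)) \<le>
                Max {markov_value (continue_with a N v1),
                     markov_value (continue_with a N v2), ereal x})))"
    using assoc unfolding associated_subshifts_def by blast
  obtain \<tau> vB where t: "\<forall>k\<in>set \<tau>. 0 < k" "vB \<in> one_sided B"
      "markov_value (continue_with a N (\<tau> \<frown> vB)) \<le> Max {markov_value (continue_with a N v1),
                     markov_value (continue_with a N v2), ereal x}"
    using goodP[rule_format, OF _ v, of a N] ma a(1) ays \<open>v1 0 \<noteq> v2 0\<close> cw by auto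
  obtain b where b: "b \<in> B" "vB = (\<lambda>n. b (int n))" using t(2) unfolding one_sided_def by auto
  define c where "c = continue_with a N (\<tau> \<frown> vB)"
  have pb: "0 < b i" for i using sft_pos[OF B b(1)] by (simp add: pos_seq_def)
  have "Max {markov_value (continue_with a N v1), markov_value (continue_with a N v2), ereal x} \<le> ereal s"
    using ms mw s(1) unfolding cw by simp
  then have mc: "markov_value c \<le> ereal s" using t(3) unfolding c_def by (rule order_trans[rotated])
  show ?thesis
  proof (rule exI[of _ c], rule exI[of _ b], rule exI[of _ "int N + 1 + int (length \<tau>)"], intro conjI)
    show "pos_seq c" using a(1) t(1) pb
      by (auto simp: c_def pos_seq_def continue_with_def conc_def b(2))
    show "\<forall>i\<le>int N. c i = a i" by (simp add: c_def continue_with_def)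
    show "\<forall>i\<ge>int N + 1 + int (length \<tau>). c i = b (i - (int N + 1 + int (length \<tau>)))"
      by (auto simp: c_def continue_with_def conc_def b(2) of_nat_diff nat_less_iff algebra_simps)
    show "\<forall>j. markov_lambda c j \<le> s" using mc by (simp add: markov_value_le)
  qed (rule b(1))
qed

text \<open>The continuations are two of \<open>seq22\<close>: its own tail of 1s, and a tail with a
  second 22 so late that the value does not exceed \<open>t\<close>. The left end of 1s
  survives.\<close>

lemma ones_to_B:
  assumes assoc: "associated_subshifts x y B C" and t: "3 < t" "x \<le> t" "t < y"
  shows "\<exists>h b p K. pos_seq h \<and> (\<forall>i\<le>K. h i = 1) \<and> b \<in> B \<and> (\<forall>i\<ge>p. h i = b (i - p)) \<and>
    (\<forall>j. markov_lambda h j \<le> t)"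
proof -
  obtain R where R: "8 / 2^R < t - 3" using err_small[of "t - 3"] t by auto
  define n :: int where "n = 2 + int R"
  define k where "k = 2 * R + 3"
  define w where "w = append22 seq22 n (int k)"
  have K: "\<forall>i\<ge>2. seq22 i = 1" by (simp add: seq22_def)
  have k: "2 + 2 * int R < int k" by (simp add: k_def)
  note lam = append22_lam[OF pos_seq22 K k, folded n_def, folded w_def]
  have up: "markov_lambda w j \<le> t" for j
  proof (cases "j \<le> n")
    case True then show ?thesis using lam(1)[OF True] lam_seq22(3)[of j] R by linarith
  next
    case False then show ?thesis using lam(2)[of j] R by linarith
  qed
  have le0: "\<forall>j. markov_lambda seq22 j \<le> markov_lambda seq22 0" using lam_seq22 by simp
  have ag: "\<forall>i\<le>int (k-1). w i = seq22 i" "w (int (k-1) + 1) \<noteq> seq22 (int (k-1) + 1)"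
    by (auto simp: w_def append22_def seq22_def n_def k_def)
  have "\<exists>h b p. pos_seq h \<and> (\<forall>i\<le>int (k-1). h i = seq22 i) \<and> b \<in> B \<and> (\<forall>i\<ge>p. h i = b (i - p)) \<and>
    (\<forall>j. markov_lambda h j \<le> t)"
    by (rule connect_to_B[OF assoc pos_seq22 le0 _ _ ag _ t(2,3)])
       (use t up lam_seq22(1) pos_append22[OF pos_seq22] w_def in auto)
  then obtain h b p where h: "pos_seq h" "\<forall>i\<le>int (k-1). h i = seq22 i" "b \<in> B" "\<forall>i\<ge>p. h i = b (i - p)"
    "\<forall>j. markov_lambda h j \<le> t" by blast
  have "\<forall>i\<le>-1. h i = 1" using h(2) by (auto simp: seq22_def)
  then show ?thesis using h by blast
qed

text \<open>As \<open>B\<close> is symmetric, the reversal of the sequence \<open>h\<close> from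
  \<open>ones_to_B\<close> runs from \<open>B\<close> into the 1s. Transitivity provides an element
  of \<open>B\<close> containing a window of \<open>c\<close> and later a window of this reversal;
  glueing at both windows costs \<open>8 / 2^R\<close> each time.\<close>

lemma B_to_ones:
  assumes assoc: "associated_subshifts x y B C" and t: "3 < t" "x \<le> t" "t < y"
    and c: "pos_seq c" "b \<in> B" "\<forall>i\<ge>p. c i = b (i - p)" "\<forall>j. markov_lambda c j \<le> s" "t \<le> s"
    and e: "0 < e"
  shows "\<exists>d. pos_seq d \<and> (\<forall>i\<le>N. d i = c i) \<and> (\<exists>K. \<forall>i\<ge>K. d i = 1) \<and> (\<forall>j. markov_lambda d j \<le> s + e)"
proof -
  have B: "subshift_of_finite_type B" "symmetric_subshift B" "transitive_subshift B"
    and xB: "ereal x = (SUP b\<in>B. markov_value b)"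
    using assoc unfolding associated_subshifts_def sym_trans_sft_def by auto
  have lamB: "markov_lambda b' j \<le> x" if "b' \<in> B" for b' j
  proof -
    have "markov_value b' \<le> ereal x" unfolding xB using that by (rule SUP_upper)
    then show ?thesis by (simp add: markov_value_le)
  qed
  obtain h b1 p1 K where h: "pos_seq h" "\<forall>i\<le>K. h i = 1" "b1 \<in> B" "\<forall>i\<ge>p1. h i = b1 (i - p1)"
    "\<forall>j. markov_lambda h j \<le> t"
    using ones_to_B[OF assoc t] by meson
  obtain R where R: "8 / 2^R < e / 2" using err_small[of "e/2"] e by auto
  define q where "q = max p N"
  define u where "u = map (\<lambda>k. c (q + int k)) [0..<2*R+1]"
  \<comment> \<open>A window of the reversed \<open>h\<close> where it still runs inside
    \<open>B\<close>.\<close>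
  define v where "v = map (\<lambda>k. h (p1 + 2 * int R - int k)) [0..<2*R+1]"
  have "occurs_at u b (q - p)" using c(3) by (auto simp: occurs_at_def u_def q_def algebra_simps simp del: upt_Suc)
  moreover have "occurs_at v (rev_seq b1) (- 2 * int R)"
    using h(4) by (auto simp: occurs_at_def v_def algebra_simps simp del: upt_Suc)
  moreover have "rev_seq b1 \<in> B" using B(2) h(3) unfolding symmetric_subshift_def rev_seq_def by blast
  ultimately obtain b2 i j where b2: "b2 \<in> B" "occurs_at u b2 i" "occurs_at v b2 j" "i + int (length u) \<le> j"
    using B(3) c(2) unfolding transitive_subshift_def by blast
  define \<beta> where "\<beta> = shift_seq (i - q) b2"
  define n1 where "n1 = q + int R"
  define w1 where "w1 = (\<lambda>l. if l \<le> n1 then c l else \<beta> l)"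
  have pb: "pos_seq \<beta>" using sft_pos[OF B(1) b2(1)] by (simp add: \<beta>_def)
  have ub: "c (q + int k) = \<beta> (q + int k)" if "k < 2*R+1" for k
    using b2(2) that by (auto simp: occurs_at_def u_def \<beta>_def algebra_simps simp del: upt_Suc)
  have ag1: "\<forall>l. \<bar>l - n1\<bar> \<le> int R \<longrightarrow> c l = \<beta> l"
  proof (intro allI impI)
    fix l assume "\<bar>l - n1\<bar> \<le> int R"
    then have "l = q + int (nat (l - q))" "nat (l - q) < 2*R+1" by (auto simp: n1_def)
    then show "c l = \<beta> l" using ub by metis
  qed
  have lb: "\<forall>j. markov_lambda \<beta> j \<le> s"
    using lamB[OF b2(1)] t(2) c(5) sft_pos[OF B(1) b2(1)] by (auto simp: \<beta>_def lam_shift intro: order_trans)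
  note w1 = glue[OF c(1) pb ag1 w1_def c(4) lb]
  define r where "r = j - i + q"
  have rn: "q + 2 * int R + 1 \<le> r" using b2(4) by (simp add: r_def u_def)
  \<comment> \<open>Shifts the reversed \<open>h\<close> so that the word \<open>v\<close> begins at
    \<open>r\<close>, its place in \<open>\<beta>\<close>.\<close>
  define \<sigma> where "\<sigma> = - (r + p1 + 2 * int R)"
  define \<gamma> where "\<gamma> = shift_seq \<sigma> (rev_seq h)"
  define n2 where "n2 = r + int R"
  define d where "d = (\<lambda>l. if l \<le> n2 then w1 l else \<gamma> l)"
  have pg: "pos_seq \<gamma>" using h(1) by (simp add: \<gamma>_def)
  have vb: "w1 (r + int k) = \<gamma> (r + int k)" if "k < 2*R+1" for k
  proof -
    have "w1 (r + int k) = b2 (j + int k)" using rn by (simp add: w1_def n1_def \<beta>_def r_def algebra_simps)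
    also have "\<dots> = v ! k" using b2(3) that by (auto simp: occurs_at_def v_def simp del: upt_Suc)
    also have "\<dots> = \<gamma> (r + int k)" using that by (simp add: v_def \<gamma>_def \<sigma>_def algebra_simps del: upt_Suc)
    finally show ?thesis .
  qed
  have ag2: "\<forall>l. \<bar>l - n2\<bar> \<le> int R \<longrightarrow> w1 l = \<gamma> l"
  proof (intro allI impI)
    fix l assume "\<bar>l - n2\<bar> \<le> int R"
    then have "l = r + int (nat (l - r))" "nat (l - r) < 2*R+1" by (auto simp: n2_def)
    then show "w1 l = \<gamma> l" using vb by metis
  qed
  have lw: "\<forall>j. markov_lambda w1 j \<le> s + 8 / 2^R" using w1(2) by blast
  have lg: "\<forall>j. markov_lambda \<gamma> j \<le> s + 8 / 2^R"
  proof
    fix j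
    have "markov_lambda \<gamma> j \<le> t" using h(1,5) by (simp add: \<gamma>_def lam_shift lam_rev)
    moreover have "0 < (8::real) / 2^R" by simp
    ultimately show "markov_lambda \<gamma> j \<le> s + 8 / 2^R" using c(5) by linarith
  qed
  note d = glue[OF w1(1) pg ag2 d_def lw lg]
  show ?thesis
  proof (intro exI[of _ d] conjI)
    show "\<forall>i\<le>N. d i = c i" using rn by (auto simp: d_def w1_def n1_def n2_def q_def)
    show "\<exists>K. \<forall>i\<ge>K. d i = 1"
      using h(2) by (intro exI[of _ "max (n2 + 1) (- \<sigma> - K)"]) (auto simp: d_def \<gamma>_def)
    show "\<forall>j. markov_lambda d j \<le> s + e"
    proof
      fix j show "markov_lambda d j \<le> s + e" using d(2)[of j] R by linarith
    qed
  qed (rule d(1))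
qed

section \<open>Flexible right halves can be connected to the 1s\<close>

definition right_flexible :: "(int \<Rightarrow> nat) \<Rightarrow> real \<Rightarrow> bool" where
  "right_flexible a t \<longleftrightarrow> (\<forall>e>0. \<forall>N0::nat. \<exists>N\<ge>N0. \<exists>w. pos_seq w \<and> (\<forall>i\<le>int N. w i = a i) \<and>
     w (int N + 1) \<noteq> a (int N + 1) \<and> (\<forall>j. markov_lambda w j \<le> t + e))"

definition right_connected :: "(int \<Rightarrow> nat) \<Rightarrow> real \<Rightarrow> bool" where
  "right_connected a t \<longleftrightarrow> (\<forall>e>0. \<forall>N::nat. \<exists>c. pos_seq c \<and> (\<forall>i\<le>int N. c i = a i) \<and>
     (\<exists>K. \<forall>i\<ge>K. c i = 1) \<and> (\<forall>j. markov_lambda c j \<le> t + e))"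

lemma right_flexible_connected:
  assumes assoc: "associated_subshifts x y B C" and t: "3 < t" "x \<le> t" "t < y"
    and a: "pos_seq a" "markov_lambda a 0 = t" "\<forall>j. markov_lambda a j \<le> t"
    and flex: "right_flexible a t"
  shows "right_connected a t"
  unfolding right_connected_def
proof (intro allI impI)
  fix e :: real and N :: nat assume "0 < e"
  \<comment> \<open>Half of the allowance for the way into \<open>B\<close> and half for the way on
    to the 1s, while \<open>t + e1\<close> stays below \<open>y\<close>.\<close>
  define e1 where "e1 = min e (y - t) / 2"
  have e1: "0 < e1" "e1 \<le> e / 2" "t + e1 < y" using \<open>0 < e\<close> t by (auto simp: e1_def min_def field_simps)
  obtain N' w where w: "N' \<ge> N" "pos_seq w" "\<forall>i\<le>int N'. w i = a i"
     "w (int N' + 1) \<noteq> a (int N' + 1)" "\<forall>j. markov_lambda w j \<le> t + e1"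
    using flex e1(1) unfolding right_flexible_def by blast
  have 1: "\<forall>j. markov_lambda a j \<le> markov_lambda a 0" "markov_lambda a 0 \<le> t + e1" "x \<le> t + e1"
    using a e1 t by auto
  obtain c b p where c: "pos_seq c" "\<forall>i\<le>int N'. c i = a i" "b \<in> B" "\<forall>i\<ge>p. c i = b (i - p)"
    "\<forall>j. markov_lambda c j \<le> t + e1"
    using connect_to_B[OF assoc a(1) 1(1,2) w(2-5) 1(3) e1(3)] by meson
  have "t \<le> t + e1" using e1 by simp
  obtain d where d: "pos_seq d" "\<forall>i\<le>int N. d i = c i" "\<exists>K. \<forall>i\<ge>K. d i = 1"
    "\<forall>j. markov_lambda d j \<le> t + e1 + e1"
    using B_to_ones[OF assoc t c(1,3,4,5) \<open>t \<le> t + e1\<close> e1(1), of "int N"] by meson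
  have "markov_lambda d j \<le> t + e" for j using d(4)[rule_format, of j] e1(2) by linarith
  then show "\<exists>c. pos_seq c \<and> (\<forall>i\<le>int N. c i = a i) \<and>
     (\<exists>K. \<forall>i\<ge>K. c i = 1) \<and> (\<forall>j. markov_lambda c j \<le> t + e)"
    using d c(2) w(1) by (intro exI[of _ d]) auto
qed

section \<open>Galois conjugation of periodic sequences\<close>

text \<open>Galois conjugation in \<open>\<rat>(t)\<close>, meaningful for irrational \<open>t\<close> with rational square.\<close>
definition conjugates :: "real \<Rightarrow> real \<Rightarrow> real \<Rightarrow> bool" where
  "conjugates t z z' \<longleftrightarrow> (\<exists>u\<in>\<rat>. \<exists>v\<in>\<rat>. z = u + v * t \<and> z' = u - v * t)"

lemma rat_combination:
  assumes "t \<notin> \<rat>" "x \<in> \<rat>" "y \<in> \<rat>" "x + y * t = 0"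
  shows "x = 0" "y = (0::real)"
proof -
  show "y = 0"
  proof (rule ccontr)
    assume "y \<noteq> 0"
    then have "t = - x / y" using assms(4) by (simp add: field_simps)
    then show False using assms(1,2,3) by (metis Rats_divide Rats_minus_iff)
  qed
  then show "x = 0" using assms(4) by simp
qed

lemma conjugates_unique:
  assumes t: "t \<notin> \<rat>" and "conjugates t z z1" "conjugates t z z2" shows "z1 = z2"
proof -
  obtain u v where 1: "u \<in> \<rat>" "v \<in> \<rat>" "z = u + v * t" "z1 = u - v * t" using assms(2) unfolding conjugates_def by blast
  obtain p q where 2: "p \<in> \<rat>" "q \<in> \<rat>" "z = p + q * t" "z2 = p - q * t" using assms(3) unfolding conjugates_def by blast
  have "(u - p) + (v - q) * t = 0" using 1 2 by (simp add: algebra_simps)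
  then have "u - p = 0" "v - q = 0" using rat_combination[OF t, of "u - p" "v - q"] 1 2 by auto
  then show ?thesis using 1 2 by simp
qed

lemma conjugates_sym: "conjugates t z z' \<Longrightarrow> conjugates t z' z"
  unfolding conjugates_def by (metis Rats_minus_iff add_uminus_conv_diff minus_mult_left diff_minus_eq_add)

lemma conjugates_add_rat:
  assumes "conjugates t z z'" "q \<in> \<rat>" shows "conjugates t (q + z) (q + z')"
proof -
  obtain u v where "u \<in> \<rat>" "v \<in> \<rat>" "z = u + v * t" "z' = u - v * t" using assms(1) unfolding conjugates_def by blast
  then show ?thesis unfolding conjugates_def using assms(2)
    by (intro bexI[of _ "q + u"] bexI[of _ v]) auto
qed

lemma conjugates_minus:
  assumes "conjugates t z z'" shows "conjugates t (- z) (- z')"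
proof -
  obtain u v where "u \<in> \<rat>" "v \<in> \<rat>" "z = u + v * t" "z' = u - v * t" using assms unfolding conjugates_def by blast
  then show ?thesis unfolding conjugates_def
    by (intro bexI[of _ "- u"] bexI[of _ "- v"]) auto
qed

text \<open>The norm \<open>m = z * z'\<close> is rational and nonzero, so that
  \<open>1 / z = z' / m\<close>.\<close>

lemma conjugates_inverse:
  assumes t: "t \<notin> \<rat>" "t * t \<in> \<rat>" and z: "conjugates t z z'" "z \<noteq> 0"
  shows "z' \<noteq> 0" "conjugates t (1 / z) (1 / z')"
proof -
  obtain u v where uv: "u \<in> \<rat>" "v \<in> \<rat>" "z = u + v * t" "z' = u - v * t" using z(1) unfolding conjugates_def by blast
  show z': "z' \<noteq> 0"
  proof
    assume "z' = 0"
    then have "u + (- v) * t = 0" using uv by simp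
    then have "u = 0" "- v = 0" using rat_combination[OF t(1), of u "- v"] uv by auto
    then show False using uv z(2) by simp
  qed
  define m where "m = u * u - v * v * (t * t)"
  have mQ: "m \<in> \<rat>" using uv t(2) by (auto simp: m_def)
  have m: "m = z * z'" by (simp add: m_def uv algebra_simps)
  have "1 / z = z' / m" "1 / z' = z / m" using z(2) z' by (simp_all add: m)
  then have "1 / z = u / m + (- v / m) * t" "1 / z' = u / m - (- v / m) * t"
    by (simp_all add: uv(3,4) diff_divide_distrib add_divide_distrib)
  moreover have "u / m \<in> \<rat>" "- v / m \<in> \<rat>" using uv mQ by auto
  ultimately show "conjugates t (1 / z) (1 / z')" unfolding conjugates_def by blast
qed

lemma conjugates_quadratic:
  assumes t: "t \<notin> \<rat>" "t * t \<in> \<rat>" and z: "conjugates t z z'"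
    and q: "g \<in> \<rat>" "b \<in> \<rat>" "c \<in> \<rat>" "g * (z * z) + b * z + c = 0"
  shows "g * (z' * z') + b * z' + c = 0"
proof -
  obtain u v where uv: "u \<in> \<rat>" "v \<in> \<rat>" "z = u + v * t" "z' = u - v * t" using z unfolding conjugates_def by blast
  define X where "X = g * (u * u + v * v * (t * t)) + b * u + c"
  define Y where "Y = v * (2 * g * u + b)"
  have "X + Y * t = 0" using q(4) by (simp add: X_def Y_def uv algebra_simps)
  moreover have "X \<in> \<rat>" "Y \<in> \<rat>" using uv q t(2) by (auto simp: X_def Y_def)
  ultimately have "X = 0" "Y = 0" using rat_combination[OF t(1)] by blast+
  moreover have "g * (z' * z') + b * z' + c = X - Y * t" by (simp add: X_def Y_def uv algebra_simps)
  ultimately show ?thesis by simp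
qed

section \<open>Quadratic equations of periodic continued fractions\<close>

text \<open>The Euclidean algorithm: each step yields a fraction with a smaller positive
  denominator, so an infinite expansion cannot belong to a fraction.\<close>

lemma rv_irrational: assumes p: "pos_seq a" shows "rv a i \<notin> \<rat>"
proof
  assume "rv a i \<in> \<rat>"
  then obtain m n :: int where mn: "0 < n" "rv a i = of_int m / of_int n" using Rats_cases' by blast
  have "False" if "0 < n" "rv a i = of_int m / of_int n" for m n :: int
    using that
  proof (induction "nat n" arbitrary: m n i rule: less_induct)
    case less
    define n' where "n' = m - int (a i) * n"
    have n0: "(0::real) < of_int n" using less.prems by simp
    have d: "rv a i - real (a i) = of_int n' / of_int n" using less.prems by (simp add: n'_def field_simps)
    have b: "0 < rv a i - real (a i)" "rv a i - real (a i) < 1" using rv_bounds[OF p, of i] by auto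
    then have "(0::real) < of_int n'" "(of_int n' :: real) < of_int n"
      using n0 unfolding d by (simp_all add: zero_less_divide_iff)
    then have n': "0 < n'" "n' < n" by simp_all
    have "rv a (i+1) = 1 / (rv a i - real (a i))" using rv_step[OF p, of i] by simp
    then have "rv a (i+1) = of_int n / of_int n'" unfolding d by simp
    then show False using less.hyps[of n' "i+1" n] n' by simp
  qed
  then show False using mn by blast
qed

text \<open>The matrix of a product of maps z \<mapsto> a + 1/z. The recursion is written without
  division and for arbitrary real solutions, so that it covers both \<open>rv\<close> and the
  negative solution \<open>- 1/lv\<close>; the bound on \<open>\<gamma>\<close> keeps the quadratic
  equation of a period nondegenerate.\<close>

lemma moebius_word:
  assumes "pos_seq a"
  shows "\<exists>\<alpha> \<beta> \<gamma> \<delta> :: nat. 1 \<le> \<alpha> \<and> (1 \<le> n \<longrightarrow> 1 \<le> \<gamma>) \<and>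
    (\<forall>z :: int \<Rightarrow> real. (\<forall>k. z k * z (k+1) = real (a k) * z (k+1) + 1) \<longrightarrow>
      z i * (real \<gamma> * z (i + int n) + real \<delta>) = real \<alpha> * z (i + int n) + real \<beta>)"
proof (induction n arbitrary: i)
  case 0
  show ?case by (rule exI[of _ 1], rule exI[of _ 0], rule exI[of _ 0], rule exI[of _ 1]) auto
next
  case (Suc n)
  obtain \<alpha> \<beta> \<gamma> \<delta> :: nat where IH: "1 \<le> \<alpha>"
    "\<And>z :: int \<Rightarrow> real. (\<forall>k. z k * z (k+1) = real (a k) * z (k+1) + 1) \<Longrightarrow>
      z (i+1) * (real \<gamma> * z (i + 1 + int n) + real \<delta>) = real \<alpha> * z (i + 1 + int n) + real \<beta>"
    using Suc.IH[of "i+1"] by blast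
  have "1 \<le> a i * \<alpha> + \<gamma>" using IH(1) assms by (simp add: pos_seq_def Suc_le_eq)
  moreover have "z i * (real \<alpha> * z (i + int (Suc n)) + real \<beta>) =
       real (a i * \<alpha> + \<gamma>) * z (i + int (Suc n)) + real (a i * \<beta> + \<delta>)"
    if z: "\<forall>k. z k * z (k+1) = real (a k) * z (k+1) + 1" for z :: "int \<Rightarrow> real"
  proof -
    define Z where "Z = z (i + 1 + int n)"
    have 1: "z (i+1) * (real \<gamma> * Z + real \<delta>) = real \<alpha> * Z + real \<beta>" using IH(2)[OF z] by (simp add: Z_def)
    have "z i * (real \<alpha> * Z + real \<beta>) = (z i * z (i+1)) * (real \<gamma> * Z + real \<delta>)"
      unfolding 1[symmetric] by simp
    also have "\<dots> = (real (a i) * z (i+1) + 1) * (real \<gamma> * Z + real \<delta>)" using z by simp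
    also have "\<dots> = real (a i) * (z (i+1) * (real \<gamma> * Z + real \<delta>)) + (real \<gamma> * Z + real \<delta>)"
      by (simp add: algebra_simps)
    also have "\<dots> = real (a i) * (real \<alpha> * Z + real \<beta>) + (real \<gamma> * Z + real \<delta>)" unfolding 1 ..
    finally have "z i * (real \<alpha> * Z + real \<beta>) = real (a i * \<alpha> + \<gamma>) * Z + real (a i * \<beta> + \<delta>)"
      by (simp add: algebra_simps)
    then show ?thesis by (simp add: Z_def add_ac)
  qed
  ultimately show ?case using IH(1)
    by - (rule exI[of _ "a i * \<alpha> + \<gamma>"], rule exI[of _ "a i * \<beta> + \<delta>"],
          rule exI[of _ \<alpha>], rule exI[of _ \<beta>], intro conjI allI impI)
qed

definition periodic_seq :: "nat \<Rightarrow> (int \<Rightarrow> nat) \<Rightarrow> bool" where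
  "periodic_seq P f \<longleftrightarrow> 1 \<le> P \<and> (\<forall>i. f (i + int P) = f i)"

lemma periodic_rev: assumes "periodic_seq P f" shows "periodic_seq P (rev_seq f)"
  unfolding periodic_seq_def
proof (intro conjI allI)
  fix i
  have "f (- (i + int P) + int P) = f (- (i + int P))" using assms unfolding periodic_seq_def by blast
  then show "rev_seq f (i + int P) = rev_seq f i" by simp
qed (use assms in \<open>simp add: periodic_seq_def\<close>)

lemma periodic_rv: assumes "periodic_seq P f" shows "rv f (i + int P) = rv f i"
proof -
  have "f (i + int P + int k) = f (i + int k)" for k
    using assms unfolding periodic_seq_def by (metis add.assoc add.commute)
  then show ?thesis by (simp add: rv_def)
qed

lemma periodic_lv: assumes "periodic_seq P f" shows "lv f (i + int P) = lv f i"
  using periodic_rv[OF periodic_rev[OF assms], of "- i - int P"] by (simp add: rv_rev add.commute)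

lemma periodic_lam: "pos_seq f \<Longrightarrow> periodic_seq P f \<Longrightarrow> markov_lambda f (i + int P) = markov_lambda f i"
  using periodic_rv[of P f i] periodic_lv[of P f "i - 1"] by (simp add: lam_eq algebra_simps)

text \<open>\<open>X\<close> and \<open>Y\<close> are the two fixed points of the Moebius map of one period; the last two equations
  are Vieta's formulas.\<close>
lemma periodic_quadratic:
  fixes i :: int
  assumes p: "pos_seq f" and per: "periodic_seq P f"
  defines "X \<equiv> rv f i" and "Y \<equiv> - (1 / lv f (i - 1))"
  shows "\<exists>g b c. g \<in> \<rat> \<and> b \<in> \<rat> \<and> c \<in> \<rat> \<and> g \<noteq> 0 \<and> g * (X * X) + b * X + c = 0 \<and>
    g * (X + Y) + b = 0 \<and> g * (X * Y) = c"
proof -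
  have P: "1 \<le> P" using per by (simp add: periodic_seq_def)
  obtain \<alpha> \<beta> \<gamma> \<delta> :: nat where m: "1 \<le> \<gamma>"
    "\<And>z :: int \<Rightarrow> real. (\<forall>k. z k * z (k+1) = real (f k) * z (k+1) + 1) \<Longrightarrow>
      z i * (real \<gamma> * z (i + int P) + real \<delta>) = real \<alpha> * z (i + int P) + real \<beta>"
    using moebius_word[OF p, of P i] P by blast
  have eX: "X * (real \<gamma> * X + real \<delta>) = real \<alpha> * X + real \<beta>"
  proof -
    have "\<forall>k. rv f k * rv f (k+1) = real (f k) * rv f (k+1) + 1"
    proof
      fix k show "rv f k * rv f (k+1) = real (f k) * rv f (k+1) + 1"
        using rv_step[OF p, of k] rv_gt_1[OF p, of "k+1"] by (simp add: field_simps)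
    qed
    from m(2)[OF this] show ?thesis using periodic_rv[OF per, of i] by (simp add: X_def)
  qed
  have eY: "Y * (real \<gamma> * Y + real \<delta>) = real \<alpha> * Y + real \<beta>"
  proof -
    define y where "y k = - (1 / lv f (k - 1))" for k
    have "\<forall>k. y k * y (k+1) = real (f k) * y (k+1) + 1"
    proof
      fix k
      have "real (f k) * y (k+1) + 1 = (lv f k - real (f k)) / lv f k"
        using lv_gt_1[OF p, of k] by (simp add: y_def diff_divide_distrib)
      also have "lv f k - real (f k) = 1 / lv f (k-1)" using lv_step[OF p, of k] by simp
      finally show "y k * y (k+1) = real (f k) * y (k+1) + 1" by (simp add: y_def)
    qed
    from m(2)[OF this] show ?thesis using periodic_lv[OF per, of "i-1"]
      by (simp add: Y_def y_def algebra_simps)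
  qed
  have XY: "0 < X" "Y < 0" using rv_gt_1[OF p, of i] lv_gt_1[OF p, of "i-1"] by (auto simp: X_def Y_def)
  define g where "g = real \<gamma>"
  define b where "b = real \<delta> - real \<alpha>"
  define c where "c = - real \<beta>"
  have qX: "g * (X * X) + b * X + c = 0" and qY: "g * (Y * Y) + b * Y + c = 0"
    using eX eY by (simp_all add: g_def b_def c_def algebra_simps)
  have "(X - Y) * (g * (X + Y) + b) = 0" using qX qY by (simp add: algebra_simps)
  then have s: "g * (X + Y) + b = 0" using XY by simp
  have "g * (X * Y) = X * (g * (X + Y) + b) - (g * (X * X) + b * X + c) + c" by (simp add: algebra_simps)
  then have "g * (X * Y) = c" using s qX by simp
  moreover have "g \<in> \<rat>" "b \<in> \<rat>" "c \<in> \<rat>" "g \<noteq> 0" using m(1) by (auto simp: g_def b_def c_def)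
  ultimately show ?thesis using qX s by blast
qed

text \<open>With \<open>X\<close> and \<open>Y\<close> as roots of a rational quadratic,
  \<open>t = X - Y\<close> has a rational square, and the roots are (S + t)/2 and (S - t)/2 with
  rational sum S.\<close>

lemma periodic_conjugates:
  assumes p: "pos_seq f" and per: "periodic_seq P f" and t: "markov_lambda f i = t"
  shows "t \<notin> \<rat>" "t * t \<in> \<rat>" "conjugates t (rv f i) (- (1 / lv f (i - 1)))"
proof -
  define X where "X = rv f i"
  define Y where "Y = - (1 / lv f (i - 1))"
  obtain g b c where q: "g \<in> \<rat>" "b \<in> \<rat>" "c \<in> \<rat>" "g \<noteq> 0" "g * (X + Y) + b = 0" "g * (X * Y) = c"
    using periodic_quadratic[OF p per, of i] unfolding X_def Y_def by blast
  have tXY: "t = X - Y" using t lam_eq[OF p, of i] by (simp add: X_def Y_def)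
  have S: "X + Y = - b / g" "X * Y = c / g" using q(4,5,6) by (simp_all add: field_simps)
  then have SQ: "X + Y \<in> \<rat>" "X * Y \<in> \<rat>" using q by auto
  have X: "X = (X + Y) / 2 + (1/2) * t" and Y: "Y = (X + Y) / 2 - (1/2) * t" using tXY by (simp_all add: field_simps)
  have "(X + Y) / 2 \<in> \<rat>" "1/2 \<in> \<rat>" using SQ by auto
  then show "conjugates t (rv f i) (- (1 / lv f (i - 1)))"
    unfolding conjugates_def X_def[symmetric] Y_def[symmetric] using X Y by blast
  show "t \<notin> \<rat>"
  proof
    assume "t \<in> \<rat>"
    then have "X \<in> \<rat>" using X \<open>(X + Y) / 2 \<in> \<rat>\<close> \<open>1/2 \<in> \<rat>\<close> by (metis Rats_add Rats_mult)
    then show False using rv_irrational[OF p, of i] by (simp add: X_def)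
  qed
  have "t * t = (X + Y) * (X + Y) - 4 * (X * Y)" unfolding tXY by (simp add: algebra_simps)
  then show "t * t \<in> \<rat>" using SQ by (simp add: Rats_diff Rats_mult)
qed

text \<open>Galois's theorem in a field \<rat>(t) that may come from another sequence: a conjugate
  of \<open>rv\<close> solves the same quadratic equation and, as \<open>rv\<close> is irrational,
  is the other root.\<close>

lemma periodic_conjugate_unique:
  assumes p: "pos_seq f" and per: "periodic_seq P f" and t: "t \<notin> \<rat>" "t * t \<in> \<rat>"
    and z: "conjugates t (rv f i) z"
  shows "z = - (1 / lv f (i - 1))"
proof -
  define X where "X = rv f i"
  define Y where "Y = - (1 / lv f (i - 1))"
  obtain g b c where q: "g \<in> \<rat>" "b \<in> \<rat>" "c \<in> \<rat>" "g \<noteq> 0" "g * (X * X) + b * X + c = 0" "g * (X + Y) + b = 0"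
    using periodic_quadratic[OF p per, of i] unfolding X_def Y_def by blast
  have qz: "g * (z * z) + b * z + c = 0"
    using conjugates_quadratic[OF t z q(1-3)] q(5) by (simp add: X_def)
  have "z \<noteq> X"
  proof
    assume "z = X"
    then obtain u v where uv: "u \<in> \<rat>" "X = u + v * t" "X = u - v * t"
      using z unfolding conjugates_def X_def by blast
    then have "X = u" by simp
    then show False using uv(1) rv_irrational[OF p, of i] by (simp add: X_def)
  qed
  have "(z - X) * (g * (X + z) + b) = 0" using qz q(5) by (simp add: algebra_simps)
  then have "g * (X + z) + b = 0" using \<open>z \<noteq> X\<close> by simp
  then have "g * (X + z) + b = g * (X + Y) + b" using q(6) by simp
  then show ?thesis using q(4) by (simp add: Y_def)
qed

lemma conjugates_rv_back:
  assumes p: "pos_seq a" and t: "t \<notin> \<rat>" "t * t \<in> \<rat>" and z: "conjugates t (rv a (i+1)) z"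
  shows "z \<noteq> 0" "conjugates t (rv a i) (real (a i) + 1 / z)"
proof -
  have "rv a (i+1) \<noteq> 0" using rv_gt_1[OF p, of "i+1"] by simp
  note inv = conjugates_inverse[OF t z this]
  show "z \<noteq> 0" by (rule inv(1))
  show "conjugates t (rv a i) (real (a i) + 1 / z)"
    unfolding rv_step[OF p, of i] by (rule conjugates_add_rat[OF inv(2)]) simp
qed

lemma conjugates_rv_forward:
  assumes p: "pos_seq a" and t: "t \<notin> \<rat>" "t * t \<in> \<rat>" and z: "conjugates t (rv a i) z"
  shows "\<exists>z'. conjugates t (rv a (i+1)) z'"
proof -
  have "conjugates t (- real (a i) + rv a i) (- real (a i) + z)"
    by (rule conjugates_add_rat[OF z]) simp
  moreover have "- real (a i) + rv a i \<noteq> 0" using rv_bounds[OF p, of i] by simp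
  ultimately have "conjugates t (1 / (- real (a i) + rv a i)) (1 / (- real (a i) + z))"
    by (rule conjugates_inverse(2)[OF t])
  moreover have "1 / (- real (a i) + rv a i) = rv a (i+1)" using rv_step[OF p, of i] by simp
  ultimately show ?thesis by auto
qed

lemma conjugates_rv_all:
  assumes p: "pos_seq a" and t: "t \<notin> \<rat>" "t * t \<in> \<rat>" and z: "\<exists>z. conjugates t (rv a i0) z"
  shows "\<exists>z. conjugates t (rv a i) z"
proof (induction i rule: int_induct[where k=i0])
  case (step1 i) then show ?case using conjugates_rv_forward[OF p t] by blast
next
  case (step2 i)
  then obtain z where "conjugates t (rv a (i - 1 + 1)) z" by auto
  then show ?case using conjugates_rv_back(2)[OF p t] by blast
qed (rule z)

text \<open>The conjugate of a complete quotient of an eventually periodic sequence is computed by running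
  the recursion \<open>z = a + 1 / z'\<close> backwards from the periodic tail \<open>f\<close>. At the first disagreement
  between \<open>a\<close> and \<open>f\<close> it leaves the interval \<open>(-1, 0)\<close>, and one step later it becomes
  positive for good.\<close>
lemma conjugate_gap:
  assumes p: "pos_seq a" "pos_seq f" and per: "periodic_seq P f" and t: "t \<notin> \<rat>" "t * t \<in> \<rat>"
    and ag: "\<forall>i\<ge>I. a i = f i" and z: "conjugates t (rv a i) z"
  shows "((\<forall>k\<ge>i. a k = f k) \<and> z = - (1 / lv f (i - 1))) \<or>
    (rv a i - z = markov_lambda f i \<and> (z < -1 \<or> 0 < z)) \<or> (0 < z \<and> rv a i - z < 2)"
proof -
  have base: "(\<forall>k\<ge>i. a k = f k) \<and> z = - (1 / lv f (i - 1))" if "I \<le> i" "conjugates t (rv a i) z" for i z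
  proof -
    have "rv a i = rv f i" by (rule rv_cong) (use ag that in auto)
    then show ?thesis using periodic_conjugate_unique[OF p(2) per t, of i z] that ag by auto
  qed
  have "((\<forall>k\<ge>I - int n. a k = f k) \<and> z = - (1 / lv f (I - int n - 1))) \<or>
    (rv a (I - int n) - z = markov_lambda f (I - int n) \<and> (z < -1 \<or> 0 < z)) \<or>
    (0 < z \<and> rv a (I - int n) - z < 2)" if "conjugates t (rv a (I - int n)) z" for n z
    using that
  proof (induction n arbitrary: z)
    case 0 then show ?case using base[of I z] by simp
  next
    case (Suc n)
    define j where "j = I - int (Suc n)"
    have j1: "I - int n = j + 1" by (simp add: j_def)
    have cz: "conjugates t (rv a j) z" using Suc.prems by (simp add: j_def)
    obtain z1 where z1: "conjugates t (rv a (j+1)) z1" using conjugates_rv_forward[OF p(1) t cz] by blast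
    note b = conjugates_rv_back[OF p(1) t z1]
    have ze: "z = real (a j) + 1 / z1" using conjugates_unique[OF t(1) cz b(2)] .
    \<comment> \<open>Either \<open>a\<close> still agrees with \<open>f\<close>, or the conjugate
      has already left the interval \<open>[-1, 0]\<close>.\<close>
    consider (A) "\<forall>k\<ge>j+1. a k = f k" "z1 = - (1 / lv f j)" | (B) "z1 < -1 \<or> 0 < z1"
      using Suc.IH[of z1] z1 unfolding j1 by auto
    then have "((\<forall>k\<ge>j. a k = f k) \<and> z = - (1 / lv f (j - 1))) \<or>
      (rv a j - z = markov_lambda f j \<and> (z < -1 \<or> 0 < z)) \<or> (0 < z \<and> rv a j - z < 2)"
    proof cases
      case A
      have z2: "z = real (a j) - lv f j" using ze A(2) by simp
      show ?thesis
      proof (cases "a j = f j")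
        case True
        have "\<forall>k\<ge>j. a k = f k"
        proof (intro allI impI)
          fix k assume "j \<le> k" then show "a k = f k" using A(1) True by (cases "k = j") auto
        qed
        then show ?thesis using z2 True lv_step[OF p(2), of j] by simp
      next
        case False
        have "rv a (j+1) = rv f (j+1)" by (rule rv_cong) (use A in auto)
        then have "rv a j - z = markov_lambda f j"
          using z2 rv_step[OF p(1), of j] lam_eq_lv[OF p(2), of j] by simp
        moreover have "z < -1 \<or> 0 < z"
        proof (cases "a j < f j")
          case True
          then have "real (a j) + 1 \<le> real (f j)" by linarith
          then show ?thesis using z2 lv_bounds[OF p(2), of j] by linarith
        next
          case F: False
          then have "real (f j) + 1 \<le> real (a j)" using False by linarith
          then show ?thesis using z2 lv_bounds[OF p(2), of j] by linarith
        qed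
        ultimately show ?thesis by blast
      qed
    next
      case B
      have "- 1 < 1 / z1"
      proof (cases "0 < z1")
        case True then show ?thesis by (simp add: less_trans[of "-1" 0])
      next
        case False
        then have "z1 < -1" using B by simp
        then show ?thesis by (simp add: field_simps)
      qed
      then show ?thesis using ze seq_ge_1[OF p(1), of j] rv_bounds[OF p(1), of j] by linarith
    qed
    then show ?case by (simp add: j_def)
  qed
  from this[of "nat (I - i)" z] show ?thesis
  proof (cases "I \<le> i")
    case True then show ?thesis using base[OF True z] by blast
  next
    case False
    then have "I - int (nat (I - i)) = i" by simp
    then show ?thesis using \<open>conjugates t (rv a (I - int (nat (I - i)))) z \<Longrightarrow> _\<close> z by simp
  qed
qed

text \<open>If a sequence is periodic to the left with Markov value \<open>t\<close>, then applying Galois conjugation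
  to \<open>\<lambda>\<^sub>0(a) = t\<close> yields two gaps, each at most \<open>t\<close>, that sum to \<open>2 * t\<close>; equality forces periodicity.\<close>
lemma biperiodic_is_periodic:
  assumes p: "pos_seq a" "pos_seq e" "pos_seq f" and per: "periodic_seq P e" "periodic_seq Q f"
    and ag: "\<forall>i\<le>I0. a i = e i" "\<forall>i\<ge>I1. a i = f i"
    and lam: "markov_lambda a 0 = t" "markov_lambda e j0 = t" "\<forall>j. markov_lambda e j \<le> t"
      "\<forall>j. markov_lambda f j \<le> t" "2 \<le> t"
  shows "a = f"
proof -
  note t = periodic_conjugates(1,2)[OF p(2) per(1) lam(2)]
  \<comment> \<open>Conjugation takes \<open>rv e\<close> to \<open>- 1/lv e\<close>, so the
    quotients of the reversed \<open>e\<close> have conjugates too; the common left end transfers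
    this to \<open>a\<close>.\<close>
  have ce: "conjugates t (rv e j0) (- (1 / lv e (j0 - 1)))" by (rule periodic_conjugates(3)[OF p(2) per(1) lam(2)])
  have "conjugates t (1 / lv e (j0 - 1)) (- rv e j0)"
    using conjugates_minus[OF conjugates_sym[OF ce]] by simp
  moreover have "1 / lv e (j0 - 1) \<noteq> 0" using inv_lv[OF p(2), of "j0 - 1"] by simp
  ultimately have "conjugates t (1 / (1 / lv e (j0 - 1))) (1 / (- rv e j0))" by (rule conjugates_inverse(2)[OF t])
  then have "\<exists>z. conjugates t (rv (rev_seq e) (1 - j0)) z" by (auto simp: rv_rev)
  moreover have pr: "pos_seq (rev_seq e)" "pos_seq (rev_seq a)" using p by simp_all
  ultimately have "\<exists>z. conjugates t (rv (rev_seq e) (- I0)) z" using conjugates_rv_all[OF _ t] by blast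
  moreover have "rv (rev_seq e) (- I0) = rv (rev_seq a) (- I0)" by (rule rv_cong) (use ag(1) in auto)
  ultimately have "\<exists>z. conjugates t (rv (rev_seq a) 0) z" using conjugates_rv_all[OF pr(2) t] by metis
  then obtain z' where z': "conjugates t (rv (rev_seq a) 0) z'" by blast
  have r0: "rv a 0 = t + real (a 0) - lv a 0"
    using lam(1) lam_eq_lv[OF p(1), of 0] rv_step[OF p(1), of 0] by simp
  \<comment> \<open>The conjugate of \<open>rv a 0 = t + a 0 - lv a 0\<close>, since
    \<open>t\<close> goes to \<open>- t\<close>.\<close>
  define z where "z = real (a 0) - t - z'"
  have cz: "conjugates t (rv a 0) z"
  proof -
    obtain u v where uv: "u \<in> \<rat>" "v \<in> \<rat>" "lv a 0 = u + v * t" "z' = u - v * t"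
      using z' unfolding conjugates_def by (auto simp: rv_rev)
    have "rv a 0 = (real (a 0) - u) + (1 - v) * t" "z = (real (a 0) - u) - (1 - v) * t"
      using r0 uv by (simp_all add: z_def algebra_simps)
    moreover have "real (a 0) - u \<in> \<rat>" "1 - v \<in> \<rat>" using uv by auto
    ultimately show ?thesis unfolding conjugates_def by blast
  qed
  have bound: "rv b 0 - w \<le> t"
    if "((\<forall>k\<ge>0. b k = h k) \<and> w = - (1 / lv h (0 - 1))) \<or>
       (rv b 0 - w = markov_lambda h 0 \<and> (w < -1 \<or> 0 < w)) \<or> (0 < w \<and> rv b 0 - w < 2)"
      "pos_seq h" "\<forall>j. markov_lambda h j \<le> t" for b h w
    using that(1)
  proof (elim disjE conjE)
    assume "\<forall>k\<ge>0. b k = h k" "w = - (1 / lv h (0 - 1))"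
    moreover from this have "rv b 0 = rv h 0" by (intro rv_cong) auto
    ultimately show ?thesis using that(3)[rule_format, of 0] lam_eq[OF that(2), of 0] by simp
  qed (use that(3) lam(5) in \<open>auto simp del: diff_le_eq\<close>)
  note ga = conjugate_gap[OF p(1,3) per(2) t ag(2) cz]
  have "\<forall>i\<ge>- I0. rev_seq a i = rev_seq e i" using ag(1) by simp
  note gr = conjugate_gap[OF pr(2,1) periodic_rev[OF per(1)] t this z']
  have 1: "rv a 0 - z \<le> t" by (rule bound[OF ga p(3) lam(4)])
  have 2: "rv (rev_seq a) 0 - z' \<le> t"
    by (rule bound[OF gr pr(1)]) (use lam(3) p(2) in \<open>simp add: lam_rev\<close>)
  have "rv a 0 - z = t" using 1 2 r0 by (simp add: z_def rv_rev)
  \<comment> \<open>Equality puts \<open>z\<close> into the interval \<open>(-1, 0)\<close>, which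
    leaves only the first alternative of \<open>conjugate_gap\<close>; the value of \<open>z\<close>
    then determines the left half of \<open>a\<close>.\<close>
  then have z: "z = - (1 / lv a (-1))" using r0 lv_step[OF p(1), of 0] by simp
  then have zb: "-1 < z" "z < 0" using inv_lv[OF p(1), of "-1"] by auto
  then have A: "\<forall>k\<ge>0. a k = f k" "z = - (1 / lv f (0 - 1))" using ga by auto
  have "lv a (-1) = lv f (-1)" using z A(2) by simp
  then have "a k = f k" if "k \<le> -1" for k using lv_inj_eq[OF p(1,3)] that by blast
  then show ?thesis using A(1) by (metis ext linorder_not_le zle_diff1_eq diff_0)
qed

section \<open>Rigid and flexible limits\<close>

lemma le_by_err:
  fixes x y :: real assumes "\<And>n. x \<le> y + 8 / 2^n" shows "x \<le> y"
proof (rule ccontr)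
  assume "\<not> x \<le> y"
  then obtain n where "8 / 2^n < x - y" using err_small[of "x - y"] by auto
  then show False using assms[of n] by linarith
qed

text \<open>The first position beyond \<open>N0\<close> where \<open>w\<close> left \<open>a\<close>
  would be a witness of flexibility.\<close>

lemma right_rigid:
  assumes "\<not> right_flexible a t"
  shows "\<exists>e>0. \<exists>N::nat. \<forall>w. pos_seq w \<and> (\<forall>i\<le>int N. w i = a i) \<and> (\<forall>j. markov_lambda w j \<le> t + e) \<longrightarrow> w = a"
proof -
  obtain e N0 where e: "0 < e" and no: "\<And>N w. N \<ge> (N0::nat) \<Longrightarrow> pos_seq w \<Longrightarrow> \<forall>i\<le>int N. w i = a i \<Longrightarrow>
     w (int N + 1) \<noteq> a (int N + 1) \<Longrightarrow> \<not> (\<forall>j. markov_lambda w j \<le> t + e)"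
    using assms unfolding right_flexible_def by blast
  have "w = a" if w: "pos_seq w" "\<forall>i\<le>int N0. w i = a i" "\<forall>j. markov_lambda w j \<le> t + e" for w
  proof -
    have "\<forall>i\<le>int (N0 + n). w i = a i" for n
    proof (induction n)
      case (Suc n)
      then have eq: "w (int (N0 + n) + 1) = a (int (N0 + n) + 1)"
        using no[OF le_add1 w(1) Suc] w(3) by blast
      show ?case
      proof (intro allI impI)
        fix i assume "i \<le> int (N0 + Suc n)"
        then have "i \<le> int (N0 + n) \<or> i = int (N0 + n) + 1" by auto
        then show "w i = a i" using Suc eq by blast
      qed
    qed (use w in auto)
    note ag = this
    have "w i = a i" for i using ag[of "nat i"] by auto
    then show ?thesis by blast
  qed
  then show ?thesis using e by blast
qed

text \<open>Splice the left half of \<open>a\<close> with the right half of a close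
  \<open>b\<close>: rigidity identifies the result with \<open>a\<close>.\<close>

lemma tail_rigid:
  assumes nf: "\<not> right_flexible a t" and a: "pos_seq a" "markov_lambda a 0 = t" "\<forall>j. markov_lambda a j \<le> t"
  shows "\<exists>N0::nat. \<forall>b. pos_seq b \<and> (\<forall>i. \<bar>i\<bar> \<le> int N0 \<longrightarrow> b i = a i) \<and>
     (\<forall>j. markov_lambda b j \<le> markov_lambda b 0) \<longrightarrow> (\<forall>i\<ge>0. b i = a i)"
proof -
  obtain e N1 where e: "0 < e" and rig: "\<And>w. pos_seq w \<Longrightarrow> \<forall>i\<le>int N1. w i = a i \<Longrightarrow>
    \<forall>j. markov_lambda w j \<le> t + e \<Longrightarrow> w = a"
    using right_rigid[OF nf] by blast
  obtain R where R: "8 / 2^R < e / 2" using err_small[of "e/2"] e by auto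
  define N0 where "N0 = max N1 R"
  have err: "8 / 2^N0 < e / 2" using R err_mono[of R N0] by (auto simp: N0_def)
  have "b i = a i" if b: "pos_seq b" "\<forall>i. \<bar>i\<bar> \<le> int N0 \<longrightarrow> b i = a i"
     "\<forall>j. markov_lambda b j \<le> markov_lambda b 0" "0 \<le> i" for b i
  proof -
    have "\<bar>markov_lambda b 0 - markov_lambda a 0\<bar> \<le> 8 / 2^N0"
      by (rule lam_close[OF b(1) a(1)]) (use b(2) in auto)
    then have b0: "markov_lambda b 0 \<le> t + 8 / 2^N0" using a(2) by linarith
    have lb: "\<forall>j. markov_lambda b j \<le> t + 8 / 2^N0" using b(3) b0 order_trans by blast
    have "0 \<le> (8::real) / 2^N0" by simp
    then have la: "\<forall>j. markov_lambda a j \<le> t + 8 / 2^N0" using a(3) by (meson add_increasing2 order_trans order_refl)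
    have ag: "\<forall>i. \<bar>i - 0\<bar> \<le> int N0 \<longrightarrow> a i = b i" using b(2) by simp
    define w where "w = (\<lambda>i. if i \<le> (0::int) then a i else b i)"
    note g = glue[OF a(1) b(1) ag w_def la lb]
    have "w = a"
    proof (rule rig[OF g(1)])
      show "\<forall>i\<le>int N1. w i = a i" using b(2) by (auto simp: w_def N0_def)
      show "\<forall>j. markov_lambda w j \<le> t + e"
      proof
        fix j show "markov_lambda w j \<le> t + e" using g(2)[of j] err by linarith
      qed
    qed
    then have "w i = a i" by simp
    then show ?thesis using b(2,4) by (cases "i = 0") (auto simp: w_def)
  qed
  then show ?thesis by blast
qed

text \<open>If both halves were rigid, close approximants would coincide with \<open>a\<close> and
  so have the value \<open>t\<close>.\<close>

lemma flexible_dichotomy: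
  assumes sl: "spectrum_limit a t"
  shows "right_flexible a t \<or> right_flexible (rev_seq a) t"
proof (rule ccontr)
  assume "\<not> ?thesis"
  then have nf: "\<not> right_flexible a t" "\<not> right_flexible (rev_seq a) t" by auto
  have a: "pos_seq a" "markov_lambda a 0 = t" "\<forall>j. markov_lambda a j \<le> t"
    using sl by (auto simp: spectrum_limit_def)
  have r: "pos_seq (rev_seq a)" "markov_lambda (rev_seq a) 0 = t" "\<forall>j. markov_lambda (rev_seq a) j \<le> t"
    using a by (auto simp: lam_rev)
  obtain N1 where N1: "\<And>b. pos_seq b \<Longrightarrow> (\<forall>i. \<bar>i\<bar> \<le> int N1 \<longrightarrow> b i = a i) \<Longrightarrow>
     (\<forall>j. markov_lambda b j \<le> markov_lambda b 0) \<Longrightarrow> (\<forall>i\<ge>0. b i = a i)"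
    using tail_rigid[OF nf(1) a] by blast
  obtain N2 where N2: "\<And>b. pos_seq b \<Longrightarrow> (\<forall>i. \<bar>i\<bar> \<le> int N2 \<longrightarrow> b i = rev_seq a i) \<Longrightarrow>
     (\<forall>j. markov_lambda b j \<le> markov_lambda b 0) \<Longrightarrow> (\<forall>i\<ge>0. b i = rev_seq a i)"
    using tail_rigid[OF nf(2) r] by blast
  obtain b where b: "pos_seq b" "\<forall>i. \<bar>i\<bar> \<le> int (max N1 N2) \<longrightarrow> b i = a i"
        "\<forall>j. markov_lambda b j \<le> markov_lambda b 0" "markov_lambda b 0 \<noteq> t"
    using sl unfolding spectrum_limit_def by blast
  have 1: "\<forall>i\<ge>0. b i = a i" by (rule N1[OF b(1) _ b(3)]) (use b(2) in auto)
  have 2: "\<forall>i\<ge>0. rev_seq b i = rev_seq a i"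
    by (rule N2[of "rev_seq b"]) (use b in \<open>auto simp: lam_rev\<close>)
  have "b i = a i" for i
    using 1[rule_format, of i] 2[rule_format, of "- i"] by (cases "0 \<le> i") auto
  then have "b = a" by blast
  then show False using b(4) a(2) by simp
qed

section \<open>Eventual periodicity of rigid and of extremal halves\<close>

lemma periodic_extension:
  assumes p: "pos_seq a" and P: "1 \<le> P" "\<forall>i\<ge>I. a (i + int P) = a i"
  shows "\<exists>f. pos_seq f \<and> periodic_seq P f \<and> (\<forall>i\<ge>I. a i = f i)"
proof -
  define f where "f i = a (I + (i - I) mod int P)" for i
  have "a i = f i" if "I \<le> i" for i
  proof -
    have "a (j + int n * int P) = a j" if "I \<le> j" for j n
    proof (induction n)
      case (Suc n)
      have "a (j + int (Suc n) * int P) = a ((j + int n * int P) + int P)" by (simp add: algebra_simps)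
      also have "\<dots> = a (j + int n * int P)" using P(2) that by (simp add: add_increasing2)
      finally show ?case using Suc by simp
    qed simp
    note * = this
    have "I \<le> I + (i - I) mod int P" using P by simp
    from *[OF this, of "nat ((i - I) div int P)"] show ?thesis
      using that P by (simp add: f_def pos_imp_zdiv_nonneg_iff algebra_simps)
  qed
  moreover have "f (i + int P) = f i" for i
  proof -
    have "(i + int P - I) mod int P = ((i - I) + int P) mod int P" by (simp add: algebra_simps)
    then show ?thesis by (simp add: f_def)
  qed
  then have "periodic_seq P f" using P(1) by (simp add: periodic_seq_def)
  moreover have "pos_seq f" using p by (simp add: pos_seq_def f_def)
  ultimately show ?thesis by blast
qed

text \<open>Pigeonhole on windows. Their starting points \<open>N + 2 * n\<close> differ by even
  numbers, which matters for the order of continued fractions.\<close>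

lemma repeated_window:
  assumes p: "pos_seq a" and le: "\<forall>j. markov_lambda a j \<le> t"
  shows "\<exists>q q' :: nat. N \<le> q \<and> q < q' \<and> even (q' - q) \<and>
    (\<forall>k. int q \<le> k \<and> k \<le> int (q + 2 * R) \<longrightarrow> a k = a (k + int (q' - q)))"
proof -
  define A where "A = nat \<lceil>t\<rceil>"
  have A: "a i \<le> A" for i using lam_gt[OF p, of i] le[rule_format, of i] unfolding A_def by linarith
  define w where "w n = map (\<lambda>k. a (int (N + 2 * n) + int k)) [0..<2*R+1]" for n
  have "range w \<subseteq> {xs. set xs \<subseteq> {..A} \<and> length xs = 2*R+1}" using A by (auto simp: w_def)
  then have "finite (range w)" using finite_lists_length_eq[of "{..A}"] finite_subset by blast
  then have "\<not> inj w" using finite_imageD infinite_UNIV_nat by blast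
  then obtain n n' where n: "n < n'" "w n = w n'" unfolding inj_def by (metis linorder_neqE_nat)
  have "a (int (N + 2 * n) + int k) = a (int (N + 2 * n') + int k)" if "k < 2*R+1" for k
  proof -
    have "w n ! k = w n' ! k" using n(2) by simp
    then show ?thesis using that by (simp add: w_def del: upt_Suc)
  qed
  note eq = this
  have "a k = a (k + int (N + 2 * n' - (N + 2 * n)))"
    if "int (N + 2 * n) \<le> k" "k \<le> int (N + 2 * n + 2 * R)" for k
  proof -
    have "nat (k - int (N + 2 * n)) < 2*R+1" using that by auto
    from eq[OF this] show ?thesis using that n(1) by (simp add: of_nat_diff algebra_simps)
  qed
  moreover have "N \<le> N + 2 * n" "N + 2 * n < N + 2 * n'" "even (N + 2 * n' - (N + 2 * n))"
    using n(1) by auto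
  ultimately show ?thesis by blast
qed

text \<open>Cutting out the letters between two equal windows raises the values by little, so by
  rigidity the shortened sequence equals \<open>a\<close>.\<close>

lemma rigid_periodic:
  assumes nf: "\<not> right_flexible a t" and a: "pos_seq a" "\<forall>j. markov_lambda a j \<le> t"
  shows "\<exists>P f I. pos_seq f \<and> periodic_seq P f \<and> (\<forall>i\<ge>I. a i = f i)"
proof -
  obtain e N1 where e: "0 < e" and rig: "\<And>w. pos_seq w \<Longrightarrow> \<forall>i\<le>int N1. w i = a i \<Longrightarrow>
    \<forall>j. markov_lambda w j \<le> t + e \<Longrightarrow> w = a"
    using right_rigid[OF nf] by blast
  obtain R where R: "8 / 2^R < e" using err_small[OF e] by blast
  obtain q q' :: nat where q: "N1 \<le> q" "q < q'"
    "\<forall>k. int q \<le> k \<and> k \<le> int (q + 2 * R) \<longrightarrow> a k = a (k + int (q' - q))"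
    using repeated_window[OF a, of N1 R] by blast
  define P where "P = q' - q"
  define m where "m = int q + int R"
  define w where "w = (\<lambda>i. if i \<le> m then a i else shift_seq (int P) a i)"
  have ag: "\<forall>i. \<bar>i - m\<bar> \<le> int R \<longrightarrow> a i = shift_seq (int P) a i"
  proof (intro allI impI)
    fix i assume "\<bar>i - m\<bar> \<le> int R"
    then have "int q \<le> i \<and> i \<le> int (q + 2 * R)" by (auto simp: m_def)
    then show "a i = shift_seq (int P) a i" using q(3) by (simp add: P_def)
  qed
  have ls: "\<forall>j. markov_lambda (shift_seq (int P) a) j \<le> t" using a by (simp add: lam_shift)
  have ps: "pos_seq (shift_seq (int P) a)" using a(1) by simp
  note g = glue[OF a(1) ps ag w_def a(2) ls]
  have "w = a"
  proof (rule rig[OF g(1)])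
    show "\<forall>i\<le>int N1. w i = a i" using q(1) by (auto simp: w_def m_def)
    show "\<forall>j. markov_lambda w j \<le> t + e"
    proof
      fix j show "markov_lambda w j \<le> t + e" using g(2)[of j] R by linarith
    qed
  qed
  then have "a (i + int P) = a i" if "m + 1 \<le> i" for i
  proof -
    have "w i = a (i + int P)" using that by (simp add: w_def)
    then show ?thesis using \<open>w = a\<close> by simp
  qed
  then have "\<forall>i\<ge>m + 1. a (i + int P) = a i" by blast
  moreover have "1 \<le> P" using q(2) by (simp add: P_def)
  ultimately show ?thesis using periodic_extension[OF a(1)] by blast
qed

lemma periodic_tail_le:
  assumes a: "pos_seq a" "\<forall>j. markov_lambda a j \<le> t" and f: "pos_seq f" "periodic_seq P f" "\<forall>i\<ge>I. a i = f i"
  shows "markov_lambda f j \<le> t"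
proof (rule le_by_err)
  fix n
  define k where "k = nat (I - j) + n"
  have per: "markov_lambda f (j + int (m * P)) = markov_lambda f j" for m
  proof (induction m)
    case (Suc m)
    then show ?case using periodic_lam[OF f(1,2), of "j + int (m * P)"] by (simp add: algebra_simps)
  qed simp
  have "k \<le> k * P" using f(2) by (simp add: periodic_seq_def)
  then have "I + int n \<le> j + int (k * P)" unfolding k_def by linarith
  then have "\<bar>markov_lambda a (j + int (k * P)) - markov_lambda f (j + int (k * P))\<bar> \<le> 8 / 2^n"
    by (intro lam_close[OF a(1) f(1)]) (use f(3) in auto)
  then show "markov_lambda f j \<le> t + 8 / 2^n" using per[of k] a(2)[rule_format, of "j + int (k * P)"] by linarith
qed

text \<open>A value above \<open>t\<close> would exceed everything at the left end, where
  \<open>c\<close> looks like \<open>a\<close>. Then \<open>c\<close> would be perturbable with a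
  value within \<open>e / 2\<close> of \<open>t\<close>, inside the gap.\<close>

lemma same_left_le:
  assumes a: "pos_seq a" "\<forall>j. markov_lambda a j \<le> t" and t: "3 < t"
    and gap: "\<forall>c s. perturbable c s \<longrightarrow> e \<le> \<bar>s - t\<bar>"
    and c: "pos_seq c" "\<forall>i\<le>I. c i = a i" "\<forall>i\<ge>K. c i = 1" "\<forall>j. markov_lambda c j \<le> t + e / 2" "0 < e"
  shows "markov_lambda c j \<le> t"
proof (rule ccontr)
  assume "\<not> ?thesis"
  obtain s where s: "lam_sup c s" "s \<le> t + e / 2" using bounded_lam_sup[OF c(4)] by blast
  have "markov_lambda c j \<le> s" using s(1) by (simp add: lam_sup_def)
  then have ts: "t < s" using \<open>\<not> markov_lambda c j \<le> t\<close> by linarith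
  define d where "d = (s - t) / 2"
  have d: "0 < d" "s - d = t + d" using ts by (auto simp: d_def field_simps)
  obtain R where R: "8 / 2^R < d" using err_small[OF d(1)] by blast
  have "perturbable c s" unfolding perturbable_def
  proof (intro conjI)
    show "\<exists>d>0. \<exists>J. \<forall>j\<le>J. markov_lambda c j \<le> s - d"
    proof (rule exI[of _ d], intro conjI exI[of _ "I - int R"] allI impI)
      fix j assume "j \<le> I - int R"
      then have "\<bar>markov_lambda c j - markov_lambda a j\<bar> \<le> 8 / 2^R"
        by (intro lam_close[OF c(1) a(1)]) (use c(2) in auto)
      then show "markov_lambda c j \<le> s - d" using a(2)[rule_format, of j] R d(2) by linarith
    qed (rule d(1))
  qed (use c s ts t in auto)
  then have "e \<le> \<bar>s - t\<bar>" using gap by blast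
  then show False using ts s(2) c(5) by linarith
qed

text \<open>The splicing \<open>w\<close> need not end in 1s. It is approximated by
  \<open>v\<close>, which follows \<open>w\<close> for a long time and then runs into the hub;
  \<open>same_left_le\<close> bounds \<open>v\<close>, and the bound passes to the limit.\<close>

lemma splice_le:
  assumes a: "pos_seq a" "\<forall>j. markov_lambda a j \<le> t" and t: "3 < t"
    and gap: "\<forall>c s. perturbable c s \<longrightarrow> e \<le> \<bar>s - t\<bar>" "0 < e" and conn: "right_connected a t"
    and R: "8 / 2^R < e / 4" and ag: "\<forall>i. \<bar>i - int m\<bar> \<le> int R \<longrightarrow> a i = a (i + d)"
    and w: "w = (\<lambda>i. if i \<le> int m then a i else a (i + d))"
  shows "markov_lambda w 0 \<le> t"
proof (rule le_by_err)
  fix n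
  \<comment> \<open>Large enough, after the shift by \<open>d\<close>, for the window at the cut and
    for radius \<open>n\<close> around 0.\<close>
  define M where "M = n + m + R + nat \<bar>d\<bar>"
  have "0 < e / 4" using gap(2) by simp
  then obtain c K where c: "pos_seq c" "\<forall>i\<le>int M. c i = a i" "\<forall>i\<ge>K. c i = 1" "\<forall>j. markov_lambda c j \<le> t + e / 4"
    using conn unfolding right_connected_def by blast
  define v where "v = (\<lambda>i. if i \<le> int m then a i else shift_seq d c i)"
  have ag': "\<forall>i. \<bar>i - int m\<bar> \<le> int R \<longrightarrow> a i = shift_seq d c i"
    using ag c(2) by (auto simp: M_def)
  have la: "\<forall>j. markov_lambda a j \<le> t + e / 4" using a(2) gap(2) by (meson add_increasing2 divide_nonneg_nonneg less_imp_le order_refl order_trans zero_le_numeral)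
  have lc: "\<forall>j. markov_lambda (shift_seq d c) j \<le> t + e / 4" using c(1,4) by (simp add: lam_shift)
  have pc: "pos_seq (shift_seq d c)" using c(1) by simp
  note g = glue[OF a(1) pc ag' v_def la lc]
  have lv: "\<forall>j. markov_lambda v j \<le> t + e / 2"
  proof
    fix j show "markov_lambda v j \<le> t + e / 2" using g(2)[of j] R by linarith
  qed
  have "markov_lambda v 0 \<le> t"
  proof (rule same_left_le[OF a t gap(1) g(1) _ _ lv gap(2)])
    show "\<forall>i\<le>int m. v i = a i" by (simp add: v_def)
    show "\<forall>i\<ge>max (int m + 1) (K - d). v i = 1" using c(3) by (auto simp: v_def)
  qed
  moreover have "pos_seq w" using a(1) by (simp add: w pos_seq_def)
  then have "\<bar>markov_lambda w 0 - markov_lambda v 0\<bar> \<le> 8 / 2^n"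
    by (rule lam_close[OF _ g(1)]) (use c(2) in \<open>auto simp: w v_def M_def\<close>)
  ultimately show "markov_lambda w 0 \<le> t + 8 / 2^n" by linarith
qed

text \<open>By \<open>splice_le\<close> the right half of \<open>a\<close> is extremal among its own splicings. Splicing at two equal
  windows in both directions therefore identifies the tails behind the windows.\<close>
lemma connected_periodic:
  assumes a: "pos_seq a" "markov_lambda a 0 = t" "\<forall>j. markov_lambda a j \<le> t" and t: "3 < t"
    and gap: "\<forall>c s. perturbable c s \<longrightarrow> e \<le> \<bar>s - t\<bar>" "0 < e" and conn: "right_connected a t"
  shows "\<exists>P f I. pos_seq f \<and> periodic_seq P f \<and> (\<forall>i\<ge>I. a i = f i)"
proof -
  obtain R where R: "8 / 2^R < e / 4" using err_small[of "e/4"] gap(2) by auto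
  obtain q q' :: nat where q: "q < q'" "even (q' - q)"
    "\<forall>k. int q \<le> k \<and> k \<le> int (q + 2 * R) \<longrightarrow> a k = a (k + int (q' - q))"
    using repeated_window[OF a(1,3), of 0 R] by blast
  define P where "P = q' - q"
  define m where "m = q + R"
  define m' where "m' = q' + R"
  have mm: "m' = m + P" using q(1) by (simp add: m_def m'_def P_def)
  define w1 where "w1 = (\<lambda>i. if i \<le> int m then a i else a (i + int P))"
  define w2 where "w2 = (\<lambda>i. if i \<le> int m' then a i else a (i + - int P))"
  have ag1: "\<forall>i. \<bar>i - int m\<bar> \<le> int R \<longrightarrow> a i = a (i + int P)"
  proof (intro allI impI)
    fix i assume "\<bar>i - int m\<bar> \<le> int R"
    then have "int q \<le> i \<and> i \<le> int (q + 2 * R)" by (auto simp: m_def)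
    then show "a i = a (i + int P)" using q(3) by (simp add: P_def)
  qed
  have ag2: "\<forall>i. \<bar>i - int m'\<bar> \<le> int R \<longrightarrow> a i = a (i + - int P)"
  proof (intro allI impI)
    fix i assume "\<bar>i - int m'\<bar> \<le> int R"
    then have "int q \<le> i - int P \<and> i - int P \<le> int (q + 2 * R)" using mm by (auto simp: m_def)
    then show "a i = a (i + - int P)" using q(3) by (auto simp: P_def)
  qed
  have l1: "markov_lambda w1 0 \<le> t" by (rule splice_le[OF a(1,3) t gap conn R ag1 w1_def])
  have l2: "markov_lambda w2 0 \<le> t" by (rule splice_le[OF a(1,3) t gap conn R ag2 w2_def])
  have p: "pos_seq w1" "pos_seq w2" using a(1) by (simp_all add: w1_def w2_def pos_seq_def)
  have "lv w1 (-1) = lv a (-1)" "lv w2 (-1) = lv a (-1)"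
    by (rule lv_cong; simp add: w1_def w2_def)+
  then have r: "\<not> rv a 0 < rv w1 0" "\<not> rv a 0 < rv w2 0"
    using l1 l2 a(2) lam_eq[OF a(1), of 0] lam_eq[OF p(1), of 0] lam_eq[OF p(2), of 0] by auto
  have t1: "rv w1 (0 + int (m+1)) = rv a (int m + 1 + int P)"
  proof -
    have "rv w1 (int (m+1)) = rv (shift_seq (int P) a) (int (m+1))" by (rule rv_cong) (simp add: w1_def)
    then show ?thesis by (simp add: rv_shift add_ac)
  qed
  have t2: "rv w2 (0 + int (m'+1)) = rv a (int m + 1)"
  proof -
    have "rv w2 (int (m'+1)) = rv (shift_seq (- int P) a) (int (m'+1))" by (rule rv_cong) (simp add: w2_def)
    then show ?thesis by (simp add: rv_shift mm algebra_simps)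
  qed
  have s1: "\<forall>k<m+1. a (0 + int k) = w1 (0 + int k)" and s2: "\<forall>k<m'+1. a (0 + int k) = w2 (0 + int k)"
    by (auto simp: w1_def w2_def)
  \<comment> \<open>Both comparisons have the same direction, while the two tails exchange roles;
    together they give equality.\<close>
  have par: "even (m'+1) \<longleftrightarrow> even (m+1)" using q(2) by (simp add: mm P_def)
  have b: "0 + int (m+1) = int m + 1" "0 + int (m'+1) = int m + 1 + int P" by (simp_all add: mm)
  have "rv a (int m + 1) = rv a (int m + 1 + int P)"
    using r rv_steps_less[OF a(1) p(1) s1] rv_steps_less[OF a(1) p(2) s2]
    unfolding par b t1[unfolded b] t2[unfolded b] by (cases "even (m+1)") auto
  then have eq: "a (int m + 1 + int k) = a (int m + 1 + int P + int k)" for k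
    by (rule rv_inj[OF a(1) a(1)])
  have "\<forall>i\<ge>int m + 1. a (i + int P) = a i"
  proof (intro allI impI)
    fix i assume "int m + 1 \<le> i"
    then show "a (i + int P) = a i" using eq[of "nat (i - (int m + 1))"] by (simp add: add_ac)
  qed
  moreover have "1 \<le> P" using q(1) by (simp add: P_def)
  ultimately show ?thesis using periodic_extension[OF a(1)] by blast
qed

text \<open>Removing a common letter multiplies the distance by \<open>x * y > 1\<close>, for the
  quotients \<open>x\<close>, \<open>y\<close> after that letter.\<close>

lemma rv_expand:
  assumes "pos_seq a" "pos_seq b" "\<forall>k<n. a (i + int k) = b (i + int k)" "1 \<le> n" "rv a i \<noteq> rv b i"
  shows "\<bar>rv a i - rv b i\<bar> < \<bar>rv a (i + int n) - rv b (i + int n)\<bar>"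
  using assms(4,3,5)
proof (induction n arbitrary: i rule: dec_induct)
  case base
  define x y where "x = rv a (i+1)" and "y = rv b (i+1)"
  have xy: "1 < x" "1 < y" using rv_gt_1 assms by (auto simp: x_def y_def)
  have "a i = b i" using base by simp
  then have e: "rv a i - rv b i = 1/x - 1/y" using rv_step[OF assms(1), of i] rv_step[OF assms(2), of i] by (simp add: x_def y_def)
  have ne: "x \<noteq> y" using e base by auto
  have "1/x - 1/y = (y - x) / (x * y)" using xy by (simp add: field_simps)
  then have "\<bar>1/x - 1/y\<bar> = \<bar>x - y\<bar> / (x * y)" using xy by (simp add: abs_minus_commute)
  also have "\<dots> < \<bar>x - y\<bar> / 1" using ne less_1_mult[OF xy] by (intro divide_strict_left_mono) auto
  finally show ?case using e by (simp add: x_def y_def)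
next
  case (step n)
  have "\<bar>rv a i - rv b i\<bar> < \<bar>rv a (i + int n) - rv b (i + int n)\<bar>" using step by auto
  moreover have "\<bar>rv a (i + int n) - rv b (i + int n)\<bar> < \<bar>rv a (i + int n + 1) - rv b (i + int n + 1)\<bar>"
  proof -
    define x y where "x = rv a (i + int n + 1)" and "y = rv b (i + int n + 1)"
    have xy: "1 < x" "1 < y" using rv_gt_1 assms by (auto simp: x_def y_def)
    have "a (i + int n) = b (i + int n)" using step by simp
    then have e: "rv a (i + int n) - rv b (i + int n) = 1/x - 1/y"
      using rv_step[OF assms(1), of "i + int n"] rv_step[OF assms(2), of "i + int n"] by (simp add: x_def y_def)
    have ne: "x \<noteq> y" using e \<open>\<bar>rv a i - rv b i\<bar> < _\<close> by auto
    have "1/x - 1/y = (y - x) / (x * y)" using xy by (simp add: field_simps)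
    then have "\<bar>1/x - 1/y\<bar> = \<bar>x - y\<bar> / (x * y)" using xy by (simp add: abs_minus_commute)
    also have "\<dots> < \<bar>x - y\<bar> / 1" using ne less_1_mult[OF xy] by (intro divide_strict_left_mono) auto
    finally show ?thesis using e by (simp add: x_def y_def)
  qed
  ultimately show ?case by (simp add: add_ac)
qed

text \<open>Shifting by an even period moves a deviation on the upper side further up, so a sequence
  leaving a periodic one cannot attain its supremum before the deviation.\<close>
lemma periodic_not_left_rigid_limit:
  assumes a: "pos_seq a" "periodic_seq Q a" "markov_lambda a 0 = t"
    and b: "pos_seq b" "\<forall>i\<le>int (2 * Q). b i = a i" "\<forall>j. markov_lambda b j \<le> markov_lambda b 0"
  shows "markov_lambda b 0 = t"
proof (rule ccontr)
  assume ne: "markov_lambda b 0 \<noteq> t"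
  have Q: "1 \<le> Q" using a(2) by (simp add: periodic_seq_def)
  have per: "markov_lambda a (- int (n * Q)) = t" for n
  proof (induction n)
    case (Suc n)
    have "markov_lambda a (- int (Suc n * Q) + int Q) = markov_lambda a (- int (Suc n * Q))"
      by (rule periodic_lam[OF a(1,2)])
    then show ?case using Suc by simp
  qed (use a(3) in simp)
  \<comment> \<open>Far to the left \<open>b\<close> looks like \<open>a\<close>, so values near
    \<open>t\<close> recur there.\<close>
  have "t \<le> markov_lambda b 0"
  proof (rule le_by_err)
    fix n
    define M where "M = n * Q"
    have "n \<le> M" using Q by (simp add: M_def)
    then have "\<bar>markov_lambda b (- int M) - markov_lambda a (- int M)\<bar> \<le> 8 / 2^n"
      by (intro lam_close[OF b(1) a(1)]) (use b(2) in auto)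
    then show "t \<le> markov_lambda b 0 + 8 / 2^n"
      using per[of n, folded M_def] b(3)[rule_format, of "- int M"] by linarith
  qed
  then have gt: "t < markov_lambda b 0" using ne by simp
  have l0: "lv b (-1) = lv a (-1)" by (rule lv_cong) (use b(2) in auto)
  then have r0: "rv a 0 < rv b 0" using gt a(3) lam_eq[OF a(1), of 0] lam_eq[OF b(1), of 0] by simp
  \<comment> \<open>Two periods make an even number of letters whatever the parity of
    \<open>Q\<close>, so the deviation keeps its direction.\<close>
  have ag: "\<forall>k<2*Q. a (0 + int k) = b (0 + int k)" using b(2) by auto
  have rp: "rv a (int (2 * Q)) = rv a 0"
    using periodic_rv[OF a(2), of 0] periodic_rv[OF a(2), of "int Q"] by simp
  have "rv a 0 < rv b (int (2 * Q))" using rv_steps_less[OF a(1) b(1) ag] r0 rp by simp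
  moreover have "\<bar>rv a 0 - rv b 0\<bar> < \<bar>rv a (0 + int (2 * Q)) - rv b (0 + int (2 * Q))\<bar>"
    by (rule rv_expand[OF a(1) b(1) ag]) (use Q r0 in auto)
  ultimately have "rv b 0 < rv b (int (2 * Q))" using r0 rp by simp
  moreover have "lv b (int (2 * Q) - 1) = lv a (int (2 * Q) - 1)" by (rule lv_cong) (use b(2) in auto)
  moreover have "lv a (int (2 * Q) - 1) = lv a (-1)"
    using periodic_lv[OF a(2), of "-1"] periodic_lv[OF a(2), of "int Q - 1"] by (simp add: algebra_simps)
  ultimately have "markov_lambda b 0 < markov_lambda b (int (2 * Q))"
    using l0 lam_eq[OF b(1), of 0] lam_eq[OF b(1), of "int (2 * Q)"] by simp
  then show False using b(3) by (meson not_le)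
qed

section \<open>Combining the cases\<close>

text \<open>Connect both halves to the 1s and join them at 0. At the left end all letters are 1, so
  \<lambda> < 3 < s there.\<close>

lemma flexible_both_sides:
  assumes a: "pos_seq a" "markov_lambda a 0 = t" and t: "3 < t" and "0 < e"
    and conn: "right_connected a t" "right_connected (rev_seq a) t"
  shows "\<exists>c s. perturbable c s \<and> \<bar>s - t\<bar> < e"
proof -
  define e' where "e' = min e (t - 3) / 4"
  have e': "0 < e'" "4 * e' \<le> e" "4 * e' \<le> t - 3" using \<open>0 < e\<close> t by (auto simp: e'_def)
  obtain N where N: "8 / 2^N < e'" using err_small[OF e'(1)] by blast
  obtain c K where c: "pos_seq c" "\<forall>i\<le>int N. c i = a i" "\<forall>i\<ge>K. c i = 1" "\<forall>j. markov_lambda c j \<le> t + e'"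
    using conn(1) e'(1) unfolding right_connected_def by blast
  obtain d L where d: "pos_seq d" "\<forall>i\<le>int N. d i = rev_seq a i" "\<forall>i\<ge>L. d i = 1" "\<forall>j. markov_lambda d j \<le> t + e'"
    using conn(2) e'(1) unfolding right_connected_def by blast
  have pr: "pos_seq (rev_seq d)" using d(1) by simp
  have ag: "\<forall>i. \<bar>i - 0\<bar> \<le> int N \<longrightarrow> rev_seq d i = c i" using c(2) d(2) by auto
  have lr: "\<forall>j. markov_lambda (rev_seq d) j \<le> t + e'" using d(1,4) by (simp add: lam_rev)
  define g where "g = (\<lambda>i. if i \<le> 0 then rev_seq d i else c i)"
  note gl = glue[OF pr c(1) ag g_def lr c(4)]
  have "\<bar>markov_lambda g 0 - markov_lambda a 0\<bar> \<le> 8 / 2^N"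
    by (rule lam_close[OF gl(1) a(1)]) (use c(2) d(2) in \<open>auto simp: g_def\<close>)
  then have g0: "t - e' < markov_lambda g 0" using N a(2) by linarith
  have up: "\<forall>j. markov_lambda g j \<le> t + 2 * e'"
  proof
    fix j show "markov_lambda g j \<le> t + 2 * e'" using gl(2)[of j] N by linarith
  qed
  obtain s where s: "lam_sup g s" "s \<le> t + 2 * e'" using bounded_lam_sup[OF up] by blast
  have s0: "t - e' < s" using g0 s(1) unfolding lam_sup_def by (meson less_le_trans)
  have s3: "3 < s" using s0 e' by linarith
  have "perturbable g s" unfolding perturbable_def
  proof (intro conjI)
    show "\<exists>K. \<forall>i\<ge>K. g i = 1" using c(3) by (intro exI[of _ "max 1 K"]) (auto simp: g_def)
    show "\<exists>d>0. \<exists>J. \<forall>j\<le>J. markov_lambda g j \<le> s - d"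
    proof (rule exI[of _ "s - 3"], intro conjI exI[of _ "min 0 (- L)"] allI impI)
      fix j assume "j \<le> min 0 (- L)"
      then have "g j = 1" using d(3) by (auto simp: g_def)
      then show "markov_lambda g j \<le> s - (s - 3)" using lam_lt[OF gl(1), of j] by simp
    qed (use s3 in simp)
  qed (use gl(1) s s3 in auto)
  moreover have "\<bar>s - t\<bar> < e" using s0 s(2) e' by linarith
  ultimately show ?thesis by blast
qed

text \<open>The left half is kept as it is; far to the left \<lambda> is close to values of
  \<open>f\<close>, which stay \<open>d\<close> below \<open>t\<close>.\<close>

lemma low_left_end:
  assumes a: "pos_seq a" "markov_lambda a 0 = t" and t: "3 < t" and "0 < e" and conn: "right_connected a t"
    and left: "pos_seq f" "\<forall>i\<le>I. a i = f i" "\<forall>j. markov_lambda f j \<le> t - d" "0 < d"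
  shows "\<exists>c s. perturbable c s \<and> \<bar>s - t\<bar> < e"
proof -
  define e' where "e' = min (min e d) (t - 3) / 4"
  have e': "0 < e'" "4 * e' \<le> e" "4 * e' \<le> t - 3" "4 * e' \<le> d" using \<open>0 < e\<close> t left(4) by (auto simp: e'_def)
  obtain N where N: "8 / 2^N < e'" using err_small[OF e'(1)] by blast
  obtain c K where c: "pos_seq c" "\<forall>i\<le>int N. c i = a i" "\<forall>i\<ge>K. c i = 1" "\<forall>j. markov_lambda c j \<le> t + e'"
    using conn(1) e'(1) unfolding right_connected_def by blast
  have "\<bar>markov_lambda c 0 - markov_lambda a 0\<bar> \<le> 8 / 2^N"
    by (rule lam_close[OF c(1) a(1)]) (use c(2) in auto)
  then have c0: "t - e' < markov_lambda c 0" using N a(2) by linarith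
  obtain s where s: "lam_sup c s" "s \<le> t + e'" using bounded_lam_sup[OF c(4)] by blast
  have s0: "t - e' < s" using c0 s(1) unfolding lam_sup_def by (meson less_le_trans)
  have "perturbable c s" unfolding perturbable_def
  proof (intro conjI)
    show "\<exists>d>0. \<exists>J. \<forall>j\<le>J. markov_lambda c j \<le> s - d"
    proof (rule exI[of _ e'], intro conjI exI[of _ "min 0 I - int N"] allI impI)
      fix j assume j: "j \<le> min 0 I - int N"
      have "\<bar>markov_lambda c j - markov_lambda f j\<bar> \<le> 8 / 2^N"
        by (rule lam_close[OF c(1) left(1)]) (use j c(2) left(2) in auto)
      then show "markov_lambda c j \<le> s - e'" using left(3)[rule_format, of j] N s0 e' by linarith
    qed (rule e'(1))
    show "3 < s" using s0 e' by linarith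
  qed (use c s in auto)
  moreover have "\<bar>s - t\<bar> < e" using s0 s(2) e' by linarith
  ultimately show ?thesis by blast
qed

lemma periodic_max:
  assumes f: "pos_seq f" "periodic_seq P f" "\<forall>j. markov_lambda f j < t"
  shows "\<exists>d>0. \<forall>j. markov_lambda f j \<le> t - d"
proof -
  have P: "1 \<le> P" using f(2) by (simp add: periodic_seq_def)
  define m where "m = Max (markov_lambda f ` {0..<int P})"
  have fin: "finite (markov_lambda f ` {0..<int P})" "markov_lambda f ` {0..<int P} \<noteq> {}" using P by auto
  have "m < t" unfolding m_def using fin f(3) by (subst Max_less_iff) auto
  have shift: "markov_lambda f (j + int n * int P) = markov_lambda f j" for j n
  proof (induction n)
    case (Suc n)
    then show ?case using periodic_lam[OF f(1,2), of "j + int n * int P"] by (simp add: algebra_simps)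
  qed simp
  have "markov_lambda f j \<le> m" for j
  proof -
    define r where "r = j mod int P"
    have r: "r \<in> {0..<int P}" using P by (simp add: r_def)
    have "markov_lambda f j = markov_lambda f r"
    proof (cases "0 \<le> j div int P")
      case True
      then show ?thesis using shift[of r "nat (j div int P)"] by (simp add: r_def)
    next
      case False
      then have "j + int (nat (- (j div int P))) * int P = r" by (simp add: r_def minus_div_mult_eq_mod)
      then show ?thesis using shift[of j "nat (- (j div int P))"] by simp
    qed
    also have "\<dots> \<le> m" unfolding m_def using fin(1) r by (intro Max_ge) auto
    finally show ?thesis .
  qed
  then show ?thesis using \<open>m < t\<close> by (intro exI[of _ "t - m"]) auto
qed

text \<open>The negation is used as a gap \<open>e\<close> around \<open>t\<close> without values of
  perturbable sequences. Connection on the left is a conditional assumption, because the left half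
  may be rigid.\<close>

lemma spectrum_limit_islimpt2:
  assumes sl: "spectrum_limit a t" and t: "3 < t" and conn: "right_connected a t"
    and conn': "right_flexible (rev_seq a) t \<longrightarrow> right_connected (rev_seq a) t"
  shows "t islimpt spectrum_limits"
proof (rule ccontr)
  assume "\<not> ?thesis"
  then have "\<not> (\<forall>e>0. \<exists>c s. perturbable c s \<and> \<bar>s - t\<bar> < e)" using islimpt2_approx by blast
  then obtain e where e: "0 < e" "\<not> (\<exists>c s. perturbable c s \<and> \<bar>s - t\<bar> < e)" by blast
  then have gap: "\<forall>c s. perturbable c s \<longrightarrow> e \<le> \<bar>s - t\<bar>" by (meson not_le)
  have a: "pos_seq a" "markov_lambda a 0 = t" "\<forall>j. markov_lambda a j \<le> t"
    using sl by (auto simp: spectrum_limit_def)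
  have r: "pos_seq (rev_seq a)" "markov_lambda (rev_seq a) 0 = t" "\<forall>j. markov_lambda (rev_seq a) j \<le> t"
    using a by (auto simp: lam_rev)
  have nf: "\<not> right_flexible (rev_seq a) t"
    using flexible_both_sides[OF a(1,2) t e(1) conn] conn' e(2) by blast
  obtain P f I where f: "pos_seq f" "periodic_seq P f" "\<forall>i\<ge>I. rev_seq a i = f i"
    using rigid_periodic[OF nf r(1,3)] by blast
  have lf: "\<forall>j. markov_lambda f j \<le> t" using periodic_tail_le[OF r(1,3) f] by blast
  define h where "h = rev_seq f"
  have h: "pos_seq h" "periodic_seq P h" "\<forall>i\<le>- I. a i = h i" "\<forall>j. markov_lambda h j \<le> t"
  proof -
    show "pos_seq h" "periodic_seq P h" using f periodic_rev by (auto simp: h_def)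
    show "\<forall>i\<le>- I. a i = h i"
    proof (intro allI impI)
      fix i assume "i \<le> - I" then show "a i = h i" using f(3)[rule_format, of "- i"] by (simp add: h_def)
    qed
    show "\<forall>j. markov_lambda h j \<le> t" using lf f(1) by (simp add: h_def lam_rev)
  qed
  show False
  proof (cases "\<forall>j. markov_lambda h j < t")
    case True
    then obtain d where "0 < d" "\<forall>j. markov_lambda h j \<le> t - d" using periodic_max[OF h(1,2)] by blast
    then show False using low_left_end[OF a(1,2) t e(1) conn h(1,3)] e(2) by blast
  next
    case False
    then obtain j0 where j0: "markov_lambda h j0 = t" using h(4) by (metis order_less_le)
    obtain Q g J where g: "pos_seq g" "periodic_seq Q g" "\<forall>i\<ge>J. a i = g i"
      using connected_periodic[OF a t gap e(1) conn] by blast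
    have lg: "\<forall>j. markov_lambda g j \<le> t" using periodic_tail_le[OF a(1,3) g] by blast
    have "a = g" by (rule biperiodic_is_periodic[OF a(1) h(1) g(1) h(2) g(2) h(3) g(3) a(2) j0 h(4) lg]) (use t in simp)
    then have per: "periodic_seq Q a" using g(2) by simp
    obtain N0 where N0: "\<And>b. pos_seq b \<Longrightarrow> (\<forall>i. \<bar>i\<bar> \<le> int N0 \<longrightarrow> b i = rev_seq a i) \<Longrightarrow>
       (\<forall>j. markov_lambda b j \<le> markov_lambda b 0) \<Longrightarrow> (\<forall>i\<ge>0. b i = rev_seq a i)"
      using tail_rigid[OF nf r] by blast
    \<comment> \<open>The window of radius \<open>2 * Q\<close> and rigidity on the left together
      give agreement at all positions up to \<open>2 * Q\<close>.\<close>
    obtain b where b: "pos_seq b" "\<forall>i. \<bar>i\<bar> \<le> int (max N0 (2 * Q)) \<longrightarrow> b i = a i"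
        "\<forall>j. markov_lambda b j \<le> markov_lambda b 0" "markov_lambda b 0 \<noteq> t"
      using sl unfolding spectrum_limit_def by blast
    have left: "\<forall>i\<ge>0. rev_seq b i = rev_seq a i" by (rule N0[of "rev_seq b"]) (use b in \<open>auto simp: lam_rev\<close>)
    have "\<forall>i\<le>int (2 * Q). b i = a i"
    proof (intro allI impI)
      fix i assume "i \<le> int (2 * Q)"
      then show "b i = a i" using b(2) left[rule_format, of "- i"] by (cases "0 \<le> i") auto
    qed
    then show False using periodic_not_left_rigid_limit[OF a(1) per a(2) b(1) _ b(3)] b(4) by blast
  qed
qed

theorem theorem1p5:
  fixes \<nu> \<mu> :: real
  assumes "good_interval \<nu> \<mu>"
  shows "accumulation_points markov_spectrum \<inter> {\<nu>..<\<mu>} =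
         accumulation_points (accumulation_points markov_spectrum) \<inter> {\<nu>..<\<mu>}"
proof -
  have "t islimpt spectrum_limits" if t: "t islimpt markov_spectrum" "t \<in> {\<nu>..<\<mu>}" for t
  proof (cases "t = 3")
    case True
    then show ?thesis using three_islimpt2 by simp
  next
    case False
    then have t3: "3 < t" using islimpt_ge_3[OF t(1)] by simp
    obtain I :: "(real \<times> real) set" where I: "{\<nu>..<\<mu>} \<subseteq> (\<Union>(x, y)\<in>I. {x..<y})"
      "\<forall>(x, y)\<in>I. \<exists>B C. associated_subshifts x y B C"
      using assms unfolding good_interval_def by blast
    obtain x y where xy: "(x, y) \<in> I" "x \<le> t" "t < y" using I(1) t(2) by auto
    obtain B C where assoc: "associated_subshifts x y B C" using I(2) xy(1) by blast
    obtain a where sl: "spectrum_limit a t" using islimpt_spectrum_limit[OF t(1)] by blast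
    have conn: "right_flexible b t \<longrightarrow> right_connected b t" if "spectrum_limit b t" for b
      using right_flexible_connected[OF assoc t3 xy(2,3), of b] that
      unfolding spectrum_limit_def by blast
    note slr = spectrum_limit_rev[OF sl]
    consider "right_flexible a t" | "right_flexible (rev_seq a) t" using flexible_dichotomy[OF sl] by blast
    then show ?thesis
    proof cases
      case 1
      then show ?thesis using spectrum_limit_islimpt2[OF sl t3] conn[OF sl] conn[OF slr] by blast
    next
      case 2
      \<comment> \<open>The flexible side has to be the right one, so the reversed sequence takes
        the place of \<open>a\<close>.\<close>
      then show ?thesis using spectrum_limit_islimpt2[OF slr t3] conn[OF sl] conn[OF slr] by simp
    qed
  qed
  then show ?thesis
    unfolding accumulation_points_def using limpt_of_limpts by auto
qed

end
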